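(* Let $n\in\mathbb Z^+$, let $D$ be a Hadamard plan of index $n$, and let $\rho\in\mathbb R$. Let $\{A_\iota\}_{\iota\in I}$ be a coherently $\rho$-rotated family of instances (or a coherently $\rho$-rotated family of unimodularized instances) of $D$. Then $\mathrm{CDF}(A_\iota)$ tends to \[1+\frac{1}{3(n-1)}+\frac{1}{n-1}\Phi(2\rho)\] as $\mathrm{SDC}(A_\iota)$ tends to infinity. For fixed $n$, this limit achieves its global minimum value $1+\frac{1}{6(n-1)}$ if and only if $\rho\in\{(2m+1)/4: m\in\mathbb Z\}$.
   Context: An aperiodic sequence is a function $f:\mathbb Z\to\mathbb C$ with finitely many nonzero values. For aperiodic $f,g$ and $s\in\mathbb Z$, $C_{f,g}(s)=\sum_{j\in\mathbb Z}f_{j+s}\overline{g_j}$. A codebook is a finite set of aperiodic sequences; $\mathrm{SDC}(F)=\min_{f\in F}C_{f,f}(0)$. For nonzero $f,g$, $\mathrm{CDF}(f,g)=\sum_{s\in\mathbb Z}|C_{f,g}(s)|^2/(C_{f,f}(0)C_{g,g}(0))$, and for a codebook $F$ of nonzero sequences, $\mathrm{CDF}(F)=|F|^{-2}\sum_{f,g\in F}\mathrm{CDF}(f,g)$ (the sum includes $f=g$). A periodic sequence of length $\ell$ is $g:\mathbb Z/\ell\mathbb Z\to\mathbb C$; its rotation $g^{(r)}$ ($r\in\mathbb Z$) is the aperiodic sequence with $g^{(r)}_j=g_{r+j}$ for $0\le j\le\ell-1$ and $0$ otherwise. For each prime $p$, $\alpha_p$ is a fixed primitive element of $\mathbb F_p$,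 and for $n\mid p-1$, $\mathbb F_p^{*n}$ is the subgroup of $n$th powers. A cyclotomic pattern of index $n$ is $d:\mathbb Z/n\mathbb Z\to\mathbb C$; for a prime $p\equiv1\pmod n$ the periodic sequence of length $p$ from $d$ is $f$ with $f_0=0$ and $f_h=d_k$ for $h\in\alpha_p^k\mathbb F_p^{*n}$; if $d$ is unimodular, a unimodularized periodic sequence of length $p$ from $d$ is obtained from $f$ by replacing $f_0$ with a complex number of modulus $1$. A cyclotomic plan of index $n$ is a finite set of cyclotomic patterns of index $n$. A Hadamard plan of index $n$ is a cyclotomic plan $D$ of index $n$ with exactly $n-1$ patterns, each unimodular (all entries of modulus $1$) and balanced (entries sum to $0$), and pairwise orthogonal in $\mathbb C^n$. A family $\{A_\iota\}_{\iota\in I}$ is a coherently $\rho$-rotated family of instances (resp. unimodularized instances) of $D$ if there are primes $p_\iota\equiv1\pmod n$ with $\{p_\iota\}$ unbounded and functions $r_\iota:D\to\mathbb Z$ such that $A_\iota=\{f_{\iota,d}^{(r_\iota(d))}:d\in D\}$, where $f_{\iota,d}$ is the periodic sequence (resp. a unimodularized periodic sequence) of length $p_\iota$ from $d$, and for every $d\in D$, $r_\iota(d)/p_\iota\to\rho$ as $p_\iota\to\infty$. $\Phi:\mathbb R\to\mathbb R$ is the function of period $1$ with $\Phi(x)=2(x-\tfrac12)^2-\tfrac16$ for $0\le x\le1$. *)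

theory Defs
  imports Complex_Main "HOL-Number_Theory.Number_Theory"
begin

(* Aperiodic sequences: int \<Rightarrow> complex with finitely many nonzero values. *)
definition aperiodic :: "(int \<Rightarrow> complex) \<Rightarrow> bool" where
  "aperiodic f \<longleftrightarrow> finite {j. f j \<noteq> 0}"

(* C_{f,g}(s) = sum_j f_{j+s} conj(g_j); only finitely many nonzero terms. *)
definition crosscorr :: "(int \<Rightarrow> complex) \<Rightarrow> (int \<Rightarrow> complex) \<Rightarrow> int \<Rightarrow> complex" where
  "crosscorr f g s = (\<Sum>j\<in>{j. f (j + s) \<noteq> 0 \<and> g j \<noteq> 0}. f (j + s) * cnj (g j))"

(* C_{f,f}(0) is a nonnegative real; SDC(F) = min_{f in F} C_{f,f}(0) *)
definition SDC :: "(int \<Rightarrow> complex) set \<Rightarrow> real" where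
  "SDC F = Min ((\<lambda>f. Re (crosscorr f f 0)) ` F)"

definition CDF_pair :: "(int \<Rightarrow> complex) \<Rightarrow> (int \<Rightarrow> complex) \<Rightarrow> real" where
  "CDF_pair f g = (\<Sum>s\<in>{s. crosscorr f g s \<noteq> 0}. (cmod (crosscorr f g s))\<^sup>2)
                  / (Re (crosscorr f f 0) * Re (crosscorr g g 0))"

definition CDF :: "(int \<Rightarrow> complex) set \<Rightarrow> real" where
  "CDF F = (\<Sum>f\<in>F. \<Sum>g\<in>F. CDF_pair f g) / (real (card F))\<^sup>2"

(* Periodic sequences of length l are represented as l-periodic functions int \<Rightarrow> complex
   (read through h mod l).  Rotation g^{(r)}. *)
definition rotation :: "nat \<Rightarrow> (int \<Rightarrow> complex) \<Rightarrow> int \<Rightarrow> (int \<Rightarrow> complex)" where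
  "rotation l g r = (\<lambda>j. if 0 \<le> j \<and> j < int l then g ((r + j) mod int l) else 0)"

(* Cyclotomic pattern of index n: a list of length n (d_k = d ! k, k in Z/nZ).
   For h not divisible by p, cyc_class a p n h is the k < n with h in a^k F_p^{*n}. *)
definition cyc_class :: "nat \<Rightarrow> nat \<Rightarrow> nat \<Rightarrow> int \<Rightarrow> nat" where
  "cyc_class a p n h = (THE k. k < n \<and> (\<exists>x::int. [h = int a ^ k * x ^ n] (mod int p)))"

(* periodic sequence of length p from d (with value c at position 0: c = 0 gives the
   plain periodic sequence, |c| = 1 a unimodularized one); alpha is the choice of
   primitive elements *)
definition cyc_seq :: "(nat \<Rightarrow> nat) \<Rightarrow> nat \<Rightarrow> nat \<Rightarrow> complex list \<Rightarrow> complex \<Rightarrow> int \<Rightarrow> complex" where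
  "cyc_seq alpha p n d c h =
     (if h mod int p = 0 then c else d ! cyc_class (alpha p) p n (h mod int p))"

definition unimodular :: "complex list \<Rightarrow> bool" where
  "unimodular d \<longleftrightarrow> (\<forall>z\<in>set d. cmod z = 1)"

definition balanced :: "complex list \<Rightarrow> bool" where
  "balanced d \<longleftrightarrow> sum_list d = 0"

definition orthogonal_patterns :: "complex list \<Rightarrow> complex list \<Rightarrow> bool" where
  "orthogonal_patterns d e \<longleftrightarrow> (\<Sum>k<length d. d ! k * cnj (e ! k)) = 0"

definition hadamard_plan :: "nat \<Rightarrow> complex list set \<Rightarrow> bool" where
  "hadamard_plan n D \<longleftrightarrow> finite D \<and> card D = n - 1 \<and>
     (\<forall>d\<in>D. length d = n \<and> unimodular d \<and> balanced d) \<and>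
     (\<forall>d\<in>D. \<forall>e\<in>D. d \<noteq> e \<longrightarrow> orthogonal_patterns d e)"

(* Phi: period 1, Phi(x) = 2(x-1/2)^2 - 1/6 on [0,1] *)
definition Phi :: "real \<Rightarrow> real" where
  "Phi x = 2 * (frac x - 1/2)\<^sup>2 - 1/6"

(* The family {A_iota}: primes p iota, rotations r iota d, and values c iota d at
   position 0 (all 0 for instances; all of modulus 1 for unimodularized instances). *)
definition family_codebook ::
  "(nat \<Rightarrow> nat) \<Rightarrow> nat \<Rightarrow> complex list set \<Rightarrow> nat \<Rightarrow> (complex list \<Rightarrow> int)
     \<Rightarrow> (complex list \<Rightarrow> complex) \<Rightarrow> (int \<Rightarrow> complex) set" where
  "family_codebook alpha n D p r c =
     (\<lambda>d. rotation p (cyc_seq alpha p n d (c d)) (r d)) ` D"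

end

theory Submission
  imports Defs "Berlekamp_Zassenhaus.Finite_Field" "HOL-Analysis.Analysis" "HOL-Real_Asymp.Real_Asymp"
    "HOL-Library.Discrete_Functions"
begin

text \<open>
  Write \<open>E(f, g) = \<Sum>\<^sub>s |C\<^sub>f\<^sub>,\<^sub>g(s)|\<^sup>2\<close>. Sampling the generating polynomials of two sequences of length \<open>p\<close>
  at the \<open>2p\<close>-th roots of unity turns \<open>2p E(f, g)\<close> into \<open>\<Sum>\<^sub>k |F(k)|\<^sup>2 |G(k)|\<^sup>2\<close>. At even \<open>k\<close> the samples are
  values of the finite Fourier transform, which for a balanced cyclotomic pattern is \<open>\<surd>p\<close> times another
  cyclotomic pattern; at odd \<open>k\<close> they are interpolated from these values by a kernel of
  logarithmic \<open>\<ell>\<^sup>1\<close>-norm. So \<open>E\<close> is a weighted sum of fourfold correlations of cyclotomic patterns at shifted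
  arguments. Up to \<open>O(\<surd>p)\<close> these behave as if cyclotomic classes at distinct shifts were independent, so
  only coinciding shifts contribute. Summing over a Hadamard plan, the transformed patterns together with the
  constant pattern form an orthogonal basis, and the averages become explicit; the remaining dependence on the
  rotation is \<open>|\<Sum>\<^sub>b K(b)\<^sup>2 e(b(r + r')/p)|\<^sup>2\<close>, whose limit is a quadratic polynomial in the fractional part
  of \<open>2\<rho>\<close>.

  The independence of the classes is the Weil bound for multiplicative character sums over products of linear
  factors, which is proved by Stepanov's method. The non-vanishing of Stepanov's auxiliary polynomial
  rests on Kummer theory: \<open>Y\<^sup>n - f(z)/f(x)\<close> is irreducible over the rational functions in \<open>x\<close> and \<open>z\<close>.
\<close>

section \<open>Kummer irreducibility\<close>

text \<open>The samples at odd \<open>k\<close> couple all p transformed values, so the fourfold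
  correlations are needed for every quadruple of shifts with one common error. The kernel enters
  four times, hence the total error is of order \<open>sqrt p * (ln p) ^ 4\<close> against a main
  term of order p. Any power saving over p would do, so no sharp constants are sought. Origin of the
  limit: attach to a pair of patterns the averages B4, \<delta>, B3 of the coincidence cases. The
  even samples contribute B4 and the odd ones 1 + \<delta> + B3 v + (B4 - 1 - \<delta> - B3)/3,
  where v = (2 frac(2\<rho>) - 1)^2 and 1/3 is the limit of the fourth moment of the kernel. Over a
  plan with m = n - 1 patterns B4 sums to m^2, and \<delta> and B3 sum to m each. Half of the total
  is m^2 + m(1/3 + v)/2, and (1/3 + v)/2 = 1/3 + Phi(2\<rho>).\<close>

lemma power_mod_root_of_unity:
  fixes z :: "'a::monoid_mult"
  assumes "z ^ n = 1"
  shows "z ^ (i mod n) = z ^ i"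
proof -
  have "z ^ i = z ^ (n * (i div n) + i mod n)" by simp
  also have "\<dots> = z ^ (i mod n)" by (simp only: power_add power_mult assms) simp
  finally show ?thesis by simp
qed

text \<open>If \<open>y\<close> is a root of \<open>Y ^ n - u\<close>, its conjugates are
  \<open>z ^ \<sigma> * y\<close>. So this is the norm of \<open>A(y)\<close>, taken as a polynomial
  identity before reducing modulo \<open>Y ^ n - u\<close>.\<close>

definition twisted_norm :: "nat \<Rightarrow> 'a::idom \<Rightarrow> 'a poly \<Rightarrow> 'a poly" where
  "twisted_norm n z A = (\<Prod>\<sigma><n. A \<circ>\<^sub>p [:0, z ^ \<sigma>:])"

lemma pcompose_linear_twice: "(A \<circ>\<^sub>p [:0, a:]) \<circ>\<^sub>p [:0, b:] = A \<circ>\<^sub>p [:0, a * b :: 'a::idom:]"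
  by (rule poly_eqI) (simp add: coeff_pcompose_linear power_mult_distrib mult_ac)

lemma twisted_norm_invariant:
  assumes z: "z ^ n = 1"
  shows "twisted_norm n z A \<circ>\<^sub>p [:0, z:] = twisted_norm n z A"
proof (cases n)
  case (Suc m)
  have "twisted_norm n z A \<circ>\<^sub>p [:0, z:] = (\<Prod>\<sigma><n. A \<circ>\<^sub>p [:0, z ^ Suc \<sigma>:])"
    by (simp add: twisted_norm_def pcompose_prod pcompose_linear_twice mult.commute)
  also have "\<dots> = (\<Prod>\<sigma><m. A \<circ>\<^sub>p [:0, z ^ Suc \<sigma>:]) * (A \<circ>\<^sub>p [:0, z ^ 0:])"
    using z Suc by simp
  also have "\<dots> = twisted_norm n z A"
    unfolding twisted_norm_def Suc prod.lessThan_Suc_shift by (simp add: mult.commute)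
  finally show ?thesis .
qed (simp add: twisted_norm_def)

lemma degree_twisted_norm_le: "degree (twisted_norm n z A) \<le> n * degree A"
proof -
  have "degree (twisted_norm n z A) \<le> (\<Sum>\<sigma><n. degree (A \<circ>\<^sub>p [:0, z ^ \<sigma>:]))"
    unfolding twisted_norm_def by (rule order.trans[OF degree_prod_sum_le]) auto
  also have "\<dots> \<le> (\<Sum>\<sigma><n. degree A)"
    by (rule sum_mono) (simp add: degree_pcompose)
  finally show ?thesis by simp
qed

text \<open>Invariance under \<open>Y \<mapsto> zY\<close> kills every coefficient whose index is not divisible by \<open>n\<close>.\<close>

lemma twisted_norm_eq_pcompose:
  fixes z :: "'a::idom"
  assumes n: "n > 0" and z: "z ^ n = 1" and prim: "\<And>i. 0 < i \<Longrightarrow> i < n \<Longrightarrow> z ^ i \<noteq> 1"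
  obtains Q where "twisted_norm n z A = Q \<circ>\<^sub>p monom 1 n" "degree Q \<le> degree A"
    "\<And>i. coeff Q i = coeff (twisted_norm n z A) (n * i)"
proof -
  define P where "P = twisted_norm n z A"
  have c: "coeff P i = 0" if "i mod n \<noteq> 0" for i
  proof -
    have "z ^ i * coeff P i = coeff P i"
      using arg_cong[OF twisted_norm_invariant[OF z, of A], of "\<lambda>q. coeff q i"]
      by (simp add: coeff_pcompose_linear P_def)
    moreover have "z ^ i \<noteq> 1"
      using prim[of "i mod n"] that n power_mod_root_of_unity[OF z, of i] by simp
    ultimately show ?thesis by (metis mult_cancel_right1)
  qed
  have dP: "degree P \<le> n * degree A" using degree_twisted_norm_le unfolding P_def .
  define Q where "Q = Abs_poly (\<lambda>i. coeff P (n * i))"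
  have Qc: "coeff Q i = coeff P (n * i)" for i
    unfolding Q_def
  proof (subst coeff_Abs_poly[where n = "degree A"])
    fix i assume "i > degree A"
    hence "n * degree A < n * i" using n by simp
    thus "coeff P (n * i) = 0" using dP by (intro coeff_eq_0) linarith
  qed simp
  have "P = Q \<circ>\<^sub>p monom 1 n"
  proof (rule poly_eqI)
    fix i
    have i: "i = n * (i div n) + i mod n" by simp
    show "coeff P i = coeff (Q \<circ>\<^sub>p monom 1 n) i"
    proof (cases "i mod n = 0")
      case True
      thus ?thesis using coeff_pcompose_monom[of "i mod n" n Q "i div n"] n Qc i by simp
    next
      case False
      have "coeff (Q \<circ>\<^sub>p monom 1 n) i = 0"
        using coeff_pcompose_monom[of "i mod n" n Q "i div n"] n False by simp
      thus ?thesis using c[OF False] by simp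
    qed
  qed
  moreover have "degree Q \<le> degree A"
  proof (rule degree_le, safe)
    fix i assume "i > degree A"
    hence "n * degree A < n * i" using n by simp
    thus "coeff Q i = 0" unfolding Qc using dP by (intro coeff_eq_0) linarith
  qed
  ultimately show ?thesis using that[of Q] Qc unfolding P_def by blast
qed

text \<open>Multiplying two Bezout identities gives one for the product; it passes from the
  conjugates of \<open>A\<close> to their norm and from \<open>G\<close> to
  \<open>G ^ n\<close>.\<close>

lemma bezout_prod:
  fixes G :: "'a::comm_ring_1"
  assumes "finite S" "\<And>x. x \<in> S \<Longrightarrow> \<exists>a b. a * f x + b * G = 1"
  shows "\<exists>a b. a * prod f S + b * G = 1"
  using assms
proof (induction S)
  case empty
  show ?case by (intro exI[of _ 1] exI[of _ 0]) simp
next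
  case (insert x S)
  then obtain a b where 1: "a * prod f S + b * G = 1" by auto
  obtain c d where 2: "c * f x + d * G = 1" using insert.prems by blast
  have "(a * prod f S + b * G) * (c * f x + d * G) = 1" using 1 2 by simp
  hence "(a * c) * (f x * prod f S) + (a * prod f S * d + b * c * f x + b * d * G) * G = 1"
    by (simp add: algebra_simps)
  thus ?case using insert.hyps by auto
qed

text \<open>A nonzero element of least degree in the ideal generated by \<open>A\<close> and
  \<open>G\<close> divides the whole ideal, because remainders stay in the ideal.\<close>

lemma exists_monic_gcd:
  fixes A G :: "'a::field poly"
  assumes "A \<noteq> 0"
  obtains Q a b where "Q = a * A + b * G" "Q dvd A" "Q dvd G" "lead_coeff Q = 1"
proof -
  define X where "X = {Q. Q \<noteq> 0 \<and> (\<exists>a b. Q = a * A + b * G)}"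
  have "A \<in> X" using assms unfolding X_def by (auto intro: exI[of _ 1] exI[of _ 0] simp: exI[of "\<lambda>a. \<exists>b. A = a * A + b * G" 1] exI[of "\<lambda>b. A = 1 * A + b * G" 0])
  then obtain Q0 where Q0: "Q0 \<in> X" "\<And>R. R \<in> X \<Longrightarrow> degree Q0 \<le> degree R"
    using ex_has_least_nat[of "\<lambda>x. x \<in> X" A degree] by blast
  then obtain a b where ab: "Q0 = a * A + b * G" "Q0 \<noteq> 0" by (auto simp: X_def)
  have "Q0 dvd c * A + d * G" for c d
  proof (rule ccontr)
    assume "\<not> ?thesis"
    hence nz: "(c * A + d * G) mod Q0 \<noteq> 0" by (simp add: dvd_eq_mod_eq_0)
    have "(c * A + d * G) mod Q0 = (c * A + d * G) - (c * A + d * G) div Q0 * Q0"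
      by (simp add: minus_div_mult_eq_mod)
    also have "\<dots> = (c - (c * A + d * G) div Q0 * a) * A + (d - (c * A + d * G) div Q0 * b) * G"
    proof -
      have "(c * A + d * G) - q * Q0 = (c - q * a) * A + (d - q * b) * G" for q
        unfolding ab(1) by (simp add: algebra_simps)
      thus ?thesis .
    qed
    finally have "(c * A + d * G) mod Q0 \<in> X" using nz unfolding X_def by blast
    from Q0(2)[OF this] show False using degree_mod_less'[OF ab(2) nz] by simp
  qed
  from this[of 1 0] this[of 0 1] have dv: "Q0 dvd A" "Q0 dvd G" by auto
  define l where "l = inverse (lead_coeff Q0)"
  have l: "l \<noteq> 0" "lead_coeff (smult l Q0) = 1" using ab(2) by (auto simp: l_def)
  have 1: "smult l Q0 = smult l a * A + smult l b * G" unfolding ab(1) by (simp add: smult_add_right)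
  have 2: "smult l Q0 dvd A" "smult l Q0 dvd G" using dv l(1) by (simp_all add: smult_dvd_iff)
  show ?thesis by (rule that[OF 1 2 l(2)])
qed

text \<open>In a splitting field the constant term of a factor of degree t is, up to a root of
  unity, the t-th power of a root, so its n-th power is \<open>u ^ t\<close> up to sign. To avoid
  extending the field, the norm of \<open>Q\<close> is written as \<open>R(Y ^ n)\<close>,
  \<open>R\<close> is shown to be \<open>w * (X - u) ^ t\<close>, and constant terms are compared.
  Squaring removes the sign of \<open>(-u) ^ t\<close> and the unit \<open>w\<close>, whose square
  is 1.\<close>

lemma Kummer_irreducible_factor:
  fixes u z :: "'a::field"
  assumes n: "n > 0" and z: "z ^ n = 1" and prim: "\<And>i. 0 < i \<Longrightarrow> i < n \<Longrightarrow> z ^ i \<noteq> 1"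
    and Q: "Q dvd monom 1 n - [:u:]" "lead_coeff Q = 1"
  shows "(coeff Q 0 ^ 2) ^ n = (u ^ degree Q) ^ 2"
proof -
  define G where "G = monom 1 n - [:u:]"
  have G_comp: "[:-u, 1:] \<circ>\<^sub>p monom 1 n = G"
    by (simp add: G_def pcompose_pCons)
  have G_tw: "G \<circ>\<^sub>p [:0, z ^ \<sigma>:] = G" for \<sigma>
  proof (rule poly_eqI)
    fix i
    have "(z ^ \<sigma>) ^ n = 1" by (metis mult.commute power_mult power_one z)
    thus "coeff (G \<circ>\<^sub>p [:0, z ^ \<sigma>:]) i = coeff G i"
      by (auto simp: coeff_pcompose_linear G_def coeff_pCons split: nat.split)
  qed
  define P where "P = twisted_norm n z Q"
  obtain R where R: "P = R \<circ>\<^sub>p monom 1 n" "degree R \<le> degree Q" "\<And>i. coeff R i = coeff P (n * i)"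
    using twisted_norm_eq_pcompose[OF n z prim, of Q] unfolding P_def by blast
  have Qn: "Q \<noteq> 0" using Q(2) by auto
  have zn: "z \<noteq> 0" using z n by (metis power_0_left less_numeral_extra(3) zero_neq_one)
  have degl: "degree [:0, z ^ \<sigma>:] = 1" for \<sigma> using zn by simp
  have degtw: "degree (Q \<circ>\<^sub>p [:0, z ^ \<sigma>:]) = degree Q" for \<sigma> using degl by (simp only: degree_pcompose)
  have tw_nz: "Q \<circ>\<^sub>p [:0, z ^ \<sigma>:] \<noteq> 0" for \<sigma>
    using Qn zn by (auto simp: pcompose_eq_0_iff)
  have lctw: "lead_coeff (Q \<circ>\<^sub>p [:0, z ^ \<sigma>:]) = z ^ (\<sigma> * degree Q)" for \<sigma>
    using zn Q(2) by (subst lead_coeff_comp) (simp_all add: power_mult)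
  have degP: "degree P = n * degree Q"
    unfolding P_def twisted_norm_def by (subst degree_prod_eq_sum_degree) (use tw_nz degtw in \<open>simp_all del: degree_pcompose\<close>)
  have lcP: "lead_coeff P = (\<Prod>\<sigma><n. z ^ (\<sigma> * degree Q))"
    unfolding P_def twisted_norm_def lead_coeff_prod lctw ..
  have lcP2: "lead_coeff P ^ 2 = 1"
  proof -
    have "lead_coeff P = z ^ (degree Q * (\<Sum>\<sigma><n. \<sigma>))"
      unfolding lcP power_sum[symmetric] by (simp add: sum_distrib_left mult.commute)
    hence "lead_coeff P ^ 2 = z ^ (degree Q * (2 * (\<Sum>\<sigma><n. \<sigma>)))"
      by (simp add: power_mult[symmetric] mult_ac)
    also have "2 * (\<Sum>\<sigma><n. \<sigma>) = n * (n - 1)"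
    proof (induction n)
      case (Suc n)
      thus ?case by (cases n) (simp_all add: algebra_simps)
    qed simp
    also have "z ^ (degree Q * (n * (n - 1))) = 1"
      by (metis mult.left_commute power_mult power_one z)
    finally show ?thesis .
  qed
  have P_nz: "P \<noteq> 0" using tw_nz by (simp add: P_def twisted_norm_def)
  hence R_nz: "R \<noteq> 0" using R(1) by auto
  have "degree P = degree R * n" by (simp add: R(1) degree_pcompose degree_monom_eq)
  hence degR: "degree R = degree Q" using degP n by simp
  have lcR: "lead_coeff R = lead_coeff P" by (simp add: R(3) degR degP)
  have "P dvd (\<Prod>\<sigma><n. G)"
    unfolding P_def twisted_norm_def
  proof (rule prod_dvd_prod)
    fix \<sigma>
    obtain V where "G = Q * V" using Q(1) unfolding G_def[symmetric] by (elim dvdE)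
    hence "G \<circ>\<^sub>p [:0, z ^ \<sigma>:] = (Q \<circ>\<^sub>p [:0, z ^ \<sigma>:]) * (V \<circ>\<^sub>p [:0, z ^ \<sigma>:])"
      by (simp add: pcompose_mult)
    thus "Q \<circ>\<^sub>p [:0, z ^ \<sigma>:] dvd G" unfolding G_tw by simp
  qed
  hence PG: "P dvd G ^ n" by simp
  \<comment> \<open>\<open>W\<close> is the part of \<open>R\<close> prime to \<open>X - u\<close>.
    Then \<open>W(Y ^ n)\<close> is invertible modulo \<open>G\<close>, hence modulo
    \<open>G ^ n\<close>; but it divides \<open>P\<close>, which divides \<open>G ^ n\<close>, so it
    is constant.\<close>
  obtain W where W: "R = [:-u, 1:] ^ order u R * W" "\<not> [:-u, 1:] dvd W"
    using order_decomp[OF R_nz] by blast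
  define c where "c = poly W u"
  have c: "c \<noteq> 0" using W(2) by (simp add: c_def poly_eq_0_iff_dvd)
  have "[:-u, 1:] dvd W - [:c:]" by (simp add: poly_eq_0_iff_dvd[symmetric] c_def)
  then obtain V where V: "W - [:c:] = [:-u, 1:] * V" by (elim dvdE)
  define V' where "V' = V \<circ>\<^sub>p monom 1 n"
  define W' where "W' = W \<circ>\<^sub>p monom 1 n"
  have "(W - [:c:]) \<circ>\<^sub>p monom 1 n = ([:-u, 1:] * V) \<circ>\<^sub>p monom 1 n" by (simp only: V)
  hence W'eq: "W' = G * V' + [:c:]"
    unfolding pcompose_mult pcompose_diff G_comp V'_def[symmetric] W'_def[symmetric]
    by (simp add: algebra_simps)
  have bz: "(- smult (1/c) V') * G + [:1/c:] * W' = 1"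
    unfolding W'eq using c by (simp add: smult_add_right mult.commute one_pCons)
  have "\<exists>a b. a * (\<Prod>_\<in>{..<n}. G) + b * W' = 1"
    by (rule bezout_prod) (use bz in blast)+
  hence "\<exists>a b. a * G ^ n + b * (W \<circ>\<^sub>p monom 1 n) = 1" unfolding W'_def by simp
  then obtain a b where ab: "a * G ^ n + b * (W \<circ>\<^sub>p monom 1 n) = 1" by blast
  have "W dvd R" using W(1) by (metis dvd_triv_right)
  hence "W \<circ>\<^sub>p monom 1 n dvd P" unfolding R(1) by (auto elim!: dvdE simp: pcompose_mult)
  hence "W \<circ>\<^sub>p monom 1 n dvd a * G ^ n + b * (W \<circ>\<^sub>p monom 1 n)" using PG
    by (intro dvd_add dvd_mult) (auto intro: dvd_trans)
  hence "W \<circ>\<^sub>p monom 1 n dvd 1" unfolding ab .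
  hence "degree (W \<circ>\<^sub>p monom 1 n) = 0" by (simp add: poly_dvd_1)
  hence "degree W = 0" using n by (simp add: degree_pcompose degree_monom_eq)
  then obtain w where w: "W = [:w:]" by (auto elim: degree_eq_zeroE)
  have w0: "w \<noteq> 0" using w W(2) by auto
  have "degree ([:-u, 1:] ^ order u R * W) = order u R"
    unfolding w using w0 by (subst degree_mult_eq) (simp_all add: degree_power_eq)
  hence "degree R = order u R" using W(1) by simp
  hence ord: "order u R = degree Q" using degR by simp
  have R_eq: "R = [:-u, 1:] ^ degree Q * [:w:]" using W(1) unfolding ord w .
  have lw: "lead_coeff R = w" unfolding R_eq lead_coeff_mult lead_coeff_power by simp
  have "coeff P 0 = coeff R 0" using R(3)[of 0] by simp
  also have "\<dots> = (-u) ^ degree Q * w"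
    unfolding R_eq poly_0_coeff_0[symmetric] by (simp add: poly_power)
  finally have 1: "coeff P 0 = (-u) ^ degree Q * w" .
  have "coeff P 0 = (\<Prod>\<sigma><n. coeff Q 0)"
    unfolding P_def twisted_norm_def poly_0_coeff_0[symmetric] poly_prod by (simp add: poly_pcompose)
  hence "coeff Q 0 ^ n = (-u) ^ degree Q * w" using 1 by simp
  hence "(coeff Q 0 ^ n)\<^sup>2 = ((-u) ^ degree Q)\<^sup>2 * w\<^sup>2" by (simp add: power_mult_distrib)
  also have "w\<^sup>2 = 1" using lcP2 lcR lw by simp
  also have "((-u) ^ degree Q)\<^sup>2 = (u ^ degree Q)\<^sup>2"
    by (simp add: power_mult[symmetric] mult.commute[of _ 2])
  finally show ?thesis by (simp add: power_mult[symmetric] mult.commute)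
qed

text \<open>The gcd of \<open>A\<close> and \<open>Y ^ n - u\<close> has degree below
  \<open>n\<close>, so \<open>no_root\<close> forces it to be 1. As \<open>Y ^ n - u\<close> is
  fixed by \<open>Y \<mapsto> z Y\<close>, all conjugates of \<open>A\<close> are coprime to it as
  well, and therefore so is the norm that it is assumed to divide.\<close>

lemma Kummer_norm_eq_0:
  fixes u z :: "'a::field"
  assumes n: "n > 0" and z: "z ^ n = 1" and prim: "\<And>i. 0 < i \<Longrightarrow> i < n \<Longrightarrow> z ^ i \<noteq> 1"
    and no_root: "\<And>w t. 0 < t \<Longrightarrow> t < n \<Longrightarrow> (w ^ 2) ^ n \<noteq> (u ^ t) ^ 2"
    and dvd: "monom 1 n - [:u:] dvd twisted_norm n z A" and deg: "degree A < n"
  shows "A = 0"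
proof (rule ccontr)
  assume "A \<noteq> 0"
  define G where "G = monom 1 n - [:u:]"
  obtain Q a b where Q: "Q = a * A + b * G" "Q dvd A" "Q dvd G" "lead_coeff Q = 1"
    using exists_monic_gcd[OF \<open>A \<noteq> 0\<close>, of G] by blast
  have G_tw: "G \<circ>\<^sub>p [:0, z ^ \<sigma>:] = G" for \<sigma>
  proof (rule poly_eqI)
    fix i
    have "(z ^ \<sigma>) ^ n = 1" by (metis mult.commute power_mult power_one z)
    thus "coeff (G \<circ>\<^sub>p [:0, z ^ \<sigma>:]) i = coeff G i"
      by (auto simp: coeff_pcompose_linear G_def coeff_pCons split: nat.split)
  qed
  have dQ: "degree Q < n" using dvd_imp_degree_le[OF Q(2) \<open>A \<noteq> 0\<close>] deg by simp
  have "(coeff Q 0 ^ 2) ^ n = (u ^ degree Q) ^ 2"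
    using Q(3,4) by (intro Kummer_irreducible_factor[OF n z prim]) (simp_all add: G_def)
  hence "\<not> 0 < degree Q" using no_root[of "degree Q" "coeff Q 0"] dQ by auto
  hence "degree Q = 0" by simp
  then obtain q where "Q = [:q:]" by (rule degree_eq_zeroE)
  hence "Q = 1" using Q(4) by (simp add: one_pCons)
  have 1: "a * A + b * G = 1" by (rule trans[OF Q(1)[symmetric] \<open>Q = 1\<close>])
  have "\<exists>c d. c * (A \<circ>\<^sub>p [:0, z ^ \<sigma>:]) + d * G = 1" for \<sigma>
  proof -
    have "(a \<circ>\<^sub>p [:0, z ^ \<sigma>:]) * (A \<circ>\<^sub>p [:0, z ^ \<sigma>:]) + (b \<circ>\<^sub>p [:0, z ^ \<sigma>:]) * G = 1"
      using arg_cong[OF 1, of "\<lambda>x. x \<circ>\<^sub>p [:0, z ^ \<sigma>:]"]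
      by (simp only: pcompose_add pcompose_mult G_tw pcompose_1)
    thus ?thesis by blast
  qed
  hence "\<exists>c d. c * twisted_norm n z A + d * G = 1"
    unfolding twisted_norm_def by (rule bezout_prod[OF finite_lessThan])
  then obtain c d where cd: "c * twisted_norm n z A + d * G = 1" by blast
  have "G dvd c * twisted_norm n z A + d * G" 
    by (rule dvd_add[OF dvd_mult[OF dvd[folded G_def]] dvd_triv_right])
  hence "G dvd 1" unfolding cd .
  hence "degree G = 0" by (simp add: poly_dvd_1)
  moreover have "G = monom 1 n + - [:u:]" by (simp add: G_def)
  hence "degree G = degree (monom (1::'a) n)"
    by (simp only:) (rule degree_add_eq_left, subst degree_monom_eq, use n in simp_all)
  hence "degree G = n" by (simp add: degree_monom_eq)
  ultimately show False using n by simp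
qed

section \<open>Independence of the powers of a radical\<close>

text \<open>The outer variable will be the independent one that replaces \<open>x ^ p\<close>; the
  degree in \<open>x\<close>, which lives in the coefficients, is what must stay below
  \<open>p\<close>.\<close>

definition xdeg_le :: "nat \<Rightarrow> 'a::zero poly poly \<Rightarrow> bool" where
  "xdeg_le d b \<longleftrightarrow> (\<forall>k. degree (coeff b k) \<le> d)"

lemma xdeg_le_mono: "xdeg_le d b \<Longrightarrow> d \<le> e \<Longrightarrow> xdeg_le e b"
  unfolding xdeg_le_def using order.trans by blast

lemma xdeg_le_0 [simp]: "xdeg_le d 0" by (simp add: xdeg_le_def)

lemma xdeg_le_const: "degree q \<le> d \<Longrightarrow> xdeg_le d [:q:]"
  by (auto simp: xdeg_le_def coeff_pCons split: nat.split)

lemma xdeg_le_1 [simp]: "xdeg_le d 1"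
  unfolding one_pCons by (rule xdeg_le_const) simp

lemma xdeg_le_monom: "degree q \<le> d \<Longrightarrow> xdeg_le d (monom q k)"
  by (auto simp: xdeg_le_def)

lemma xdeg_le_sum:
  assumes "\<And>i. i \<in> S \<Longrightarrow> xdeg_le d (f i)"
  shows "xdeg_le d (sum f S)"
  using assms unfolding xdeg_le_def coeff_sum
  by (cases "finite S") (auto intro!: degree_sum_le)

lemma xdeg_le_mult:
  fixes a b :: "'a::comm_semiring_1 poly poly"
  assumes "xdeg_le d a" "xdeg_le e b"
  shows "xdeg_le (d + e) (a * b)"
  unfolding xdeg_le_def coeff_mult
proof (intro allI degree_sum_le)
  fix k i
  show "degree (coeff a i * coeff b (k - i)) \<le> d + e"
    using assms by (intro order.trans[OF degree_mult_le] add_mono) (auto simp: xdeg_le_def)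
qed simp

lemma xdeg_le_power:
  fixes a :: "'a::comm_semiring_1 poly poly"
  assumes "xdeg_le d a"
  shows "xdeg_le (k * d) (a ^ k)"
  by (induction k) (use assms in \<open>auto intro: xdeg_le_mult\<close>)

lemma xdeg_le_coeff_prod:
  fixes P :: "'b \<Rightarrow> 'a::comm_semiring_1 poly poly poly"
  assumes "finite S" "\<And>s i. s \<in> S \<Longrightarrow> xdeg_le d (coeff (P s) i)"
  shows "xdeg_le (card S * d) (coeff (prod P S) i)"
  using assms
proof (induction S arbitrary: i rule: finite_induct)
  case empty
  show ?case by (cases i) simp_all
next
  case (insert s S)
  have "xdeg_le (d + card S * d) (coeff (P s * prod P S) i)"
    unfolding coeff_mult by (intro xdeg_le_sum xdeg_le_mult) (use insert in auto)
  thus ?case using insert by simp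
qed

text \<open>Base-\<open>p\<close> digits: \<open>x\<close> and \<open>x ^ p\<close> are independent as long as the degree in \<open>x\<close> stays below \<open>p\<close>.\<close>

lemma poly_monom_eq_0_imp_eq_0:
  fixes b :: "'a::comm_ring_1 poly poly"
  assumes d: "xdeg_le d b" "d < p" and ev: "poly b (monom 1 p) = 0"
  shows "b = 0"
proof (rule poly_eqI, rule poly_eqI)
  fix k j
  show "coeff (coeff b k) j = coeff (coeff 0 k) j"
  proof (cases "j < p")
    case False
    have "degree (coeff b k) \<le> d" using d(1) by (simp add: xdeg_le_def)
    thus ?thesis using False d(2) by (simp add: coeff_eq_0)
  next
    case True
    have big: "coeff (coeff b i) m = 0" if "m \<ge> p" for i m
    proof -
      have "degree (coeff b i) \<le> d" using d(1) by (simp add: xdeg_le_def)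
      thus ?thesis using that d(2) by (intro coeff_eq_0) linarith
    qed
    have trm: "coeff (monom 1 (p * i) * coeff b i) (p * k + j) = (if i = k then coeff (coeff b k) j else 0)" for i
    proof -
      consider "i < k" | "i = k" | "i > k" by linarith
      thus ?thesis
      proof cases
        case 1
        hence "p * i + p \<le> p * k" by (metis Suc_leI mult_Suc_right add.commute mult_le_mono2)
        thus ?thesis using 1 big[of "p * k + j - p * i" i] by (simp add: coeff_monom_mult)
      next
        case 3
        hence "p * k + p \<le> p * i" by (metis Suc_leI mult_Suc_right add.commute mult_le_mono2)
        thus ?thesis using 3 True by (simp add: coeff_monom_mult)
      qed (simp add: coeff_monom_mult)
    qed
    have "0 = coeff (poly b (monom 1 p)) (p * k + j)" by (simp add: ev)
    also have "poly b (monom 1 p) = (\<Sum>i\<le>degree b. monom 1 (p * i) * coeff b i)"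
      by (simp add: poly_altdef monom_power mult.commute)
    also have "coeff \<dots> (p * k + j) = (\<Sum>i\<le>degree b. if i = k then coeff (coeff b k) j else 0)"
      by (simp only: coeff_sum trm)
    also have "\<dots> = coeff (coeff b k) j"
      by (simp add: coeff_eq_0)
    finally show ?thesis by simp
  qed
qed

text \<open>The Frobenius map is additive and fixes the coefficients, which lie in the prime
  field.\<close>

lemma pcompose_monom_card:
  fixes f :: "'a::prime_card mod_ring poly"
  shows "f \<circ>\<^sub>p monom 1 CARD('a) = f ^ CARD('a)"
proof (induction f)
  case (pCons a f)
  have "pCons a f = [:a:] + monom 1 1 * f" by (simp add: monom_altdef)
  hence "pCons a f ^ CARD('a) = [:a:] ^ CARD('a) + (monom 1 1 * f) ^ CARD('a)"
    by (simp only:) (rule freshmans_dream, use prime_card[where ?'a = 'a] in simp_all)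
  also have "\<dots> = [:a ^ CARD('a):] + monom 1 CARD('a) * f ^ CARD('a)"
    by (simp add: power_mult_distrib monom_power poly_const_pow)
  also have "a ^ CARD('a) = a" using finite_field_power_card_eq_same[of a] by simp
  finally show ?case using pCons.IH by (simp add: pcompose_pCons)
qed (simp add: prime_gt_0_nat[OF prime_card])

lemma order_power_eq:
  fixes p :: "'a::idom poly"
  assumes "p \<noteq> 0"
  shows "order a (p ^ k) = k * order a p"
  by (induction k) (use assms in \<open>auto simp: order_mult order_1_eq_0\<close>)

text \<open>Reads \<open>f\<close> as a polynomial in the new variable z: each root \<open>a\<close>
  becomes the constant polynomial \<open>[:a:]\<close> with the same multiplicity.\<close>

lemma order_map_poly_const:
  fixes f :: "'a::idom poly"
  assumes "f \<noteq> 0"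
  shows "order [:a:] (map_poly (\<lambda>c. [:c:]) f) = order a f"
proof -
  have hom: "map_poly (\<lambda>c. [:c:]) (p * q) = map_poly (\<lambda>c. [:c:]) p * map_poly (\<lambda>c. [:c:]) q" for p q :: "'a poly"
    by (rule poly_eqI) (simp add: coeff_map_poly coeff_mult sum_to_poly mult.commute)
  have hom_pow: "map_poly (\<lambda>c. [:c:]) (p ^ k) = map_poly (\<lambda>c. [:c:]) p ^ k" for p :: "'a poly" and k
    by (induction k) (simp_all add: hom one_pCons)
  obtain q where q: "f = [:-a, 1:] ^ order a f * q" "\<not> [:-a, 1:] dvd q"
    using order_decomp[OF assms] by blast
  define k where "k = order a f"
  have "poly q a \<noteq> 0" using q(2) by (simp add: poly_eq_0_iff_dvd)
  have "poly (map_poly (\<lambda>c. [:c:]) q) [:a:] = [:poly q a:]"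
    unfolding pcompose_altdef[symmetric] by (induction q) (simp_all add: pcompose_pCons)
  hence nz: "poly (map_poly (\<lambda>c. [:c:]) q) [:a:] \<noteq> 0" using \<open>poly q a \<noteq> 0\<close> by simp
  have "map_poly (\<lambda>c. [:c:]) [:-a, 1:] = [:-[:a:], 1:]"
    by (simp add: map_poly_pCons one_pCons)
  hence eq: "map_poly (\<lambda>c. [:c:]) f = [:-[:a:], 1:] ^ k * map_poly (\<lambda>c. [:c:]) q"
    by (subst q(1)) (simp only: hom hom_pow k_def)
  have "map_poly (\<lambda>c. [:c:]) q \<noteq> 0" using nz by auto
  hence "order [:a:] (map_poly (\<lambda>c. [:c:]) f) = order [:a:] ([:-[:a:], 1:] ^ k) + order [:a:] (map_poly (\<lambda>c. [:c:]) q)"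
    unfolding eq by (intro order_mult) simp
  also have "\<dots> = k" using order_0I[OF nz] by (simp only: order_power_n_n)
  finally show ?thesis unfolding k_def .
qed

section \<open>Passage to the field of fractions\<close>

lemma to_fract_power: "to_fract (a ^ k) = to_fract a ^ k"
  by (induction k) simp_all

lemma to_fract_sum: "to_fract (sum f S) = (\<Sum>x\<in>S. to_fract (f x))"
  by (induction S rule: infinite_finite_induct) simp_all

lemma map_poly_to_fract_mult:
  "map_poly to_fract (p * q) = map_poly to_fract p * map_poly to_fract (q :: 'a::idom poly)"
  by (rule poly_eqI) (simp add: coeff_map_poly coeff_mult to_fract_sum)

lemma map_poly_to_fract_twisted_norm:
  fixes A :: "'a::idom poly"
  shows "map_poly to_fract (twisted_norm n z A) = twisted_norm n (to_fract z) (map_poly to_fract A)"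
proof -
  have pr: "map_poly to_fract (\<Prod>s\<in>S. P s) = (\<Prod>s\<in>S. map_poly to_fract (P s))" for S and P :: "nat \<Rightarrow> 'a poly"
    by (induction S rule: infinite_finite_induct) (simp_all add: map_poly_to_fract_mult one_pCons map_poly_pCons)
  have "map_poly to_fract (A \<circ>\<^sub>p [:0, c:]) = map_poly to_fract A \<circ>\<^sub>p [:0, to_fract c:]" for c
    by (rule poly_eqI) (simp add: coeff_map_poly coeff_pcompose_linear to_fract_power)
  thus ?thesis unfolding twisted_norm_def pr by (simp add: to_fract_power)
qed

text \<open>Replace \<open>x ^ p\<close> by an independent variable \<open>z\<close>. The norm of the relation has degree less than \<open>p\<close> in \<open>x\<close>,
  hence vanishes identically in \<open>x\<close> and \<open>z\<close>, and Kummer theory over the field of fractions applies.\<close>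

lemma radical_relation_trivial:
  fixes f :: "'a::prime_card mod_ring poly" and z :: "'a mod_ring" and r :: "nat \<Rightarrow> nat \<Rightarrow> 'a mod_ring poly"
  assumes n: "n > 0" and nN: "n * N + 1 = CARD('a)"
    and z: "z ^ n = 1" and prim: "\<And>i. 0 < i \<Longrightarrow> i < n \<Longrightarrow> z ^ i \<noteq> 1"
    and f: "f \<noteq> 0" and ord: "\<And>t. (\<And>a. n dvd t * order a f) \<Longrightarrow> n dvd t"
    and deg: "\<And>j k. degree (r j k) \<le> d" and d: "n * d + (n - 1) * degree f < CARD('a)"
    and R: "(\<Sum>j<n. \<Sum>k<K. r j k * (f ^ N) ^ j * monom 1 (CARD('a) * k)) = 0"
    and jk: "j < n" "k < K"
  shows "r j k = 0"
proof -
  define p where "p = CARD('a)"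
  define A where "A j = (\<Sum>k<K. monom (r j k) k)" for j
  \<comment> \<open>Three layers of variables: the outermost Y stands for \<open>f ^ N\<close>, the
    middle one z for \<open>x ^ p\<close>, the innermost is \<open>x\<close>. The relation
    \<open>R\<close> says that \<open>AA\<close> vanishes at these values.\<close>
  define AA where "AA = (\<Sum>j<n. monom (A j) j)"
  define zz where "zz = [:[:z:]:]"
  define fz where "fz = map_poly (\<lambda>c. [:c:]) f"
  have zz_pow: "zz ^ i = [:[:z ^ i:]:]" for i by (simp add: zz_def poly_const_pow)
  have zz: "zz ^ n = 1" unfolding zz_pow z by (simp add: one_pCons)
  have zz_prim: "zz ^ i \<noteq> 1" if "0 < i" "i < n" for i
    unfolding zz_pow using prim[OF that] by (simp add: one_pCons)
  define P where "P = twisted_norm n zz AA"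
  have AA_coeff: "coeff AA i = (if i < n then A i else 0)" for i
    by (auto simp: AA_def coeff_sum)
  have degAA: "degree AA \<le> n - 1" using n by (intro degree_le) (auto simp: AA_coeff)
  obtain Q where Q: "P = Q \<circ>\<^sub>p monom 1 n" "degree Q \<le> degree AA" "\<And>i. coeff Q i = coeff P (n * i)"
    using twisted_norm_eq_pcompose[OF n zz zz_prim, of AA] unfolding P_def by blast
  have xA: "xdeg_le d (coeff AA i)" for i
    unfolding AA_coeff A_def by (auto intro!: xdeg_le_sum xdeg_le_monom deg)
  have xAs: "xdeg_le d (coeff (AA \<circ>\<^sub>p [:0, zz ^ \<sigma>:]) i)" for \<sigma> i
  proof -
    have "(zz ^ \<sigma>) ^ i = [:[:z ^ (\<sigma> * i):]:]" by (metis zz_pow power_mult)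
    hence "xdeg_le (0 + d) ((zz ^ \<sigma>) ^ i * coeff AA i)"
      by (simp only:) (intro xdeg_le_mult xA xdeg_le_const, simp)
    thus ?thesis by (simp add: coeff_pcompose_linear)
  qed
  have xP: "xdeg_le (n * d) (coeff P i)" for i
    using xdeg_le_coeff_prod[of "{..<n}" d "\<lambda>\<sigma>. AA \<circ>\<^sub>p [:0, zz ^ \<sigma>:]" i] xAs
    unfolding P_def twisted_norm_def by simp
  \<comment> \<open>This is \<open>f(x) ^ (n - 1) * Q(f(z) / f(x))\<close> with denominators
    cleared. Setting z to \<open>x ^ p\<close> gives a multiple of the norm at \<open>g\<close>,
    which is 0; the degree in \<open>x\<close> is below \<open>p\<close> by \<open>d\<close>, so
    \<open>T\<close> itself vanishes.\<close>
  define T where "T = (\<Sum>s<n. coeff Q s * (fz ^ s * [:f:] ^ (n - 1 - s)))"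
  have xfz: "xdeg_le 0 (fz ^ s)" for s
    using xdeg_le_power[of 0 fz s] by (simp add: fz_def xdeg_le_def coeff_map_poly)
  have xT: "xdeg_le (n * d + (0 + (n - 1) * degree f)) T"
    unfolding T_def
  proof (intro xdeg_le_sum xdeg_le_mult)
    fix s assume "s \<in> {..<n}"
    show "xdeg_le (n * d) (coeff Q s)" unfolding Q(3) by (rule xP)
    show "xdeg_le 0 (fz ^ s)" by (rule xfz)
    show "xdeg_le ((n - 1) * degree f) ([:f:] ^ (n - 1 - s))"
      by (rule xdeg_le_mono[OF xdeg_le_power[OF xdeg_le_const[OF order.refl]]], rule mult_le_mono1) simp
  qed
  define g where "g = f ^ N"
  \<comment> \<open>Here \<open>p = n * N + 1\<close> enters: \<open>g ^ n\<close> equals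
    \<open>f(x ^ p) / f(x)\<close>, so \<open>g\<close> is a radical of the element \<open>u\<close>
    below, specialised at z = \<open>x ^ p\<close>.\<close>
  have fp: "poly fz (monom 1 p) = f * g ^ n"
  proof -
    have "poly fz (monom 1 p) = f ^ p"
      unfolding fz_def pcompose_altdef[symmetric] p_def by (rule pcompose_monom_card)
    also have "\<dots> = f * g ^ n"
      unfolding p_def nN[symmetric] g_def by (simp add: power_mult[symmetric] mult.commute)
    finally show ?thesis .
  qed
  have evP: "poly (poly P [:g:]) (monom 1 p) = 0"
  proof -
    have "poly (poly AA [:g:]) (monom 1 p) = (\<Sum>j<n. \<Sum>k<K. r j k * monom 1 (p * k) * g ^ j)"
      by (simp add: AA_def A_def poly_sum poly_monom monom_power poly_const_pow sum_distrib_left sum_distrib_right mult_ac)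
    also have "\<dots> = 0" using R unfolding p_def g_def by (simp add: mult_ac)
    finally have 0: "poly (poly AA [:g:]) (monom 1 p) = 0" .
    have "poly (poly P [:g:]) (monom 1 p) = (\<Prod>\<sigma><n. poly (poly AA (zz ^ \<sigma> * [:g:])) (monom 1 p))"
      by (simp add: P_def twisted_norm_def poly_prod poly_pcompose mult.commute)
    also have "\<dots> = 0"
      using 0 n by (intro prod_zero[OF finite_lessThan] bexI[of _ 0]) auto
    finally show ?thesis .
  qed
  have "poly T (monom 1 p) = (\<Sum>s<n. f ^ (n - 1) * (poly (coeff Q s) (monom 1 p) * (g ^ n) ^ s))"
    unfolding T_def poly_sum
  proof (rule sum.cong[OF refl])
    fix s assume "s \<in> {..<n}"
    hence "f ^ (n - 1) = f ^ s * f ^ (n - 1 - s)" by (simp add: power_add[symmetric])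
    thus "poly (coeff Q s * (fz ^ s * [:f:] ^ (n - 1 - s))) (monom 1 p) =
       f ^ (n - 1) * (poly (coeff Q s) (monom 1 p) * (g ^ n) ^ s)"
      by (simp add: fp power_mult_distrib poly_const_pow mult_ac)
  qed
  also have "\<dots> = f ^ (n - 1) * poly (\<Sum>s<n. coeff Q s * ([:g:] ^ n) ^ s) (monom 1 p)"
    by (simp add: sum_distrib_left poly_sum poly_const_pow mult_ac)
  also have "(\<Sum>s<n. coeff Q s * ([:g:] ^ n) ^ s) = poly Q ([:g:] ^ n)"
    unfolding poly_altdef by (rule sum.mono_neutral_right) (use Q(2) degAA n in \<open>auto simp: coeff_eq_0\<close>)
  also have "\<dots> = poly P [:g:]" by (simp add: Q(1) poly_pcompose poly_monom)
  finally have "poly T (monom 1 p) = 0" by (simp add: evP)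
  hence T0: "T = 0" using xT d by (intro poly_monom_eq_0_imp_eq_0[of _ T p]) (auto simp: p_def)

  have fz0: "fz \<noteq> 0" using f by (simp add: fz_def map_poly_eq_0_iff)
  have fx0: "[:f:] \<noteq> 0" using f by simp
  define u where "u = to_fract fz / to_fract [:f:]"
  have dQ: "degree (map_poly to_fract Q) = degree Q" by (rule degree_map_poly) simp
  have "poly (map_poly to_fract Q) u = (\<Sum>s<n. to_fract (coeff Q s) * u ^ s)"
    unfolding poly_altdef coeff_map_poly[of to_fract, OF to_fract_0] dQ
    by (rule sum.mono_neutral_left) (use Q(2) degAA n in \<open>auto simp: coeff_eq_0\<close>)
  also have "\<dots> = (\<Sum>s<n. to_fract (coeff Q s * (fz ^ s * [:f:] ^ (n - 1 - s))) / to_fract [:f:] ^ (n - 1))"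
  proof (rule sum.cong[OF refl])
    fix s assume "s \<in> {..<n}"
    hence "to_fract [:f:] ^ (n - 1) = to_fract [:f:] ^ s * to_fract [:f:] ^ (n - 1 - s)" by (simp add: power_add[symmetric])
    thus "to_fract (coeff Q s) * u ^ s = to_fract (coeff Q s * (fz ^ s * [:f:] ^ (n - 1 - s))) / to_fract [:f:] ^ (n - 1)"
      using fx0 by (simp add: u_def to_fract_power power_divide)
  qed
  also have "\<dots> = to_fract T / to_fract [:f:] ^ (n - 1)"
    by (simp add: T_def to_fract_sum sum_divide_distrib)
  finally have "poly (map_poly to_fract Q) u = 0" by (simp add: T0)
  then obtain V where V: "map_poly to_fract Q = [:-u, 1:] * V" by (auto simp: poly_eq_0_iff_dvd elim: dvdE)
  have "map_poly to_fract P = map_poly to_fract Q \<circ>\<^sub>p monom 1 n"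
  proof (rule poly_eqI)
    fix i
    have "i = n * (i div n) + i mod n" "i mod n < n" using n by auto
    thus "coeff (map_poly to_fract P) i = coeff (map_poly to_fract Q \<circ>\<^sub>p monom 1 n) i"
      using coeff_pcompose_monom[of "i mod n" n Q "i div n"]
        coeff_pcompose_monom[of "i mod n" n "map_poly to_fract Q" "i div n"]
      by (auto simp: coeff_map_poly Q(1))
  qed
  also have "\<dots> = (monom 1 n - [:u:]) * (V \<circ>\<^sub>p monom 1 n)"
    unfolding V pcompose_mult by (simp add: pcompose_pCons)
  finally have dvd: "monom 1 n - [:u:] dvd twisted_norm n (to_fract zz) (map_poly to_fract AA)"
    unfolding P_def map_poly_to_fract_twisted_norm by simp
  have "map_poly to_fract AA = 0"
  proof (rule Kummer_norm_eq_0[OF n _ _ _ dvd])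
    show "to_fract zz ^ n = 1" using zz by (metis to_fract_1 to_fract_power)
    show "to_fract zz ^ i \<noteq> 1" if "0 < i" "i < n" for i
      using zz_prim[OF that] by (metis to_fract_1 to_fract_eq_iff to_fract_power)
    show "degree (map_poly to_fract AA) < n" using degAA n degree_map_poly_le[of to_fract AA] by linarith
    show "(w ^ 2) ^ n \<noteq> (u ^ t) ^ 2" if t: "0 < t" "t < n" for w t
    proof
      assume eq: "(w ^ 2) ^ n = (u ^ t) ^ 2"
      obtain a b where w: "w = Fract a b" and b: "b \<noteq> 0" by (cases w)
      hence w: "w = to_fract a / to_fract b" by (simp add: Fract_conv_to_fract)
      have "to_fract ((a ^ 2) ^ n * ([:f:] ^ t) ^ 2) = to_fract ((fz ^ t) ^ 2 * (b ^ 2) ^ n)"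
        using eq b fx0 unfolding w u_def by (simp add: power_divide to_fract_power field_simps)
      hence eq': "(a ^ 2) ^ n * ([:f:] ^ t) ^ 2 = (fz ^ t) ^ 2 * (b ^ 2) ^ n" by (simp only: to_fract_eq_iff)
      hence a: "a \<noteq> 0" using fz0 b n by (auto simp: zero_power)
      \<comment> \<open>Multiplicities are compared at z = \<open>c\<close>. The factor
        \<open>f(x)\<close> does not involve z and contributes nothing, so only the orders of
        \<open>a\<close>, \<open>b\<close> and \<open>f\<close> remain.\<close>
      have "n dvd t * order c f" for c
      proof -
        have "order [:c:] [:f:] = 0" using f by (intro order_0I) simp
        hence "n * (2 * order [:c:] a) = 2 * (t * order c f) + n * (2 * order [:c:] b)"
          using arg_cong[OF eq', of "order [:c:]"] a b fz0 fx0
            order_map_poly_const[OF f, of c]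
          by (simp add: order_mult order_power_eq fz_def[symmetric] del: power_mult_distrib)
        hence "int n * (int (order [:c:] a) - int (order [:c:] b)) = int (t * order c f)"
          by (simp add: algebra_simps flip: of_nat_mult of_nat_add)
        hence "int n dvd int (t * order c f)" by (metis dvd_triv_left)
        thus ?thesis by (simp only: of_nat_dvd_iff)
      qed
      hence "n dvd t" by (rule ord)
      thus False using t by (auto dest: dvd_imp_le)
    qed
  qed
  hence "AA = 0" by (simp add: map_poly_eq_0_iff)
  hence "A j = 0" using AA_coeff[of j] jk by simp
  hence "coeff (A j) k = 0" by simp
  thus ?thesis using jk by (simp add: A_def coeff_sum)
qed

section \<open>Stepanov's method\<close>

text \<open>Over a finite field pigeonhole replaces rank: two coefficient vectors have the same
  image, and their difference solves the system.\<close>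

lemma underdetermined_system:
  fixes a :: "'i \<Rightarrow> 'j \<Rightarrow> 'f::{finite,field}"
  assumes I: "finite I" and J: "finite J" and card: "card J < card I"
  obtains c where "\<exists>i\<in>I. c i \<noteq> 0" "\<And>j. j \<in> J \<Longrightarrow> (\<Sum>i\<in>I. c i * a i j) = 0"
proof -
  define X where "X = PiE I (\<lambda>_. UNIV :: 'f set)"
  define Y where "Y = PiE J (\<lambda>_. UNIV :: 'f set)"
  define \<Phi> where "\<Phi> c = restrict (\<lambda>j. \<Sum>i\<in>I. c i * a i j) J" for c
  have two: "CARD('f) > 1"
    using card_mono[of UNIV "{0, 1 :: 'f}"] by simp
  have fY: "finite Y" unfolding Y_def using J by (intro finite_PiE) auto
  have "card (\<Phi> ` X) \<le> card Y"
    by (rule card_mono[OF fY]) (auto simp: \<Phi>_def Y_def)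
  also have "card Y = CARD('f) ^ card J" unfolding Y_def using J by (simp add: card_PiE)
  also have "\<dots> < CARD('f) ^ card I" using two card by (intro power_strict_increasing) auto
  also have "\<dots> = card X" unfolding X_def using I by (simp add: card_PiE)
  finally have "\<not> inj_on \<Phi> X" by (rule pigeonhole)
  then obtain c d where cd: "c \<in> X" "d \<in> X" "c \<noteq> d" "\<Phi> c = \<Phi> d" unfolding inj_on_def by blast
  have "\<exists>i\<in>I. c i \<noteq> d i" using cd(1-3) unfolding X_def by (metis PiE_ext)
  moreover have "(\<Sum>i\<in>I. (c i - d i) * a i j) = 0" if "j \<in> J" for j
    using fun_cong[OF cd(4), of j] that by (simp add: \<Phi>_def left_diff_distrib sum_subtractf)
  ultimately show ?thesis by (intro that[of "\<lambda>i. c i - d i"]) auto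
qed

lemma of_nat_mod_ring_neq_0:
  assumes "0 < k" "k < CARD('a::prime_card)"
  shows "(of_nat k :: 'a mod_ring) \<noteq> 0"
proof
  assume "(of_nat k :: 'a mod_ring) = 0"
  from of_nat_0_mod_ring_dvd[OF this] show False using assms by (auto dest: dvd_imp_le)
qed

text \<open>Where \<open>h\<close> does not vanish, \<open>h * pderiv\<close> lowers a positive
  multiplicity by exactly one as long as it is below the characteristic; hence the bound on
  \<open>M\<close>. The factor \<open>h\<close> is there to clear the denominator of the logarithmic
  derivative of \<open>f\<close>.\<close>

lemma order_ge_of_derivation:
  fixes R h :: "'a::prime_card mod_ring poly"
  assumes "R \<noteq> 0" and h: "poly h x \<noteq> 0" and "M \<le> CARD('a)"
    and "\<And>l. l < M \<Longrightarrow> poly (((\<lambda>r. h * pderiv r) ^^ l) R) x = 0"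
  shows "M \<le> order x R"
  using assms(1,3,4)
proof (induction M arbitrary: R)
  case (Suc M)
  have "poly R x = 0" using Suc.prems(3)[of 0] by simp
  hence "order x R \<noteq> 0" using Suc.prems(1) by (simp add: order_root)
  then obtain o' where o': "order x R = Suc o'" by (cases "order x R") auto
  show ?case
  proof (cases "Suc o' < CARD('a)")
    case False
    thus ?thesis using Suc.prems(2) o' by simp
  next
    case True
    obtain Q where Q: "R = [:-x, 1:] ^ Suc o' * Q" "\<not> [:-x, 1:] dvd Q"
      using order_decomp[OF Suc.prems(1), of x] unfolding o' by blast
    have Qx: "poly Q x \<noteq> 0" using Q(2) by (simp add: poly_eq_0_iff_dvd)
    define V where "V = h * (smult (of_nat (Suc o')) Q + [:-x, 1:] * pderiv Q)"
    have eq: "h * pderiv R = [:-x, 1:] ^ o' * V"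
      unfolding Q(1) V_def pderiv_mult pderiv_power_Suc
      by (simp add: pderiv_pCons algebra_simps)
    have V: "poly V x \<noteq> 0" using Qx h of_nat_mod_ring_neq_0[OF _ True] unfolding V_def by simp
    hence "V \<noteq> 0" by auto
    hence nz: "h * pderiv R \<noteq> 0" unfolding eq by simp
    have "order x (h * pderiv R) = order x ([:-x, 1:] ^ o') + order x V"
      unfolding eq using nz eq by (intro order_mult) simp
    also have "\<dots> = o'" using order_0I[OF V] by (simp only: order_power_n_n)
    finally have "order x (h * pderiv R) = o'" .
    moreover have "M \<le> order x (h * pderiv R)"
    proof (rule Suc.IH[OF nz])
      fix l assume "l < M"
      thus "poly (((\<lambda>r. h * pderiv r) ^^ l) (h * pderiv R)) x = 0"
        using Suc.prems(3)[of "Suc l"] by (simp only: funpow_Suc_right o_def)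
    qed (use Suc.prems in simp)
    ultimately show ?thesis using o' by simp
  qed
qed simp

lemma card_mult_le_degree:
  fixes R :: "'a::idom poly"
  assumes "R \<noteq> 0" "\<And>x. x \<in> S \<Longrightarrow> M \<le> order x R" "0 < M"
  shows "M * card S \<le> degree R"
proof -
  have sub: "S \<subseteq> {x. poly R x = 0}"
  proof
    fix x assume "x \<in> S"
    hence "order x R \<noteq> 0" using assms(2)[of x] assms(3) by simp
    thus "x \<in> {x. poly R x = 0}" by (simp add: order_root)
  qed
  have fin: "finite {x. poly R x = 0}" using poly_roots_finite[OF assms(1)] .
  have "M * card S = (\<Sum>x\<in>S. M)" by simp
  also have "\<dots> \<le> (\<Sum>x\<in>S. order x R)" by (rule sum_mono) (use assms in auto)
  also have "\<dots> \<le> (\<Sum>x | poly R x = 0. order x R)" by (rule sum_mono2[OF fin sub]) simp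
  also have "\<dots> \<le> degree R" by (rule sum_order_le_degree[OF assms(1)])
  finally show ?thesis .
qed

text \<open>With \<open>g = f ^ N\<close>, the auxiliary polynomial is \<open>\<Sum> r\<^sub>j\<^sub>k g ^ j x ^ (pk)\<close> with \<open>deg r\<^sub>j\<^sub>k \<le> d\<close>. On \<open>S\<close> one has
  \<open>g = \<omega>\<close> and \<open>x ^ p = x\<close>, so vanishing to order \<open>M\<close> on \<open>S\<close> follows from linear conditions on polynomials of low
  degree; \<open>count\<close> says that there are fewer conditions than unknown coefficients.\<close>

lemma stepanov_auxiliary:
  fixes f h v :: "'a::prime_card mod_ring poly" and z \<omega> :: "'a mod_ring"
  assumes n: "n > 0" and nN: "n * N + 1 = CARD('a)"
    and z: "z ^ n = 1" and prim: "\<And>i. 0 < i \<Longrightarrow> i < n \<Longrightarrow> z ^ i \<noteq> 1"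
    and f: "f \<noteq> 0" and ord: "\<And>t. (\<And>a. n dvd t * order a f) \<Longrightarrow> n dvd t"
    and hv: "h * pderiv f = v * f" and degs: "degree h \<le> 4" "degree v \<le> 4" "degree f \<le> 4 * n"
    and d: "n * d + (n - 1) * degree f < CARD('a)"
    and M: "0 < M" "M \<le> CARD('a)"
    and count: "M * (Suc d + K + 4 * M) < n * K * Suc d"
    and S: "\<And>x. x \<in> S \<Longrightarrow> poly h x \<noteq> 0 \<and> poly f x ^ N = \<omega>"
  shows "M * card S \<le> (K + 4 * n) * CARD('a)"
proof -
  define p where "p = CARD('a)"
  \<comment> \<open>Since \<open>h * pderiv f = v * f\<close>, the derivation maps
    \<open>r * g ^ j * x ^ (p * k)\<close> to \<open>\<Delta> j r * g ^ j * x ^ (p * k)\<close>. The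
    shape is preserved, and the coefficient gains at most 4 in degree per step.\<close>
  define \<Delta> where "\<Delta> j r = h * pderiv r + smult (of_nat (j * N)) (v * r)" for j :: nat and r
  define g where "g = f ^ N"
  have \<Delta>_add: "\<Delta> j (r + s) = \<Delta> j r + \<Delta> j s" for j r s
    by (simp add: \<Delta>_def pderiv_add algebra_simps smult_add_right)
  have \<Delta>_smult: "\<Delta> j (smult c r) = smult c (\<Delta> j r)" for j c r
    by (simp add: \<Delta>_def pderiv_smult smult_add_right mult_ac)
  have \<Delta>l_sum: "(\<Delta> j ^^ l) (\<Sum>i\<in>X. smult (c i) (q i)) = (\<Sum>i\<in>X. smult (c i) ((\<Delta> j ^^ l) (q i)))"
    for j l X and c :: "nat \<Rightarrow> 'a mod_ring" and q
  proof (induction l)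
    case (Suc l)
    have 0: "\<Delta> j 0 = 0" by (simp add: \<Delta>_def)
    have "\<Delta> j (\<Sum>i\<in>X. Q i) = (\<Sum>i\<in>X. \<Delta> j (Q i))" for Q
      by (induction X rule: infinite_finite_induct) (simp_all add: \<Delta>_add 0)
    thus ?case by (simp add: Suc \<Delta>_smult)
  qed simp
  have deg\<Delta>: "degree (\<Delta> j r) \<le> degree r + 4" for j r
  proof -
    have "degree (h * pderiv r) \<le> degree r + 4"
      using degree_mult_le[of h "pderiv r"] degree_pderiv_le[of r] degs by linarith
    moreover have "degree (smult (of_nat (j * N)) (v * r)) \<le> degree r + 4"
      using degree_mult_le[of v r] degs degree_smult_le[of "of_nat (j * N)" "v * r"] by linarith
    ultimately show ?thesis unfolding \<Delta>_def by (intro degree_add_le)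
  qed
  have deg\<Delta>l: "degree ((\<Delta> j ^^ l) r) \<le> degree r + 4 * l" for j l r
  proof (induction l)
    case (Suc l)
    thus ?case using deg\<Delta>[of j "(\<Delta> j ^^ l) r"] by simp
  qed simp
  have hg: "h * pderiv g = smult (of_nat N) (v * g)"
  proof (cases N)
    case (Suc N')
    have "h * pderiv g = smult (of_nat N) (f ^ N' * (h * pderiv f))"
      unfolding g_def Suc pderiv_power_Suc by (simp add: mult_ac del: of_nat_Suc)
    thus ?thesis by (simp add: hv g_def Suc mult_ac)
  qed (simp add: g_def)
  have hgj: "h * pderiv (g ^ j) = smult (of_nat (j * N)) (v * g ^ j)" for j
  proof (cases j)
    case (Suc j')
    have "h * pderiv (g ^ j) = smult (of_nat j) (g ^ j' * (h * pderiv g))"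
      unfolding Suc pderiv_power_Suc by (simp add: mult_ac del: of_nat_Suc)
    thus ?thesis by (simp add: hg Suc mult_ac distrib_left)
  qed simp
  have pZ: "pderiv (monom (1::'a mod_ring) (p * k)) = 0" for k
    by (simp add: pderiv_monom p_def)
  define \<theta> where "\<theta> = (\<lambda>r. h * pderiv r)"
  have \<theta>1: "\<theta> (r * g ^ j * monom 1 (p * k)) = \<Delta> j r * g ^ j * monom 1 (p * k)" for r j k
  proof -
    have "\<theta> (r * g ^ j * monom 1 (p * k)) = (h * pderiv r * g ^ j + r * (h * pderiv (g ^ j))) * monom 1 (p * k)"
      unfolding \<theta>_def by (simp only: pderiv_mult pZ) (simp add: algebra_simps)
    thus ?thesis unfolding hgj by (simp add: \<Delta>_def algebra_simps)
  qed
  have \<theta>l: "(\<theta> ^^ l) (r * g ^ j * monom 1 (p * k)) = (\<Delta> j ^^ l) r * g ^ j * monom 1 (p * k)" for l r j k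
    by (induction l) (simp_all add: \<theta>1)
  have \<theta>l_sum: "(\<theta> ^^ l) (\<Sum>i\<in>X. Q i) = (\<Sum>i\<in>X. (\<theta> ^^ l) (Q i))" for l and Q :: "'b \<Rightarrow> 'a mod_ring poly" and X
  proof (induction l)
    case (Suc l)
    have "\<theta> (\<Sum>i\<in>X. Q' i) = (\<Sum>i\<in>X. \<theta> (Q' i))" for Q' :: "'b \<Rightarrow> 'a mod_ring poly"
      by (induction X rule: infinite_finite_induct) (simp_all add: \<theta>_def pderiv_add algebra_simps)
    thus ?case by (simp add: Suc)
  qed simp

  define I where "I = {..<n} \<times> {..<K} \<times> {..<Suc d}"
  \<comment> \<open>One equation for each derivative \<open>l < M\<close> and each coefficient
    \<open>m\<close>. After substituting \<omega> for \<open>g\<close> and \<open>x\<close> for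
    \<open>x ^ p\<close> the degree is at most \<open>K + d + 4 * M\<close>, so these equations kill
    the whole polynomial.\<close>
  define J where "J = {..<M} \<times> {..<Suc d + K + 4 * M}"
  define a where "a = (\<lambda>(j, k, i) (l, m). coeff (smult (\<omega> ^ j) (monom 1 k * (\<Delta> j ^^ l) (monom 1 i))) m)"
  have "card J < card I" using count unfolding I_def J_def by (simp add: algebra_simps)
  then obtain c where c: "\<exists>i\<in>I. c i \<noteq> 0" "\<And>j. j \<in> J \<Longrightarrow> (\<Sum>i\<in>I. c i * a i j) = 0"
    using underdetermined_system[of I J a] unfolding I_def J_def by blast
  define r where "r j k = (\<Sum>i<Suc d. smult (c (j, k, i)) (monom 1 i))" for j k
  have r_coeff: "coeff (r j k) i = (if i < Suc d then c (j, k, i) else 0)" for j k i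
  proof -
    have "coeff (r j k) i = (\<Sum>m<Suc d. if i = m then c (j, k, i) else 0)"
      unfolding r_def coeff_sum by (rule sum.cong) auto
    thus ?thesis by (simp only: sum.delta' finite_lessThan lessThan_iff)
  qed
  have degr: "degree (r j k) \<le> d" for j k by (rule degree_le) (simp add: r_coeff)
  define R where "R = (\<Sum>j<n. \<Sum>k<K. r j k * g ^ j * monom 1 (p * k))"
  have "R \<noteq> 0"
  proof
    assume "R = 0"
    have "r j k = 0" if "j < n" "k < K" for j k
    proof (rule radical_relation_trivial[where r = r and d = d and K = K and z = z, OF n nN z _ f _ _ d _ that])
      show "(\<Sum>j<n. \<Sum>k<K. r j k * (f ^ N) ^ j * monom 1 (CARD('a) * k)) = 0"
        using \<open>R = 0\<close> unfolding R_def g_def p_def .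
    qed (fact prim, fact ord, fact degr)
    moreover obtain j k i where "j < n" "k < K" "i < Suc d" "c (j, k, i) \<noteq> 0"
      using c(1) unfolding I_def by auto
    ultimately show False using r_coeff[of j k i] by auto
  qed
  define T where "T l = (\<Sum>j<n. \<Sum>k<K. smult (\<omega> ^ j) (monom 1 k * (\<Delta> j ^^ l) (r j k)))" for l
  have T0: "T l = 0" if l: "l < M" for l
  proof (rule poly_eqI)
    fix m
    have \<Delta>r: "(\<Delta> j ^^ l) (r j k) = (\<Sum>i<Suc d. smult (c (j, k, i)) ((\<Delta> j ^^ l) (monom 1 i)))" for j k
      unfolding r_def by (rule \<Delta>l_sum)
    show "coeff (T l) m = coeff 0 m"
    proof (cases "m < Suc d + K + 4 * M")
      case True
      have "coeff (T l) m = (\<Sum>j<n. \<Sum>k<K. \<Sum>i<Suc d. c (j, k, i) * a (j, k, i) (l, m))"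
        unfolding T_def \<Delta>r coeff_sum
        by (simp add: a_def sum_distrib_left smult_sum2 coeff_sum mult_ac del: sum.lessThan_Suc)
      also have "\<dots> = (\<Sum>i\<in>I. c i * a i (l, m))"
        unfolding I_def by (simp add: sum.cartesian_product case_prod_unfold del: sum.lessThan_Suc)
      also have "\<dots> = 0" using True l by (intro c(2)) (simp add: J_def)
      finally show ?thesis by simp
    next
      case False
      have "degree (T l) \<le> K + d + 4 * M" unfolding T_def
      proof (intro degree_sum_le finite_lessThan)
        fix j k assume "k \<in> {..<K}"
        have "degree (smult (\<omega> ^ j) (monom 1 k * (\<Delta> j ^^ l) (r j k))) \<le> degree (monom (1::'a mod_ring) k * (\<Delta> j ^^ l) (r j k))"
          by (rule degree_smult_le)
        also have "\<dots> \<le> k + degree ((\<Delta> j ^^ l) (r j k))"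
          by (rule order.trans[OF degree_mult_le]) (simp add: degree_monom_le)
        also have "\<dots> \<le> K + d + 4 * M"
          using deg\<Delta>l[where j = j and l = l and r = "r j k"] degr[of j k] \<open>k \<in> _\<close> l by simp
        finally show "degree (smult (\<omega> ^ j) (monom 1 k * (\<Delta> j ^^ l) (r j k))) \<le> K + d + 4 * M" .
      qed
      thus ?thesis using False by (simp add: coeff_eq_0)
    qed
  qed
  have xp: "x ^ (p * k) = x ^ k" for x :: "'a mod_ring" and k
    using finite_field_power_card_eq_same[of x] by (simp add: p_def power_mult)
  have "M \<le> order x R" if "x \<in> S" for x
  proof (rule order_ge_of_derivation[OF \<open>R \<noteq> 0\<close> _ M(2)])
    show "poly h x \<noteq> 0" using S that by blast
    have gx: "poly g x = \<omega>" using S[OF that] by (simp add: g_def)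
    fix l assume l: "l < M"
    have "poly ((\<theta> ^^ l) R) x = poly (T l) x"
      unfolding R_def \<theta>l_sum \<theta>l T_def
      by (simp add: poly_sum poly_monom gx xp) (simp add: mult_ac)
    thus "poly (((\<lambda>r. h * pderiv r) ^^ l) R) x = 0" unfolding T0[OF l] \<theta>_def by simp
  qed
  hence "M * card S \<le> degree R" by (intro card_mult_le_degree[OF \<open>R \<noteq> 0\<close> _ M(1)])
  also have "\<dots> \<le> (K + 4 * n) * p"
    unfolding R_def
  proof (intro degree_sum_le finite_lessThan)
    fix j k assume jk: "j \<in> {..<n}" "k \<in> {..<K}"
    have "degree (r j k * g ^ j * monom 1 (p * k)) \<le> degree (r j k) + degree (g ^ j) + p * k"
      by (intro order.trans[OF degree_mult_le] add_mono degree_mult_le degree_monom_le)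
    also have "degree (g ^ j) \<le> (N * j) * degree f"
      unfolding g_def power_mult[symmetric] by (rule degree_power_le[THEN order.trans]) (simp add: mult_ac)
    also have "(N * j) * degree f \<le> (N * n) * (4 * n)" using jk degs by (intro mult_le_mono) auto
    also have "\<dots> \<le> p * (4 * n)" using nN by (intro mult_le_mono) (auto simp: p_def mult.commute)
    \<comment> \<open>The \<open>p\<close> spared by \<open>k \<le> K - 1\<close> pays for the
      coefficient \<open>r j k\<close>, whose degree is at most \<open>p\<close>.\<close>
    also have "p * k \<le> p * (K - 1)" using jk by (intro mult_le_mono) auto
    also have "degree (r j k) \<le> p"
    proof -
      have "d \<le> n * d" using n by simp
      thus ?thesis using degr[of j k] d unfolding p_def by linarith
    qed
    also have "p + p * (4 * n) + p * (K - 1) = (K + 4 * n) * p"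
      using jk by (cases K) (auto simp: algebra_simps)
    finally show "degree (r j k * g ^ j * monom 1 (p * k)) \<le> (K + 4 * n) * p" by simp
  qed
  finally show ?thesis unfolding p_def .
qed

text \<open>In \<open>stepanov_bound\<close> the parenthesis is s + 4 n^2: s is the amount by which
  the multiplicity must stay below \<open>n * K\<close>, and 4 n^2 comes from the degrees of the
  powers of \<open>g\<close>. The factor 4 comes from
  \<open>p / (n * M) \<le> 4 * sqrt p\<close>.\<close>

definition stepanov_const :: "nat \<Rightarrow> nat" where
  "stepanov_const n = 4 * (2 * n\<^sup>2 * (1 + 4 * n) + 1 + 4 * n\<^sup>2)"

text \<open>Parameters: \<open>K\<close> is about the square root of \<open>p\<close>,
  \<open>d + 1\<close> about \<open>p / n\<close>, and \<open>M = n * K - s\<close>. The degree,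
  about \<open>K * p\<close>, divided by the multiplicity, about \<open>n * K\<close>, gives the
  main term \<open>p / n\<close>; all corrections are of relative size \<open>1 / K\<close>.\<close>

lemma stepanov_bound:
  fixes f h v :: "'a::prime_card mod_ring poly" and z \<omega> :: "'a mod_ring"
  assumes n: "n > 0" and nN: "n * N + 1 = CARD('a)"
    and z: "z ^ n = 1" and prim: "\<And>i. 0 < i \<Longrightarrow> i < n \<Longrightarrow> z ^ i \<noteq> 1"
    and f: "f \<noteq> 0" and ord: "\<And>t. (\<And>a. n dvd t * order a f) \<Longrightarrow> n dvd t"
    and hv: "h * pderiv f = v * f" and degs: "degree h \<le> 4" "degree v \<le> 4" "degree f \<le> 4 * n"
    and S: "\<And>x. x \<in> S \<Longrightarrow> poly h x \<noteq> 0 \<and> poly f x ^ N = \<omega>"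
  shows "real (card S) \<le> real CARD('a) / real n + real (stepanov_const n) * sqrt (real CARD('a))"
proof -
  define p where "p = CARD('a)"
  define s where "s = 2 * n\<^sup>2 * (1 + 4 * n) + 1"
  define K where "K = floor_sqrt p"
  \<comment> \<open>\<open>L\<close> will be \<open>d + 1\<close>; subtracting \<open>4 * n\<close>
    leaves room for \<open>(n - 1) * degree f\<close> in the degree condition.\<close>
  define L where "L = p div n - 4 * n"
  have p0: "p > 0" by (simp add: p_def)
  have C: "stepanov_const n = 4 * (s + 4 * n\<^sup>2)" by (simp add: stepanov_const_def s_def)
  have Kp: "K\<^sup>2 \<le> p" "p < (Suc K)\<^sup>2" unfolding K_def by (simp_all add: Suc_floor_sqrt_power2_gt)
  have sqrtK: "sqrt p \<le> real K + 1"
    using Kp(2) by (intro real_le_lsqrt) (auto simp: algebra_simps power2_eq_square simp flip: of_nat_mult of_nat_add of_nat_Suc)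
  have "card S \<le> CARD('a mod_ring)" by (rule card_mono) auto
  hence Sp: "real (card S) \<le> p" by (simp add: p_def)
  show ?thesis
  \<comment> \<open>For small \<open>p\<close> the trivial bound \<open>card S \<le> p\<close>
    suffices, since then \<open>sqrt p\<close> is at most the constant.\<close>
  proof (cases "p < 2 * n * (1 + 4 * n) \<or> n * K < 2 * s")
    case True
    have nn: "real (4 * (s + 4 * n\<^sup>2)) = 4 * real s + 16 * (real n)\<^sup>2" "0 \<le> (real n)\<^sup>2" by simp_all
    have "sqrt p \<le> 4 * (s + 4 * n\<^sup>2)"
      using True
    proof
      assume *: "p < 2 * n * (1 + 4 * n)"
      have "n \<le> n\<^sup>2" using n by (simp add: power2_eq_square)
      hence "2 * n * (1 + 4 * n) \<le> 2 * n\<^sup>2 * (1 + 4 * n)" by (intro mult_le_mono) auto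
      hence "p \<le> s" using * unfolding s_def by linarith
      moreover have "sqrt p \<le> p" using p0
        by (intro real_le_lsqrt) (auto simp: power2_eq_square simp flip: of_nat_mult)
      moreover have "real p \<le> real s" using \<open>p \<le> s\<close> by simp
      ultimately have "sqrt p \<le> real s" by linarith
      thus ?thesis using nn by linarith
    next
      assume *: "n * K < 2 * s"
      have "K \<le> n * K" using n by simp
      hence "K + 1 \<le> 2 * s" using * by linarith
      hence "real K + 1 \<le> 2 * real s" by linarith
      thus ?thesis using sqrtK nn by linarith
    qed
    hence "sqrt p * sqrt p \<le> (4 * (s + 4 * n\<^sup>2)) * sqrt p" by (intro mult_right_mono) auto
    hence "real p \<le> real (stepanov_const n) * sqrt p" by (simp add: C)
    thus ?thesis using Sp n unfolding p_def by (auto intro: order.trans add_increasing)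
  next
    case False
    hence big: "2 * n * (1 + 4 * n) \<le> p" and nK: "2 * s \<le> n * K" by auto
    define M where "M = n * K - s"
    have nKM: "n * K = M + s" using nK by (simp add: M_def)
    have s0: "s > 0" by (simp add: s_def)
    have M0: "0 < M" using nKM nK s0 by simp
    have pdiv: "p < n * (p div n) + n"
      using n by (metis add_strict_left_mono mod_less_divisor mult_div_mod_eq)
    have "n * (2 * (1 + 4 * n)) \<le> p" using big by (simp add: algebra_simps)
    hence "2 * (1 + 4 * n) \<le> p div n" using n by (metis div_le_mono nonzero_mult_div_cancel_left not_gr_zero)
    hence L: "L \<ge> 1" "p div n = L + 4 * n" by (auto simp: L_def)
    then obtain d where d: "L = Suc d" by (cases L) auto
    have pL: "p < n * L + 4 * n * n + n" using pdiv unfolding L(2) by (simp add: algebra_simps)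
    have nL: "n * L + 4 * n * n \<le> p" using div_times_less_eq_dividend[of p n] unfolding L(2) by (simp add: algebra_simps)
    have 2: "p \<le> 2 * n * L" using pL big by (simp add: algebra_simps)
    have "n\<^sup>2 * 1 \<le> 2 * n * (1 + 4 * n)" by (simp add: power2_eq_square algebra_simps)
    hence "n\<^sup>2 \<le> p" using big by simp
    hence "(n * K)\<^sup>2 \<le> p * p" using Kp(1) unfolding power_mult_distrib by (intro mult_le_mono)
    hence "n * K \<le> p" by (simp add: power2_eq_square[symmetric])
    hence Mp: "M \<le> p" using nKM by simp
    \<comment> \<open>With \<open>n * K = M + s\<close> the claim reduces to
      \<open>M * (K + 4 * M) < s * L\<close>. The left side is at most
      \<open>n * (1 + 4 * n) * p\<close> and \<open>L\<close> is at least
      \<open>p / (2 * n)\<close>, which dictates the value of \<open>s\<close>.\<close>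
    have count: "M * (Suc d + K + 4 * M) < n * K * Suc d"
    proof -
      have "M * (K + 4 * M) \<le> (n * K) * (K + 4 * (n * K))" using nKM by (intro mult_le_mono add_mono) auto
      also have "\<dots> = n * (1 + 4 * n) * K\<^sup>2" by (simp add: power2_eq_square algebra_simps)
      also have "\<dots> \<le> n * (1 + 4 * n) * p" using Kp(1) by simp
      finally have "2 * n * (M * (K + 4 * M)) \<le> 2 * n * (n * (1 + 4 * n) * p)" by (rule mult_le_mono2)
      also have "\<dots> < s * p" using p0 by (simp add: s_def power2_eq_square algebra_simps)
      also have "\<dots> \<le> s * (2 * n * L)" using 2 by simp
      finally have "2 * n * (M * (K + 4 * M)) < 2 * n * (s * L)" by (simp add: mult_ac)
      hence "M * (K + 4 * M) < s * L" by simp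
      thus ?thesis unfolding nKM d[symmetric] by (simp add: algebra_simps)
    qed
    have dd: "n * d + (n - 1) * degree f < CARD('a)"
    proof -
      have "(n - 1) * degree f \<le> n * (4 * n)" using degs by (intro mult_le_mono) auto
      moreover have "n * d + n = n * L" by (simp add: d)
      ultimately show ?thesis using nL n unfolding p_def by (simp add: algebra_simps)
    qed
    have "M * card S \<le> (K + 4 * n) * CARD('a)"
      by (rule stepanov_auxiliary[OF n nN z prim f ord hv degs dd M0 _ count S]) (use Mp in \<open>auto simp: p_def\<close>)
    hence "real M * real (card S) \<le> (real K + 4 * real n) * real p"
      unfolding p_def by (metis (mono_tags, lifting) of_nat_add of_nat_le_iff of_nat_mult of_nat_numeral)
    hence "real n * (real M * real (card S)) \<le> real n * ((real K + 4 * real n) * real p)" using n by (intro mult_left_mono) auto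
    also have "\<dots> = (real (n * K) + 4 * (real n)\<^sup>2) * real p" by (simp add: algebra_simps power2_eq_square)
    also have "\<dots> = real M * real p + (real s + 4 * (real n)\<^sup>2) * real p" unfolding nKM by (simp add: algebra_simps)
    finally have "real (card S) \<le> (real M * real p + (real s + 4 * (real n)\<^sup>2) * real p) / (real n * real M)"
      using n M0 by (subst pos_le_divide_eq) (auto simp: mult_ac)
    also have "\<dots> = real p / real n + (real s + 4 * (real n)\<^sup>2) * (real p / (real n * real M))"
      using n M0 by (simp add: field_simps)
    also have "real p / (real n * real M) \<le> 4 * sqrt p"
    proof -
      have "M \<ge> s" using nKM nK by simp
      hence "2 * M \<ge> n * K" using nKM by linarith
      hence "real (2 * M) \<ge> real (n * K)" by (rule of_nat_mono)
      moreover have "real (n * K) \<ge> real K" using n by (intro of_nat_mono) simp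
      ultimately have 1: "2 * real M \<ge> real K" by simp
      have "K \<ge> 1" using p0 unfolding K_def by (metis One_nat_def Suc_leI floor_sqrt_greater_zero_iff)
      hence "sqrt p \<le> 2 * real K" using sqrtK by linarith
      hence "sqrt p \<le> 4 * real M" using 1 by linarith
      moreover have "real M \<le> real n * real M" using n M0 by (simp add: mult_le_cancel_right1)
      ultimately have "sqrt p \<le> 4 * (real n * real M)" by linarith
      hence "sqrt p * sqrt p \<le> sqrt p * (4 * (real n * real M))" by (intro mult_left_mono) auto
      hence "real p \<le> 4 * sqrt p * (real n * real M)" by (simp add: mult_ac)
      thus ?thesis using n M0 by (subst pos_divide_le_eq) auto
    qed
    finally have "real (card S) \<le> real p / real n + (real s + 4 * (real n)\<^sup>2) * (4 * sqrt p)"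
      by (simp add: mult_left_mono)
    thus ?thesis by (simp add: C p_def mult_ac)
  qed
qed

text \<open>The logarithmic derivative is a sum of terms \<open>e b / (x + b)\<close>. One copy of
  each linear factor clears the denominators, so the degree of \<open>v\<close> does not depend on
  the exponents.\<close>

lemma product_of_linear_log_derivative:
  fixes e :: "'a::idom \<Rightarrow> nat"
  assumes "finite B"
  obtains v where "degree v \<le> card B"
    "(\<Prod>b\<in>B. [:b, 1:]) * pderiv (\<Prod>b\<in>B. [:b, 1:] ^ e b) = v * (\<Prod>b\<in>B. [:b, 1:] ^ e b)"
proof -
  have "\<exists>v. degree v \<le> card B \<and>
    (\<Prod>b\<in>B. [:b, 1:]) * pderiv (\<Prod>b\<in>B. [:b, 1:] ^ e b) = v * (\<Prod>b\<in>B. [:b, 1:] ^ e b)"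
    using assms
  proof (induction B)
    case empty
    show ?case by (intro exI[of _ 0]) simp
  next
    case (insert b B)
    define H where "H = (\<Prod>b\<in>B. [:b, 1:])"
    define F where "F = (\<Prod>b\<in>B. [:b, 1:] ^ e b)"
    obtain v where v: "degree v \<le> card B" "H * pderiv F = v * F"
      using insert.IH unfolding H_def F_def by blast
    define w where "w = smult (of_nat (e b)) H + [:b, 1:] * v"
    have degH: "degree H \<le> card B"
      unfolding H_def by (rule order.trans[OF degree_prod_sum_le]) (use insert in auto)
    have 1: "[:b, 1:] * pderiv ([:b, 1:] ^ e b) = smult (of_nat (e b)) ([:b, 1:] ^ e b)"
    proof (cases "e b")
      case (Suc k)
      show ?thesis unfolding Suc pderiv_power_Suc by (simp add: pderiv_pCons mult_ac)
    qed simp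
    have "([:b, 1:] * H) * pderiv ([:b, 1:] ^ e b * F) =
       ([:b, 1:] * pderiv ([:b, 1:] ^ e b)) * (H * F) + [:b, 1:] ^ e b * [:b, 1:] * (H * pderiv F)"
      by (simp only: pderiv_mult) (simp only: algebra_simps)
    also have "\<dots> = w * ([:b, 1:] ^ e b * F)"
      unfolding 1 v(2) w_def by (simp add: algebra_simps)
    finally have 2: "([:b, 1:] * H) * pderiv ([:b, 1:] ^ e b * F) = w * ([:b, 1:] ^ e b * F)" .
    have "degree ([:b, 1:] * v) \<le> 1 + card B"
      by (rule order.trans[OF degree_mult_le]) (use v(1) in simp)
    hence "degree w \<le> card (insert b B)"
      unfolding w_def using degH insert.hyps by (intro degree_add_le order.trans[OF degree_smult_le]) auto
    thus ?case using 2 insert.hyps unfolding H_def F_def by auto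
  qed
  thus ?thesis using that by blast
qed

text \<open>The order of the product at \<open>- b\<close> is \<open>e b\<close>, so the condition
  on the exponents becomes the order condition of \<open>stepanov_bound\<close>.\<close>

lemma stepanov_bound_linear_factors:
  fixes B :: "'a::prime_card mod_ring set" and z \<omega> :: "'a mod_ring"
  assumes n: "n > 0" and nN: "n * N + 1 = CARD('a)"
    and z: "z ^ n = 1" and prim: "\<And>i. 0 < i \<Longrightarrow> i < n \<Longrightarrow> z ^ i \<noteq> 1"
    and B: "card B \<le> 4" and e: "\<And>b. b \<in> B \<Longrightarrow> e b \<le> n"
    and indep: "\<And>t. (\<And>b. b \<in> B \<Longrightarrow> n dvd t * e b) \<Longrightarrow> n dvd t"
  shows "real (card {x. (\<forall>b\<in>B. x + b \<noteq> 0) \<and> (\<Prod>b\<in>B. (x + b) ^ e b) ^ N = \<omega>})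
     \<le> real CARD('a) / real n + real (stepanov_const n) * sqrt (real CARD('a))"
proof -
  have fin: "finite B" by simp
  define h where "h = (\<Prod>b\<in>B. [:b, 1:])"
  define f where "f = (\<Prod>b\<in>B. [:b, 1:] ^ e b)"
  obtain v where v: "degree v \<le> card B" "h * pderiv f = v * f"
    using product_of_linear_log_derivative[OF fin, of e] unfolding h_def f_def by blast
  have f0: "f \<noteq> 0" unfolding f_def using fin by simp
  have ord: "order (-b) f = e b" if b: "b \<in> B" for b
  proof -
    define q where "q = (\<Prod>c\<in>B - {b}. [:c, 1:] ^ e c)"
    have fq: "f = [:- (- b), 1:] ^ e b * q" unfolding f_def q_def using b fin by (simp add: prod.remove)
    have "poly q (-b) \<noteq> 0" unfolding q_def poly_prod using fin by (auto simp: add_eq_0_iff)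
    hence "order (-b) q = 0" by (rule order_0I)
    moreover have "order (-b) f = order (-b) ([:- (- b), 1:] ^ e b) + order (-b) q"
      using f0 unfolding fq by (rule order_mult)
    ultimately show ?thesis by (simp only: order_power_n_n)
  qed
  show ?thesis
  proof (rule stepanov_bound[OF n nN z prim f0 _ v(2)])
    show "n dvd t" if "\<And>a. n dvd t * order a f" for t
      by (rule indep) (metis that ord)
    have "degree h \<le> card B" unfolding h_def by (rule order.trans[OF degree_prod_sum_le]) (use fin in auto)
    thus "degree h \<le> 4" using B by simp
    show "degree v \<le> 4" using v(1) B by simp
    have "degree f \<le> (\<Sum>b\<in>B. e b)"
      unfolding f_def by (rule order.trans[OF degree_prod_sum_le]) (use fin in \<open>auto simp: degree_power_eq\<close>)
    also have "\<dots> \<le> (\<Sum>b\<in>B. n)" by (rule sum_mono) (rule e)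
    also have "\<dots> \<le> 4 * n" using B by simp
    finally show "degree f \<le> 4 * n" .
    show "poly h x \<noteq> 0 \<and> poly f x ^ N = \<omega>"
      if "x \<in> {x. (\<forall>b\<in>B. x + b \<noteq> 0) \<and> (\<Prod>b\<in>B. (x + b) ^ e b) ^ N = \<omega>}" for x
      using that fin by (auto simp: h_def f_def poly_prod add.commute)
  qed
qed

text \<open>Speaks of integers and congruences only, so that the prime may be a variable. The
  condition on \<open>t\<close> amounts to \<open>n\<close> and the exponents having no common
  factor.\<close>

definition stepanov_property :: "nat \<Rightarrow> bool" where
  "stepanov_property p \<longleftrightarrow> (\<forall>n N \<alpha> (B::int set) (e::int \<Rightarrow> nat) (w::int).
     n > 0 \<longrightarrow> n * N + 1 = p \<longrightarrow> residue_primroot p \<alpha> \<longrightarrow> finite B \<longrightarrow> card B \<le> 4 \<longrightarrow>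
     inj_on (\<lambda>b. b mod int p) B \<longrightarrow> (\<forall>b\<in>B. e b \<le> n) \<longrightarrow>
     (\<forall>t. (\<forall>b\<in>B. n dvd t * e b) \<longrightarrow> n dvd t) \<longrightarrow>
     real (card {x\<in>{0..<int p}. (\<forall>b\<in>B. \<not> int p dvd x + b) \<and> [(\<Prod>b\<in>B. (x + b) ^ e b) ^ N = w] (mod int p)})
       \<le> real p / real n + real (stepanov_const n) * sqrt (real p))"

lemma of_int_mod_ring_eq_iff:
  "(of_int x :: 'a::prime_card mod_ring) = of_int y \<longleftrightarrow> [x = y] (mod int CARD('a))"
  by (simp add: of_int_eq_iff_cong_CHAR)

lemma stepanov_property_card: "stepanov_property CARD('a::prime_card)"
  unfolding stepanov_property_def
proof (intro allI impI)
  fix n N \<alpha> :: nat and B :: "int set" and e :: "int \<Rightarrow> nat" and w :: int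
  define p where "p = CARD('a)"
  define \<iota> where "\<iota> = (of_int :: int \<Rightarrow> 'a mod_ring)"
  assume n: "n > 0" and nN: "n * N + 1 = CARD('a)" and \<alpha>: "residue_primroot CARD('a) \<alpha>"
    and B: "finite B" "card B \<le> 4" "inj_on (\<lambda>b. b mod int CARD('a)) B"
    and e: "\<forall>b\<in>B. e b \<le> n" and indep: "\<forall>t. (\<forall>b\<in>B. n dvd t * e b) \<longrightarrow> n dvd t"
  have p: "prime p" unfolding p_def by (rule prime_card)
  have \<iota>_eq: "\<iota> x = \<iota> y \<longleftrightarrow> [x = y] (mod int p)" for x y
    unfolding \<iota>_def p_def by (rule of_int_mod_ring_eq_iff)
  have \<iota>0: "\<iota> x = 0 \<longleftrightarrow> int p dvd x" for x
    using \<iota>_eq[of x 0] by (simp add: \<iota>_def cong_0_iff)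
  have injB: "inj_on \<iota> B"
  proof (rule inj_onI)
    fix x y assume xy: "x \<in> B" "y \<in> B" "\<iota> x = \<iota> y"
    have "x mod int CARD('a) = y mod int CARD('a)" using xy(3) unfolding \<iota>_eq p_def Cong.cong_def .
    thus "x = y" using inj_onD[OF B(3) _ xy(1,2)] by simp
  qed
  define e' where "e' b = e (inv_into B \<iota> b)" for b
  have e': "e' (\<iota> b) = e b" if "b \<in> B" for b using injB that by (simp add: e'_def)
  \<comment> \<open>The primitive element has order \<open>n * N\<close>, so its \<open>N\<close>-th
    power is a primitive n-th root of unity.\<close>
  define z where "z = \<iota> (int \<alpha>) ^ N"
  have zi: "z ^ i = 1 \<longleftrightarrow> n dvd i" for i
  proof -
    have N0: "N > 0" using nN prime_gt_1_nat[OF p] by (intro Nat.gr0I) (simp add: p_def)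
    have "z ^ i = \<iota> (int (\<alpha> ^ (N * i)))" by (simp add: z_def \<iota>_def power_mult)
    also have "\<dots> = 1 \<longleftrightarrow> [int (\<alpha> ^ (N * i)) = int 1] (mod int p)"
      unfolding \<iota>_eq[symmetric] by (simp add: \<iota>_def)
    also have "\<dots> \<longleftrightarrow> [\<alpha> ^ (N * i) = 1] (mod p)" by (rule cong_int_iff)
    also have "\<dots> \<longleftrightarrow> ord p \<alpha> dvd N * i" by (rule ord_divides)
    also have "ord p \<alpha> = N * n" using \<alpha> p nN by (simp add: residue_primroot_def p_def[symmetric] totient_prime mult.commute)
    also have "N * n dvd N * i \<longleftrightarrow> n dvd i" using N0 by simp
    finally show ?thesis .
  qed
  define S where "S = {x\<in>{0..<int p}. (\<forall>b\<in>B. \<not> int p dvd x + b) \<and> [(\<Prod>b\<in>B. (x + b) ^ e b) ^ N = w] (mod int p)}"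
  define S' where "S' = {x. (\<forall>b\<in>\<iota> ` B. x + b \<noteq> 0) \<and> (\<Prod>b\<in>\<iota> ` B. (x + b) ^ e' b) ^ N = \<iota> w}"
  have "real (card S') \<le> real CARD('a) / real n + real (stepanov_const n) * sqrt (real CARD('a))"
    unfolding S'_def
  proof (rule stepanov_bound_linear_factors[OF n nN])
    show "z ^ n = 1" by (simp add: zi)
    show "z ^ i \<noteq> 1" if "0 < i" "i < n" for i using that by (auto simp: zi dest: dvd_imp_le)
    show "card (\<iota> ` B) \<le> 4" using card_image_le[OF B(1), of \<iota>] B(2) by linarith
    show "e' b \<le> n" if "b \<in> \<iota> ` B" for b using that e e' by auto
    show "n dvd t" if "\<And>b. b \<in> \<iota> ` B \<Longrightarrow> n dvd t * e' b" for t
      using indep that e' by (metis imageI)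
  qed
  moreover have "card S \<le> card S'"
  proof (rule card_inj_on_le[of \<iota>])
    show "inj_on \<iota> S" unfolding inj_on_def \<iota>_eq S_def by (auto intro: cong_less_imp_eq_int)
    show "\<iota> ` S \<subseteq> S'"
    proof
      fix y assume "y \<in> \<iota> ` S"
      then obtain x where x: "x \<in> S" "y = \<iota> x" by blast
      have 1: "y + b \<noteq> 0" if b: "b \<in> \<iota> ` B" for b
      proof -
        obtain b' where "b' \<in> B" "b = \<iota> b'" using b by blast
        thus ?thesis using x \<iota>0[of "x + b'"] by (simp add: S_def \<iota>_def)
      qed
      have "(\<Prod>b\<in>\<iota> ` B. (y + b) ^ e' b) = (\<Prod>b\<in>B. (y + \<iota> b) ^ e b)"
        using injB e' by (simp add: prod.reindex)
      also have "\<dots> = \<iota> (\<Prod>b\<in>B. (x + b) ^ e b)" by (simp add: x(2) \<iota>_def)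
      finally have "(\<Prod>b\<in>\<iota> ` B. (y + b) ^ e' b) ^ N = \<iota> ((\<Prod>b\<in>B. (x + b) ^ e b) ^ N)" by (simp add: \<iota>_def)
      also have "\<dots> = \<iota> w" using x(1) unfolding \<iota>_eq S_def by blast
      finally show "y \<in> S'" using 1 unfolding S'_def by blast
    qed
  qed simp
  ultimately show "real (card {x\<in>{0..<int CARD('a)}. (\<forall>b\<in>B. \<not> int CARD('a) dvd x + b) \<and> [(\<Prod>b\<in>B. (x + b) ^ e b) ^ N = w] (mod int CARD('a))})
       \<le> real CARD('a) / real n + real (stepanov_const n) * sqrt (real CARD('a))"
    unfolding S_def p_def by linarith
qed

text \<open>HOL types cannot depend on a prime variable. A hypothetical counterexample, however, is a closed
  term by choice, so it can carry a type, and for that type the bound has just been proved.\<close>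

definition bad_prime :: nat where
  "bad_prime = (if \<exists>p. prime p \<and> \<not> stepanov_property p
     then SOME p. prime p \<and> \<not> stepanov_property p else 2)"

lemma bad_prime:
  shows "prime bad_prime"
    and "prime p \<Longrightarrow> \<not> stepanov_property p \<Longrightarrow> \<not> stepanov_property bad_prime"
proof -
  have *: "prime bad_prime \<and> \<not> stepanov_property bad_prime" if "\<exists>p. prime p \<and> \<not> stepanov_property p"
    using someI_ex[OF that] that by (simp add: bad_prime_def)
  show "prime bad_prime"
  proof (cases "\<exists>p. prime p \<and> \<not> stepanov_property p")
    case False
    hence "bad_prime = 2" unfolding bad_prime_def by (rule if_not_P)
    thus ?thesis using two_is_prime_nat by (simp only:)
  qed (use * in blast)
  show "prime p \<Longrightarrow> \<not> stepanov_property p \<Longrightarrow> \<not> stepanov_property bad_prime"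
    using * by blast
qed

typedef bad_residue = "{..<bad_prime}"
  using prime_gt_0_nat[OF bad_prime(1)] by blast

lemma CARD_bad_residue: "CARD(bad_residue) = bad_prime"
  using type_definition.card[OF type_definition_bad_residue] by simp

instance bad_residue :: prime_card
  by standard (simp add: CARD_bad_residue bad_prime(1))

lemma stepanov_property_prime: "prime p \<Longrightarrow> stepanov_property p"
  using bad_prime(2)[of p] stepanov_property_card[where ?'a = bad_residue]
  unfolding CARD_bad_residue by blast

lemma cong_product_count_le:
  fixes B :: "int set" and e :: "int \<Rightarrow> nat" and w :: int
  assumes "prime p" "n > 0" "n * N + 1 = p" "residue_primroot p \<alpha>" "finite B" "card B \<le> 4"
    and "inj_on (\<lambda>b. b mod int p) B" "\<And>b. b \<in> B \<Longrightarrow> e b \<le> n"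
    and "\<And>t. (\<And>b. b \<in> B \<Longrightarrow> n dvd t * e b) \<Longrightarrow> n dvd t"
  shows "real (card {x\<in>{0..<int p}. (\<forall>b\<in>B. \<not> int p dvd x + b) \<and> [(\<Prod>b\<in>B. (x + b) ^ e b) ^ N = w] (mod int p)})
       \<le> real p / real n + real (stepanov_const n) * sqrt (real p)"
proof -
  have e: "\<forall>b\<in>B. e b \<le> n" by (intro ballI assms(8))
  have t: "\<forall>t. (\<forall>b\<in>B. n dvd t * e b) \<longrightarrow> n dvd t"
    by (intro allI impI, rule assms(9), erule bspec)
  note * = stepanov_property_prime[OF assms(1), unfolded stepanov_property_def, THEN spec, THEN spec, THEN spec,
      THEN spec, THEN spec, THEN spec, THEN mp, THEN mp, THEN mp, THEN mp, THEN mp, THEN mp, THEN mp, THEN mp,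
      OF assms(2-7) e t]
  show ?thesis by (rule *)
qed

section \<open>Cyclotomic classes\<close>

text \<open>\<open>N\<close> is the common size of the cyclotomic classes, and
  \<open>h \<mapsto> h ^ N\<close> modulo \<open>p\<close> is the n-th power residue symbol.\<close>

locale cyclotomy =
  fixes p n N a :: nat
  assumes p: "prime p" and n2: "2 \<le> n" and nN: "n * N + 1 = p" and a: "residue_primroot p a"
begin

abbreviation cls :: "int \<Rightarrow> nat" where "cls \<equiv> cyc_class a p n"

lemma n_pos: "n > 0" using n2 by simp
lemma p_gt1: "p > 1" using prime_gt_1_nat[OF p] .
lemma N_pos: "N > 0" using nN p_gt1 by (cases N) auto
lemma ord_a: "ord p a = n * N"
  using a p nN by (auto simp: residue_primroot_def totient_prime)
lemma coprime_a: "coprime p a" using a by (simp add: residue_primroot_def)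

lemma primroot_power_cong_iff: "[int a ^ i = int a ^ j] (mod int p) \<longleftrightarrow> [i = j] (mod (n * N))"
proof -
  have "[int a ^ i = int a ^ j] (mod int p) \<longleftrightarrow> [a ^ i = a ^ j] (mod p)"
    unfolding of_nat_power[symmetric] by (rule cong_int_iff)
  thus ?thesis using order_divides_expdiff[OF coprime_a, of i j] by (simp add: ord_a)
qed

lemma not_dvd_primroot_power: "\<not> int p dvd int a ^ i"
proof
  assume "int p dvd int a ^ i"
  hence "p dvd a ^ i" by (simp flip: of_nat_power)
  hence "p dvd a" using p prime_dvd_power by blast
  hence "is_unit p" by (rule coprime_common_divisor[OF coprime_a dvd_refl])
  thus False using p_gt1 by simp
qed

lemma discrete_log:
  assumes "\<not> int p dvd h"
  obtains i where "i < n * N" "[h = int a ^ i] (mod int p)"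
proof -
  define m where "m = nat (h mod int p)"
  have m: "int m = h mod int p" "m < p" using p_gt1 by (auto simp: m_def nat_less_iff)
  have "m \<noteq> 0" using assms m(1) by (auto simp: dvd_eq_mod_eq_0)
  hence "m \<in> totatives p" using m(2) p
    by (auto simp: totatives_prime)
  then obtain i where i: "i < totient p" "m = a ^ i mod p"
    using residue_primroot_is_generator[OF p_gt1 a] by (auto simp: bij_betw_def)
  have "[h = int m] (mod int p)" by (simp add: m(1) Cong.cong_def)
  also have "[int m = int (a ^ i)] (mod int p)" unfolding i(2) by (simp add: Cong.cong_def zmod_int)
  finally have "[h = int a ^ i] (mod int p)" by simp
  moreover have "i < n * N" using i(1) p nN by (simp add: totient_prime)
  ultimately show ?thesis using that by blast
qed

text \<open>The class is the discrete logarithm modulo \<open>n\<close>, well defined because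
  \<open>n\<close> divides the order \<open>n * N\<close> of the primitive element.\<close>

lemma cls_primroot_power:
  assumes "[h = int a ^ i] (mod int p)"
  shows "cls h = i mod n"
  unfolding cyc_class_def
proof (rule the_equality, safe)
  show "i mod n < n" using n_pos by simp
  have "int a ^ i = int a ^ (i mod n) * (int a ^ (i div n)) ^ n"
    by (simp flip: power_mult power_add)
  thus "\<exists>x. [h = int a ^ (i mod n) * x ^ n] (mod int p)"
    using assms by (intro exI[of _ "int a ^ (i div n)"]) simp
next
  fix k x assume k: "k < n" "[h = int a ^ k * x ^ n] (mod int p)"
  have "\<not> int p dvd x"
  proof
    assume "int p dvd x"
    hence "int p dvd x ^ n" by (rule dvd_trans) (use n_pos in \<open>simp add: dvd_power\<close>)
    hence "int p dvd int a ^ k * x ^ n" by (rule dvd_mult)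
    hence "int p dvd h" using cong_dvd_iff[OF k(2)] by simp
    hence "int p dvd int a ^ i" using cong_dvd_iff[OF assms] by simp
    thus False using not_dvd_primroot_power by blast
  qed
  then obtain j where j: "[x = int a ^ j] (mod int p)" using discrete_log by blast
  have "[int a ^ i = h] (mod int p)" using assms by (rule cong_sym)
  also note k(2)
  also have "[int a ^ k * x ^ n = int a ^ k * (int a ^ j) ^ n] (mod int p)"
    by (intro cong_mult cong_pow j cong_refl)
  finally have "[int a ^ i = int a ^ (k + j * n)] (mod int p)" by (simp add: power_add power_mult)
  hence "[i = k + j * n] (mod n * N)" by (simp only: primroot_power_cong_iff)
  hence "[i = k + j * n] (mod n)" using cong_dvd_modulus_nat dvd_triv_left by blast
  thus "k = i mod n" using k(1) by (simp add: Cong.cong_def)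
qed

lemma cls_less: "\<not> int p dvd h \<Longrightarrow> cls h < n"
  by (rule discrete_log, assumption) (use cls_primroot_power n_pos in simp)

lemma cls_cong: "[h = h'] (mod int p) \<Longrightarrow> cls h = cls h'"
proof -
  assume h: "[h = h'] (mod int p)"
  have "[h = y] (mod int p) \<longleftrightarrow> [h' = y] (mod int p)" for y
    using cong_trans[OF h] cong_trans[OF cong_sym[OF h]] by (rule iffI[rotated])
  thus ?thesis by (simp add: cyc_class_def)
qed

lemma cls_mod [simp]: "cls (h mod int p) = cls h"
  by (rule cls_cong) (simp add: Cong.cong_def)

lemma cls_mult_nth_power:
  assumes "\<not> int p dvd h" "\<not> int p dvd y"
  shows "cls (h * y ^ n) = cls h"
proof -
  obtain i where i: "[h = int a ^ i] (mod int p)" using discrete_log[OF assms(1)] by blast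
  obtain j where j: "[y = int a ^ j] (mod int p)" using discrete_log[OF assms(2)] by blast
  have "[h * y ^ n = int a ^ i * (int a ^ j) ^ n] (mod int p)" by (intro cong_mult cong_pow i j)
  hence "[h * y ^ n = int a ^ (i + j * n)] (mod int p)" by (simp add: power_add power_mult)
  from cls_primroot_power[OF this] show ?thesis using cls_primroot_power[OF i] by simp
qed

text \<open>Euler's criterion for n-th powers; it turns conditions on classes into the polynomial
  congruences counted by Stepanov's method.\<close>

lemma power_cong_cls:
  assumes "\<not> int p dvd h"
  shows "[h ^ N = int a ^ (N * cls h)] (mod int p)"
proof -
  obtain i where i: "[h = int a ^ i] (mod int p)" using discrete_log[OF assms] by blast
  have "[h ^ N = int a ^ (i * N)] (mod int p)" using cong_pow[OF i, of N] by (simp add: power_mult)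
  moreover have "[int a ^ (i * N) = int a ^ (N * (i mod n))] (mod int p)"
    unfolding primroot_power_cong_iff
    by (simp add: Cong.cong_def mult.commute mult_mod_left mod_mult_mult2)
  ultimately show ?thesis unfolding cls_primroot_power[OF i] by (rule cong_trans)
qed

lemma nonresidue_interval: "{x\<in>{0..<int p}. \<not> int p dvd x} = {1..<int p}"
proof -
  have 1: "\<not> int p dvd x" if "1 \<le> x" "x < int p" for x using that zdvd_imp_le[of "int p" x] by auto
  have 2: "1 \<le> x" if "0 \<le> x" "\<not> int p dvd x" for x using that by (cases "x = 0") auto
  show ?thesis
  proof (intro equalityI subsetI)
    fix x assume "x \<in> {x\<in>{0..<int p}. \<not> int p dvd x}"
    thus "x \<in> {1..<int p}" using 2[of x] by simp
  next
    fix x assume "x \<in> {1..<int p}"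
    thus "x \<in> {x\<in>{0..<int p}. \<not> int p dvd x}" using 1[of x] by simp
  qed
qed

lemma bij_primroot_power: "bij_betw (\<lambda>i. int a ^ i mod int p) {..<n * N} {1..<int p}"
proof -
  have b: "bij_betw (\<lambda>i. a ^ i mod p) {..<n * N} {0<..<p}"
    using residue_primroot_is_generator[OF p_gt1 a] totient_prime[OF p] totatives_prime[OF p] nN by auto
  have "bij_betw int {0<..<p} {1..<int p}"
    by (rule bij_betwI[of _ _ _ nat]) auto
  from bij_betw_trans[OF b this] show ?thesis by (simp add: o_def zmod_int)
qed

lemma sum_mod_period:
  fixes \<phi> :: "nat \<Rightarrow> 'b::{comm_semiring_1}"
  shows "(\<Sum>i<n * M. \<phi> (i mod n)) = of_nat M * (\<Sum>k<n. \<phi> k)"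
proof (induction M)
  case (Suc M)
  have eq: "{..<n * Suc M} = {..<n * M} \<union> {n * M..<n * M + n}" by auto
  have "(\<Sum>i<n * Suc M. \<phi> (i mod n)) = (\<Sum>i<n * M. \<phi> (i mod n)) + (\<Sum>i\<in>{n * M..<n * M + n}. \<phi> (i mod n))"
    unfolding eq by (rule sum.union_disjoint) auto
  also have "(\<Sum>i\<in>{n * M..<n * M + n}. \<phi> (i mod n)) = (\<Sum>k\<in>{0..<n}. \<phi> ((k + n * M) mod n))"
    using sum.shift_bounds_nat_ivl[of "\<lambda>i. \<phi> (i mod n)" 0 "n * M" n] by (simp add: add.commute)
  also have "\<dots> = (\<Sum>k<n. \<phi> k)"
    unfolding lessThan_atLeast0 by (rule sum.cong) auto
  finally show ?case by (simp only: Suc) (simp add: algebra_simps)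
qed simp

lemma sum_cls:
  fixes \<phi> :: "nat \<Rightarrow> 'b::{comm_semiring_1}"
  shows "(\<Sum>h\<in>{1..<int p}. \<phi> (cls h)) = of_nat N * (\<Sum>k<n. \<phi> k)"
proof -
  have "(\<Sum>h\<in>{1..<int p}. \<phi> (cls h)) = (\<Sum>i<n * N. \<phi> (cls (int a ^ i mod int p)))"
    by (rule sum.reindex_bij_betw[OF bij_primroot_power, symmetric])
  also have "\<dots> = (\<Sum>i<n * N. \<phi> (i mod n))"
    using cls_primroot_power[OF cong_refl] by simp
  finally show ?thesis by (simp add: sum_mod_period)
qed

end

section \<open>Character sums and equidistribution\<close>

lemma stepanov_const_mono: "m \<le> n \<Longrightarrow> stepanov_const m \<le> stepanov_const n"
  unfolding stepanov_const_def by (intro mult_le_mono add_mono power_mono) auto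

text \<open>At most \<open>n\<close> values of the exponent, each with a count that deviates from
  the average by at most \<open>4 + n * stepanov_const n * sqrt p\<close>.\<close>

definition charsum_const :: "nat \<Rightarrow> real" where
  "charsum_const n = real n * (4 + real n * real (stepanov_const n))"

lemma charsum_const_nonneg: "charsum_const n \<ge> 0"
  by (simp add: charsum_const_def)

lemma sum_cis_multiples:
  assumes "m \<ge> 2"
  shows "(\<Sum>v<m. cis (2 * pi * real v / real m)) = 0"
proof -
  define w where "w = cis (2 * pi / real m)"
  have w: "w ^ v = cis (2 * pi * real v / real m)" for v
    unfolding w_def Complex.DeMoivre by (rule arg_cong[of _ _ cis]) simp
  have "w \<noteq> 1"
  proof
    assume "w = 1"
    hence "cos (2 * pi / real m) = 1" by (simp add: w_def complex_eq_iff)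
    then obtain k :: int where "2 * pi / real m = of_int k * 2 * pi" unfolding cos_one_2pi_int by blast
    hence "of_int (int m * k) = (of_int 1 :: real)" using assms by (simp add: field_simps)
    hence "int m * k = 1" by (simp only: of_int_eq_iff)
    hence "int m dvd 1" by (metis dvd_triv_left)
    thus False using assms by simp
  qed
  moreover have "w ^ m = 1" using assms by (simp add: w)
  ultimately have "(\<Sum>v<m. w ^ v) = 0" by (simp add: sum_gp_strict)
  thus ?thesis by (simp add: w)
qed

text \<open>Stepanov's method bounds every count from above only; since the total is known, this also bounds
  each count from below.\<close>

lemma deviation_from_average:
  fixes x :: "nat \<Rightarrow> real"
  assumes m: "m > 0" and upper: "\<And>v. v < m \<Longrightarrow> x v \<le> A / real m + E" and total: "(\<Sum>v<m. x v) \<ge> A - D"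
    and E: "E \<ge> 0" "D \<ge> 0" and v: "v < m"
  shows "\<bar>x v - A / real m\<bar> \<le> D + real m * E"
proof -
  have "(\<Sum>u\<in>{..<m} - {v}. x u) \<le> (\<Sum>u\<in>{..<m} - {v}. A / real m + E)"
    by (rule sum_mono) (use upper in auto)
  also have "\<dots> = (real m - 1) * (A / real m + E)" using v by (simp add: of_nat_diff)
  finally have 1: "(\<Sum>u\<in>{..<m} - {v}. x u) \<le> (real m - 1) * (A / real m + E)" .
  have "(\<Sum>u<m. x u) = x v + (\<Sum>u\<in>{..<m} - {v}. x u)" using v by (simp add: sum.remove)
  hence "x v \<ge> A - D - (real m - 1) * (A / real m + E)" using 1 total by linarith
  moreover have "A - (real m - 1) * (A / real m + E) = A / real m - (real m - 1) * E"
    using m by (simp add: field_simps)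
  ultimately have "x v - A / real m \<ge> - (D + (real m - 1) * E)" by linarith
  moreover have "(real m - 1) * E \<le> real m * E" using E by (intro mult_right_mono) auto
  moreover have "x v - A / real m \<le> E" using upper[OF v] by linarith
  moreover have "1 * E \<le> real m * E" using m E by (intro mult_right_mono) auto
  ultimately show ?thesis using E by (simp add: abs_le_iff)
qed

context cyclotomy
begin

definition unit_shifts :: "int set \<Rightarrow> int set" where
  "unit_shifts B = {x\<in>{0..<int p}. \<forall>b\<in>B. \<not> int p dvd x + b}"

lemma finite_unit_shifts [simp]: "finite (unit_shifts B)"
  by (rule finite_subset[of _ "{0..<int p}"]) (auto simp: unit_shifts_def)

lemma card_unit_shifts:
  assumes "finite B" "card B \<le> 4"
  shows "real (card (unit_shifts B)) \<le> real p" "real p - 4 \<le> real (card (unit_shifts B))"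
proof -
  have "card (unit_shifts B) \<le> card {0..<int p}" by (rule card_mono) (auto simp: unit_shifts_def)
  thus "real (card (unit_shifts B)) \<le> real p" by simp
  have "{0..<int p} - unit_shifts B \<subseteq> (\<lambda>b. (- b) mod int p) ` B"
  proof
    fix x assume x: "x \<in> {0..<int p} - unit_shifts B"
    then obtain b where b: "b \<in> B" "int p dvd x + b" by (auto simp: unit_shifts_def)
    hence "x mod int p = (- b) mod int p" by (simp add: mod_eq_dvd_iff)
    hence "x = (- b) mod int p" using x by simp
    thus "x \<in> (\<lambda>b. (- b) mod int p) ` B" using b by blast
  qed
  hence "card ({0..<int p} - unit_shifts B) \<le> card ((\<lambda>b. (- b) mod int p) ` B)"
    using assms(1) by (intro card_mono) auto
  also have "\<dots> \<le> card B" using assms(1) by (rule card_image_le)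
  finally have "card ({0..<int p} - unit_shifts B) \<le> 4" using assms by simp
  moreover have "card ({0..<int p} - unit_shifts B) = p - card (unit_shifts B)"
    by (subst card_Diff_subset) (simp_all, auto simp: unit_shifts_def)
  ultimately show "real p - 4 \<le> real (card (unit_shifts B))" by linarith
qed

text \<open>The sum is grouped by the value of the total exponent. All values occur equally often up
  to the error, and equal counts cancel against the sum of all roots of unity.\<close>

lemma character_sum_bound:
  assumes B: "finite B" "card B \<le> 4" "inj_on (\<lambda>b. b mod int p) B"
    and e: "\<And>b. b \<in> B \<Longrightarrow> e b < n" and nz: "\<exists>b\<in>B. e b \<noteq> 0"
  shows "cmod (\<Sum>x\<in>unit_shifts B. cis (2 * pi * real (\<Sum>b\<in>B. e b * cls (x + b)) / real n))
     \<le> charsum_const n * sqrt p"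
proof -
  \<comment> \<open>The counting bound needs exponents without a common factor with the index.
    Dividing by \<open>g\<close> achieves this: the character then has order dividing
    \<open>n'\<close>, and \<open>p = n' * (g * N) + 1\<close>.\<close>
  define g where "g = Gcd (insert n (e ` B))"
  have g_dvd: "g dvd n" "\<And>b. b \<in> B \<Longrightarrow> g dvd e b" unfolding g_def by (rule Gcd_dvd, simp)+
  have g0: "g > 0" using g_dvd(1) n_pos by (metis dvd_0_left_iff not_gr_zero)
  define n' where "n' = n div g"
  define e' where "e' b = e b div g" for b
  have ng: "n = g * n'" using g_dvd(1) by (simp add: n'_def)
  have eg: "e b = g * e' b" if "b \<in> B" for b using g_dvd(2)[OF that] by (simp add: e'_def)
  have n'0: "n' > 0" using n_pos ng by (cases n') auto
  have n'n: "n' \<le> n" by (simp add: n'_def)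
  have n'2: "n' \<ge> 2"
  proof (rule ccontr)
    assume "\<not> n' \<ge> 2"
    hence "n = g" using n'0 ng by (cases n') auto
    moreover obtain b where "b \<in> B" "e b \<noteq> 0" using nz by blast
    ultimately show False using eg[of b] e[of b] by (cases "e' b") auto
  qed
  \<comment> \<open>Multiplying by \<open>g\<close> gives \<open>n dvd t * e b\<close> for all
    \<open>b\<close>, and \<open>n dvd t * n\<close> is trivial; so \<open>n\<close> divides
    \<open>t\<close> times the gcd, that is \<open>g * n' dvd t * g\<close>.\<close>
  have indep: "n' dvd t" if t: "\<And>b. b \<in> B \<Longrightarrow> n' dvd t * e' b" for t
  proof -
    have "n dvd x" if "x \<in> (*) t ` insert n (e ` B)" for x
      using that
    proof safe
      show "n dvd t * n" by simp
    next
      fix b assume "b \<in> B"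
      thus "n dvd t * e b" using t[of b] eg[of b] by (simp add: ng mult.left_commute)
    qed
    hence "n dvd Gcd ((*) t ` insert n (e ` B))" by (rule Gcd_greatest)
    also have "Gcd ((*) t ` insert n (e ` B)) = t * g" unfolding g_def by (simp only: Gcd_mult normalize_nat_def id_apply)
    finally have "g * n' dvd g * t" using ng by (simp add: mult.commute)
    thus ?thesis using g0 by simp
  qed
  define s where "s x = (\<Sum>b\<in>B. e' b * cls (x + b))" for x
  define X where "X = unit_shifts B"
  define cnt where "cnt v = card {x\<in>X. s x mod n' = v}" for v
  have nN': "n' * (g * N) + 1 = p" using nN ng by (simp add: mult_ac)
  have upper: "real (cnt v) \<le> real p / real n' + real (stepanov_const n) * sqrt p" if "v < n'" for v
  proof -
    have "{x\<in>X. s x mod n' = v} \<subseteq> {x\<in>{0..<int p}. (\<forall>b\<in>B. \<not> int p dvd x + b) \<and>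
        [(\<Prod>b\<in>B. (x + b) ^ e' b) ^ (g * N) = int a ^ (g * N * v)] (mod int p)}"
    proof safe
      fix x assume x: "x \<in> X" and v: "v = s x mod n'"
      show "x \<in> {0..<int p}" using x by (simp add: X_def unit_shifts_def)
      have nd: "\<not> int p dvd x + b" if "b \<in> B" for b using x that by (simp add: X_def unit_shifts_def)
      have "(\<Prod>b\<in>B. (x + b) ^ e' b) ^ (g * N) = (\<Prod>b\<in>B. ((x + b) ^ N) ^ (g * e' b))"
        by (simp add: prod_power_distrib power_mult[symmetric] mult_ac)
      also have "[\<dots> = (\<Prod>b\<in>B. (int a ^ (N * cls (x + b))) ^ (g * e' b))] (mod int p)"
        by (intro cong_prod cong_pow power_cong_cls nd)
      also have "(\<Prod>b\<in>B. (int a ^ (N * cls (x + b))) ^ (g * e' b)) = int a ^ (g * N * s x)"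
        by (simp add: s_def sum_distrib_left power_sum power_mult[symmetric] mult_ac)
      also have "[int a ^ (g * N * s x) = int a ^ (g * N * (s x mod n'))] (mod int p)"
      proof -
        have nNg: "n * N = g * N * n'" using ng by (simp only: mult_ac)
        show ?thesis unfolding primroot_power_cong_iff unfolding nNg Cong.cong_def by (simp only: mod_mult_mult1 mod_mod_trivial)
      qed
      finally show "[(\<Prod>b\<in>B. (x + b) ^ e' b) ^ (g * N) = int a ^ (g * N * (s x mod n'))] (mod int p)" .
      fix b assume "b \<in> B" "int p dvd x + b"
      thus False using nd by blast
    qed
    hence "cnt v \<le> card {x\<in>{0..<int p}. (\<forall>b\<in>B. \<not> int p dvd x + b) \<and>
        [(\<Prod>b\<in>B. (x + b) ^ e' b) ^ (g * N) = int a ^ (g * N * v)] (mod int p)}"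
      unfolding cnt_def by (intro card_mono finite_subset[OF _ finite_atLeastLessThan_int[of 0 "int p"]]) auto
    hence "real (cnt v) \<le> real (card {x\<in>{0..<int p}. (\<forall>b\<in>B. \<not> int p dvd x + b) \<and>
        [(\<Prod>b\<in>B. (x + b) ^ e' b) ^ (g * N) = int a ^ (g * N * v)] (mod int p)})" by simp
    also have "\<dots> \<le> real p / real n' + real (stepanov_const n') * sqrt p"
    proof (rule cong_product_count_le[OF p n'0 nN' a B])
      fix b assume b: "b \<in> B"
      have "g * e' b \<le> g * n'" using e[OF b] eg[OF b] ng by simp
      thus "e' b \<le> n'" using g0 by simp
    qed (rule indep)
    also have "\<dots> \<le> real p / real n' + real (stepanov_const n) * sqrt p"
      using stepanov_const_mono[OF n'n] by (intro add_mono mult_right_mono) auto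
    finally show ?thesis .
  qed
  have fX: "finite X" by (simp add: X_def)
  have total: "(\<Sum>v<n'. real (cnt v)) = real (card X)"
  proof -
    have "(\<Sum>v<n'. \<Sum>x\<in>{x\<in>X. s x mod n' = v}. (1::real)) = (\<Sum>x\<in>X. 1)"
      using n'0 by (intro sum.group) (auto simp: fX)
    thus ?thesis by (simp add: cnt_def)
  qed
  \<comment> \<open>The 4 accounts for the at most four residues where some \<open>x + b\<close>
    vanishes.\<close>
  have dev: "\<bar>real (cnt v) - real p / real n'\<bar> \<le> 4 + real n' * (real (stepanov_const n) * sqrt p)" if "v < n'" for v
    by (rule deviation_from_average[OF n'0 upper _ _ _ that])
      (use total card_unit_shifts[OF B(1,2)] in \<open>auto simp: X_def\<close>)
  have "(\<Sum>x\<in>X. cis (2 * pi * real (\<Sum>b\<in>B. e b * cls (x + b)) / real n)) =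
      (\<Sum>x\<in>X. cis (2 * pi * real (s x mod n') / real n'))"
  proof (rule sum.cong[OF refl])
    fix x
    have "(\<Sum>b\<in>B. e b * cls (x + b)) = g * s x"
      by (simp add: s_def sum_distrib_left eg mult.assoc)
    hence "2 * pi * real (\<Sum>b\<in>B. e b * cls (x + b)) / real n = 2 * pi * real (s x) / real n'"
      using g0 by (simp add: ng)
    moreover have sx: "real (s x) = real n' * real (s x div n') + real (s x mod n')"
      by (metis mult_div_mod_eq of_nat_add of_nat_mult)
    moreover have "2 * pi * real (s x) / real n' = 2 * pi * real (s x mod n') / real n' + 2 * pi * real (s x div n')"
      unfolding sx using n'0 by (simp add: distrib_left add_divide_distrib)
    moreover have "cis (2 * pi * real (s x mod n') / real n' + 2 * pi * real (s x div n')) = cis (2 * pi * real (s x mod n') / real n')"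
      by (simp add: cis_mult[symmetric] cis_multiple_2pi)
    ultimately show "cis (2 * pi * real (\<Sum>b\<in>B. e b * cls (x + b)) / real n) = cis (2 * pi * real (s x mod n') / real n')" by (simp only:)
  qed
  also have "\<dots> = (\<Sum>v<n'. \<Sum>x\<in>{x\<in>X. s x mod n' = v}. cis (2 * pi * real (s x mod n') / real n'))"
    using n'0 by (intro sum.group[symmetric]) (auto simp: fX)
  also have "\<dots> = (\<Sum>v<n'. of_nat (cnt v) * cis (2 * pi * real v / real n'))"
    by (rule sum.cong) (auto simp: cnt_def)
  also have "\<dots> = (\<Sum>v<n'. of_real (real (cnt v) - real p / real n') * cis (2 * pi * real v / real n'))
       + of_real (real p / real n') * (\<Sum>v<n'. cis (2 * pi * real v / real n'))"
    unfolding sum_distrib_left sum.distrib[symmetric] by (rule sum.cong) (auto simp: algebra_simps)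
  also have "\<dots> = (\<Sum>v<n'. of_real (real (cnt v) - real p / real n') * cis (2 * pi * real v / real n'))"
    by (simp add: sum_cis_multiples[OF n'2])
  finally have "cmod (\<Sum>x\<in>X. cis (2 * pi * real (\<Sum>b\<in>B. e b * cls (x + b)) / real n)) =
     cmod (\<Sum>v<n'. of_real (real (cnt v) - real p / real n') * cis (2 * pi * real v / real n'))" by simp
  also have "\<dots> \<le> (\<Sum>v<n'. \<bar>real (cnt v) - real p / real n'\<bar>)"
    by (rule sum_norm_le) (simp add: norm_mult flip: of_real_diff of_real_divide)
  also have "\<dots> \<le> (\<Sum>v<n'. 4 + real n' * (real (stepanov_const n) * sqrt p))"
    by (rule sum_mono) (use dev in auto)
  also have "\<dots> = real n' * (4 + real n' * (real (stepanov_const n) * sqrt p))" by simp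
  also have "\<dots> \<le> real n * (4 * sqrt p + real n * (real (stepanov_const n) * sqrt p))"
    using n'n p_gt1 by (intro mult_mono add_mono) auto
  also have "\<dots> = charsum_const n * sqrt p" by (simp add: charsum_const_def algebra_simps)
  finally show ?thesis unfolding X_def .
qed

end

section \<open>From character sums to independence of classes\<close>

lemma finite_Fourier_inversion:
  fixes v :: "nat \<Rightarrow> complex"
  assumes n: "n > 0" and k: "k < n"
  defines "c \<equiv> \<lambda>e. (\<Sum>k<n. v k * cis (- (2 * pi * real (e * k) / real n))) / of_nat n"
  shows "(\<Sum>e<n. c e * cis (2 * pi * real (e * k) / real n)) = v k"
proof -
  have orth: "(\<Sum>e<n. cis (2 * pi * (real e * (real k - real l)) / real n)) = (if k = l then of_nat n else 0)"
    if l: "l < n" for l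
  proof (cases "k = l")
    case False
    define w where "w = cis (2 * pi * (real k - real l) / real n)"
    have w: "w ^ e = cis (2 * pi * (real e * (real k - real l)) / real n)" for e
      unfolding w_def Complex.DeMoivre by (rule arg_cong[of _ _ cis]) simp
    have "w \<noteq> 1"
    proof
      assume "w = 1"
      hence "cos (2 * pi * (real k - real l) / real n) = 1" by (simp add: w_def complex_eq_iff)
      then obtain m :: int where "2 * pi * (real k - real l) / real n = of_int m * 2 * pi"
        unfolding cos_one_2pi_int by blast
      hence "2 * pi * ((real k - real l) / real n) = 2 * pi * of_int m" by (simp add: mult_ac)
      hence "(real k - real l) / real n = of_int m" by (simp only: mult_cancel_left) simp
      hence "of_int (int k - int l) = (of_int (m * int n) :: real)" using n by (simp add: field_simps)
      hence "int k - int l = m * int n" by (simp only: of_int_eq_iff)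
      hence "int n dvd int k - int l" by simp
      hence "int k mod int n = int l mod int n" by (simp add: mod_eq_dvd_iff)
      thus False using k l False by simp
    qed
    moreover have "w ^ n = 1"
    proof -
      have "2 * pi * (real n * (real k - real l)) / real n = 2 * pi * of_int (int k - int l)" using n by simp
      hence "w ^ n = cis (2 * pi * of_int (int k - int l))" by (simp only: w)
      also have "\<dots> = 1" by (rule cis_multiple_2pi) simp
      finally show ?thesis .
    qed
    ultimately have "(\<Sum>e<n. w ^ e) = 0" by (simp add: sum_gp_strict)
    thus ?thesis using False by (simp add: w)
  qed simp
  have "(\<Sum>e<n. c e * cis (2 * pi * real (e * k) / real n)) =
     (\<Sum>e<n. \<Sum>l<n. v l / of_nat n * cis (2 * pi * (real e * (real k - real l)) / real n))"
    unfolding c_def sum_divide_distrib sum_distrib_right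
  proof (intro sum.cong refl)
    fix e l
    have "cis (- (2 * pi * real (e * l) / real n)) * cis (2 * pi * real (e * k) / real n) =
      cis (2 * pi * (real e * (real k - real l)) / real n)"
      unfolding cis_mult by (rule arg_cong[of _ _ cis]) (simp add: algebra_simps diff_divide_distrib)
    thus "v l * cis (- (2 * pi * real (e * l) / real n)) / of_nat n * cis (2 * pi * real (e * k) / real n) =
      v l / of_nat n * cis (2 * pi * (real e * (real k - real l)) / real n)"
      by (simp add: field_simps)
  qed
  also have "\<dots> = (\<Sum>l<n. v l / of_nat n * (\<Sum>e<n. cis (2 * pi * (real e * (real k - real l)) / real n)))"
    by (subst sum.swap) (simp add: sum_distrib_left)
  also have "\<dots> = (\<Sum>l<n. if k = l then v l else 0)"
    by (rule sum.cong[OF refl]) (use n in \<open>simp add: orth\<close>)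
  also have "\<dots> = v k" using k by simp
  finally show ?thesis .
qed

text \<open>At most n^4 exponent tuples contribute a character sum each, and 4 covers the residues
  missing from \<open>unit_shifts B\<close>.\<close>

definition equidist_const :: "nat \<Rightarrow> real" where
  "equidist_const n = real n ^ 4 * charsum_const n + 4"

context cyclotomy
begin

text \<open>Each \<open>v b\<close> is expanded into characters of Z/n with coefficients of modulus
  at most 1. The tuple of zero exponents produces the product of averages; every other tuple is a
  nontrivial character sum.\<close>

lemma cls_equidistribution:
  fixes v :: "int \<Rightarrow> nat \<Rightarrow> complex"
  assumes B: "finite B" "card B \<le> 4" "inj_on (\<lambda>b. b mod int p) B"
    and v: "\<And>b k. b \<in> B \<Longrightarrow> k < n \<Longrightarrow> cmod (v b k) \<le> 1"
  shows "cmod ((\<Sum>x\<in>unit_shifts B. \<Prod>b\<in>B. v b (cls (x + b))) - of_nat p * (\<Prod>b\<in>B. (\<Sum>k<n. v b k) / of_nat n))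
     \<le> equidist_const n * sqrt p"
proof -
  define X where "X = unit_shifts B"
  define c where "c b e = (\<Sum>k<n. v b k * cis (- (2 * pi * real (e * k) / real n))) / of_nat n" for b e
  have c0: "c b 0 = (\<Sum>k<n. v b k) / of_nat n" for b by (simp add: c_def)
  have c1: "cmod (c b e) \<le> 1" if "b \<in> B" for b e
  proof -
    have "cmod (\<Sum>k<n. v b k * cis (- (2 * pi * real (e * k) / real n))) \<le> (\<Sum>k<n. 1)"
      by (rule sum_norm_le) (use v that in \<open>simp add: norm_mult\<close>)
    thus ?thesis using n_pos by (simp add: c_def norm_divide divide_le_eq)
  qed
  define F where "F = PiE B (\<lambda>_. {..<n})"
  define E0 where "E0 = restrict (\<lambda>_. 0::nat) B"
  define S where "S E = (\<Sum>x\<in>X. cis (2 * pi * real (\<Sum>b\<in>B. E b * cls (x + b)) / real n))" for E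
  have F: "finite F" unfolding F_def using B(1) by (intro finite_PiE) auto
  have E0: "E0 \<in> F" using n_pos by (simp add: E0_def F_def)
  have "(\<Sum>x\<in>X. \<Prod>b\<in>B. v b (cls (x + b))) =
     (\<Sum>x\<in>X. \<Prod>b\<in>B. \<Sum>e<n. c b e * cis (2 * pi * real (e * cls (x + b)) / real n))"
  proof (intro sum.cong prod.cong refl)
    fix x b assume "x \<in> X" "b \<in> B"
    hence "cls (x + b) < n" by (intro cls_less) (auto simp: X_def unit_shifts_def)
    thus "v b (cls (x + b)) = (\<Sum>e<n. c b e * cis (2 * pi * real (e * cls (x + b)) / real n))"
      unfolding c_def by (rule finite_Fourier_inversion[OF n_pos, symmetric])
  qed
  also have "\<dots> = (\<Sum>x\<in>X. \<Sum>E\<in>F. \<Prod>b\<in>B. c b (E b) * cis (2 * pi * real (E b * cls (x + b)) / real n))"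
    unfolding F_def by (intro sum.cong refl prod_sum_PiE B(1)) auto
  also have "\<dots> = (\<Sum>E\<in>F. \<Sum>x\<in>X. \<Prod>b\<in>B. c b (E b) * cis (2 * pi * real (E b * cls (x + b)) / real n))"
    by (rule sum.swap)
  also have "\<dots> = (\<Sum>E\<in>F. (\<Prod>b\<in>B. c b (E b)) * S E)"
  proof (rule sum.cong[OF refl])
    fix E
    have "(\<Prod>b\<in>B. cis (2 * pi * real (E b * cls (x + b)) / real n)) =
      cis (2 * pi * real (\<Sum>b\<in>B. E b * cls (x + b)) / real n)" for x
      using B(1) by (induction B) (simp_all add: cis_mult add_divide_distrib distrib_left del: of_nat_mult)
    thus "(\<Sum>x\<in>X. \<Prod>b\<in>B. c b (E b) * cis (2 * pi * real (E b * cls (x + b)) / real n)) = (\<Prod>b\<in>B. c b (E b)) * S E"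
      by (simp only: prod.distrib S_def sum_distrib_left)
  qed
  also have "\<dots> = (\<Prod>b\<in>B. c b (E0 b)) * S E0 + (\<Sum>E\<in>F - {E0}. (\<Prod>b\<in>B. c b (E b)) * S E)"
    using F E0 by (simp add: sum.remove)
  also have "(\<Prod>b\<in>B. c b (E0 b)) = (\<Prod>b\<in>B. (\<Sum>k<n. v b k) / of_nat n)"
    by (rule prod.cong) (simp_all add: E0_def c0)
  also have "S E0 = of_nat (card X)" by (simp add: S_def E0_def)
  finally have eq: "(\<Sum>x\<in>X. \<Prod>b\<in>B. v b (cls (x + b))) - of_nat p * (\<Prod>b\<in>B. (\<Sum>k<n. v b k) / of_nat n) =
     (\<Prod>b\<in>B. (\<Sum>k<n. v b k) / of_nat n) * (of_nat (card X) - of_nat p) + (\<Sum>E\<in>F - {E0}. (\<Prod>b\<in>B. c b (E b)) * S E)"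
    by (simp add: algebra_simps)
  have cprod: "cmod (\<Prod>b\<in>B. c b (E b)) \<le> 1" for E
    unfolding prod_norm[symmetric] by (rule prod_le_1) (use c1 in auto)
  have SE: "cmod (S E) \<le> charsum_const n * sqrt p" if "E \<in> F - {E0}" for E
    unfolding S_def X_def
  proof (rule character_sum_bound[OF B])
    show "E b < n" if "b \<in> B" for b using that \<open>E \<in> F - {E0}\<close> by (auto simp: F_def)
    show "\<exists>b\<in>B. E b \<noteq> 0"
    proof (rule ccontr)
      assume "\<not> ?thesis"
      hence "E = E0" using \<open>E \<in> F - {E0}\<close> E0 unfolding F_def by (intro PiE_ext[of E B _ E0]) (auto simp: E0_def)
      thus False using \<open>E \<in> F - {E0}\<close> by simp
    qed
  qed
  have "cmod (\<Sum>E\<in>F - {E0}. (\<Prod>b\<in>B. c b (E b)) * S E) \<le> (\<Sum>E\<in>F - {E0}. 1 * (charsum_const n * sqrt p))"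
    by (rule sum_norm_le) (unfold norm_mult, intro mult_mono cprod SE, auto)
  also have "\<dots> = real (card (F - {E0})) * (charsum_const n * sqrt p)" by simp
  also have "\<dots> \<le> real n ^ 4 * (charsum_const n * sqrt p)"
  proof (rule mult_right_mono)
    have "card (F - {E0}) \<le> card F" by (rule card_mono) (auto simp: F)
    also have "card F = n ^ card B" unfolding F_def using B(1) by (simp add: card_PiE)
    also have "\<dots> \<le> n ^ 4" using B(2) n_pos by (intro power_increasing) auto
    finally have "real (card (F - {E0})) \<le> real (n ^ 4)" by (rule of_nat_mono)
    thus "real (card (F - {E0})) \<le> real n ^ 4" by simp
  qed (simp add: charsum_const_nonneg)
  finally have 1: "cmod (\<Sum>E\<in>F - {E0}. (\<Prod>b\<in>B. c b (E b)) * S E) \<le> real n ^ 4 * (charsum_const n * sqrt p)" .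
  have "cmod ((\<Prod>b\<in>B. (\<Sum>k<n. v b k) / of_nat n) * (of_nat (card X) - of_nat p)) \<le> 1 * 4"
    unfolding norm_mult
  proof (rule mult_mono)
    show "cmod (\<Prod>b\<in>B. (\<Sum>k<n. v b k) / of_nat n) \<le> 1"
      using cprod[of "\<lambda>_. 0"] by (simp only: c0)
    have "cmod (of_nat (card X) - of_nat p) = \<bar>real (card X) - real p\<bar>"
      by (metis norm_of_real of_real_diff of_real_of_nat_eq)
    thus "cmod (of_nat (card X) - of_nat p) \<le> 4"
      using card_unit_shifts[OF B(1,2)] unfolding X_def by linarith
  qed auto
  also have "1 * 4 \<le> 4 * sqrt p" using p_gt1 by simp
  finally have 2: "cmod ((\<Prod>b\<in>B. (\<Sum>k<n. v b k) / of_nat n) * (of_nat (card X) - of_nat p)) \<le> 4 * sqrt p" .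
  show ?thesis
    unfolding X_def[symmetric] eq
    by (rule norm_triangle_le) (use 1 2 in \<open>simp add: equidist_const_def algebra_simps\<close>)
qed

definition avg :: "(nat \<Rightarrow> complex) \<Rightarrow> complex" where
  "avg w = (\<Sum>k<n. w k) / of_nat n"

text \<open>All four functions have average 0, so a shift occurring only once kills the main term.
  There remain the three pairings and the case of four equal shifts; there all three pairing terms
  are present too and have to be subtracted again.\<close>

lemma four_fold_correlation_scaled:
  fixes w1 w2 w3 w4 :: "nat \<Rightarrow> complex" and b1 b2 b3 b4 :: int
  assumes w: "\<And>k. k < n \<Longrightarrow> cmod (w1 k) \<le> 1" "\<And>k. k < n \<Longrightarrow> cmod (w2 k) \<le> 1"
      "\<And>k. k < n \<Longrightarrow> cmod (w3 k) \<le> 1" "\<And>k. k < n \<Longrightarrow> cmod (w4 k) \<le> 1"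
    and b: "{b1, b2, b3, b4} \<subseteq> {0..<int p}"
    and bal: "avg w1 = 0" "avg w2 = 0" "avg w3 = 0" "avg w4 = 0"
  defines "A12 \<equiv> avg (\<lambda>k. w1 k * w2 k)" and "A34 \<equiv> avg (\<lambda>k. w3 k * w4 k)"
    and "A13 \<equiv> avg (\<lambda>k. w1 k * w3 k)" and "A24 \<equiv> avg (\<lambda>k. w2 k * w4 k)"
    and "A14 \<equiv> avg (\<lambda>k. w1 k * w4 k)" and "A23 \<equiv> avg (\<lambda>k. w2 k * w3 k)"
    and "A4 \<equiv> avg (\<lambda>k. w1 k * w2 k * w3 k * w4 k)"
  shows "cmod ((\<Sum>x\<in>unit_shifts {b1, b2, b3, b4}. w1 (cls (x + b1)) * w2 (cls (x + b2)) * w3 (cls (x + b3)) * w4 (cls (x + b4)))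
     - of_nat p * ((if b1 = b2 \<and> b3 = b4 then A12 * A34 else 0) + (if b1 = b4 \<and> b2 = b3 then A14 * A23 else 0)
         + (if b1 = b3 \<and> b2 = b4 then A13 * A24 else 0)
         + (if b1 = b2 \<and> b2 = b3 \<and> b3 = b4 then A4 - A12 * A34 - A14 * A23 - A13 * A24 else 0)))
     \<le> equidist_const n * sqrt p"
proof -
  define B where "B = {b1, b2, b3, b4}"
  \<comment> \<open>Functions attached to the same shift are merged, since equidistribution is
    stated for a set of distinct shifts.\<close>
  define v where "v b k = (if b = b1 then w1 k else 1) * (if b = b2 then w2 k else 1) * (if b = b3 then w3 k else 1) * (if b = b4 then w4 k else 1)" for b k
  have cardB: "card B \<le> 4" using card_length[of "[b1, b2, b3, b4]"] by (simp add: B_def)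
  have injB: "inj_on (\<lambda>b. b mod int p) B" 
  proof (rule inj_onI)
    fix x y assume "x \<in> B" "y \<in> B" "x mod int p = y mod int p"
    moreover have "x \<in> {0..<int p}" "y \<in> {0..<int p}" using b \<open>x \<in> B\<close> \<open>y \<in> B\<close> unfolding B_def by blast+
    ultimately show "x = y" by simp
  qed
  have v1: "cmod (v b k) \<le> 1" if "k < n" for b k
  proof -
    have *: "cmod (if Q then w else 1) \<le> 1" if "cmod w \<le> 1" for Q w using that by simp
    show ?thesis unfolding v_def norm_mult by (intro mult_le_one mult_nonneg_nonneg norm_ge_zero * w that)
  qed
  have prodv: "(\<Prod>b\<in>B. v b (cls (x + b))) = w1 (cls (x + b1)) * w2 (cls (x + b2)) * w3 (cls (x + b3)) * w4 (cls (x + b4))" for x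
  proof -
    have *: "(\<Prod>b\<in>B. if b = c then w (cls (x + b)) else 1) = w (cls (x + c))" if "c \<in> B" for c and w :: "nat \<Rightarrow> complex"
      using that by (subst prod.delta) (auto simp: B_def)
    have "b1 \<in> B" "b2 \<in> B" "b3 \<in> B" "b4 \<in> B" by (auto simp: B_def)
    thus ?thesis unfolding v_def prod.distrib by (simp only: *)
  qed
  have avgv: "(\<Sum>k<n. v b k) / of_nat n = avg (v b)" for b by (simp add: avg_def)
  have "(\<Prod>b\<in>B. avg (v b)) = ((if b1 = b2 \<and> b3 = b4 then A12 * A34 else 0) + (if b1 = b4 \<and> b2 = b3 then A14 * A23 else 0)
         + (if b1 = b3 \<and> b2 = b4 then A13 * A24 else 0)
         + (if b1 = b2 \<and> b2 = b3 \<and> b3 = b4 then A4 - A12 * A34 - A14 * A23 - A13 * A24 else 0))"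
    unfolding B_def v_def A12_def A34_def A13_def A24_def A14_def A23_def A4_def
    by (cases "b1 = b2"; cases "b1 = b3"; cases "b1 = b4"; cases "b2 = b3"; cases "b2 = b4"; cases "b3 = b4")
      (auto simp: bal mult_ac prod.insert_if)
  moreover have "cmod ((\<Sum>x\<in>unit_shifts B. \<Prod>b\<in>B. v b (cls (x + b))) - of_nat p * (\<Prod>b\<in>B. (\<Sum>k<n. v b k) / of_nat n))
     \<le> equidist_const n * sqrt p"
    by (rule cls_equidistribution[OF _ cardB injB v1]) (simp add: B_def)
  ultimately show ?thesis unfolding prodv avgv B_def[symmetric] by (simp only:)
qed

end

section \<open>Fourier analysis of aperiodic correlations\<close>

definition ep :: "real \<Rightarrow> complex" where "ep x = cis (2 * pi * x)"

lemma ep_add: "ep (x + y) = ep x * ep y" by (simp add: ep_def cis_mult distrib_left)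
lemma ep_0 [simp]: "ep 0 = 1" by (simp add: ep_def)
lemma norm_ep [simp]: "cmod (ep x) = 1" by (simp add: ep_def)
lemma cnj_ep: "cnj (ep x) = ep (- x)" by (simp add: ep_def cis_cnj)
lemma ep_of_int [simp]: "ep (of_int k) = 1" unfolding ep_def by (rule cis_multiple_2pi) simp
lemma ep_add_int: "ep (x + of_int k) = ep x" by (simp add: ep_add)
lemma ep_power: "ep x ^ k = ep (real k * x)"
  unfolding ep_def Complex.DeMoivre by (rule arg_cong[of _ _ cis]) simp

lemma ep_eq_1_iff: "ep x = 1 \<longleftrightarrow> x \<in> \<int>"
proof
  assume "ep x = 1"
  hence "cos (2 * pi * x) = 1" by (simp add: ep_def complex_eq_iff)
  then obtain m :: int where "2 * pi * x = of_int m * 2 * pi" unfolding cos_one_2pi_int by blast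
  hence "2 * pi * x = 2 * pi * of_int m" by (simp only: mult_ac)
  hence "x = of_int m" by (simp only: mult_cancel_left) simp
  thus "x \<in> \<int>" by simp
qed (auto elim: Ints_cases)

lemma ep_cong_mod:
  assumes "q > 0" "x mod int q = y mod int q"
  shows "ep (of_int x / real q) = ep (of_int y / real q)"
proof -
  obtain k where "x - y = int q * k" using assms(2) by (auto simp: mod_eq_dvd_iff elim: dvdE)
  hence "x = y + int q * k" by simp
  hence "of_int x / real q = of_int y / real q + of_int k" using assms(1) by (simp add: field_simps)
  thus ?thesis by (simp only: ep_add_int)
qed

lemma sum_int_interval: "(\<Sum>j\<in>{0..<int q}. f j) = (\<Sum>j<q. f (int j))"
  by (rule sum.reindex_bij_witness[of _ int nat]) auto

lemma sum_ep:
  assumes q: "q > 0"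
  shows "(\<Sum>j\<in>{0..<int q}. ep (of_int (j * t) / real q)) = (if int q dvd t then of_nat q else 0)"
proof -
  define w where "w = ep (of_int t / real q)"
  have w: "ep (of_int (int j * t) / real q) = w ^ j" for j unfolding w_def ep_power by simp
  have eq: "(\<Sum>j\<in>{0..<int q}. ep (of_int (j * t) / real q)) = (\<Sum>j<q. w ^ j)"
    unfolding sum_int_interval w ..
  have wq: "w ^ q = 1" unfolding w_def ep_power using q by simp
  have w1: "w = 1 \<longleftrightarrow> int q dvd t"
  proof
    assume "w = 1"
    then obtain m :: int where "of_int t / real q = of_int m" unfolding w_def ep_eq_1_iff by (elim Ints_cases)
    hence "of_int t = (of_int (int q * m) :: real)" using q by (simp add: field_simps)
    hence "t = int q * m" by (simp only: of_int_eq_iff)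
    thus "int q dvd t" by simp
  next
    assume "int q dvd t"
    then obtain m where "t = int q * m" by (elim dvdE)
    thus "w = 1" using q by (simp add: w_def)
  qed
  show ?thesis
  proof (cases "int q dvd t")
    case True
    hence "w = 1" using w1 by blast
    thus ?thesis unfolding eq using True by simp
  next
    case False
    hence "w \<noteq> 1" using w1 by blast
    thus ?thesis unfolding eq using False wq by (simp add: sum_gp_strict)
  qed
qed

text \<open>\<open>S\<close> is any set of pairwise incongruent integers: for correlations it is the
  set of negated shifts, which is not an interval from 0.\<close>

lemma finite_Parseval:
  fixes c d :: "int \<Rightarrow> complex"
  assumes q: "q > 0" and S: "finite S" and inj: "inj_on (\<lambda>s. s mod int q) S"
  shows "(\<Sum>k\<in>{0..<int q}. (\<Sum>s\<in>S. c s * ep (of_int (s * k) / real q)) * cnj (\<Sum>s\<in>S. d s * ep (of_int (s * k) / real q)))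
     = of_nat q * (\<Sum>s\<in>S. c s * cnj (d s))"
proof -
  have "(\<Sum>s\<in>S. c s * ep (of_int (s * k) / real q)) * cnj (\<Sum>s\<in>S. d s * ep (of_int (s * k) / real q))
     = (\<Sum>s\<in>S. \<Sum>t\<in>S. c s * cnj (d t) * ep (of_int (k * (s - t)) / real q))" for k
    unfolding cnj_sum sum_product
  proof (intro sum.cong refl)
    fix s t
    have "ep (of_int (s * k) / real q) * cnj (ep (of_int (t * k) / real q)) = ep (of_int (k * (s - t)) / real q)"
      unfolding cnj_ep ep_add[symmetric] by (rule arg_cong[of _ _ ep]) (simp add: algebra_simps diff_divide_distrib)
    thus "c s * ep (of_int (s * k) / real q) * cnj (d t * ep (of_int (t * k) / real q)) =
      c s * cnj (d t) * ep (of_int (k * (s - t)) / real q)" by (simp add: mult_ac)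
  qed
  hence "(\<Sum>k\<in>{0..<int q}. (\<Sum>s\<in>S. c s * ep (of_int (s * k) / real q)) * cnj (\<Sum>s\<in>S. d s * ep (of_int (s * k) / real q)))
     = (\<Sum>k\<in>{0..<int q}. \<Sum>s\<in>S. \<Sum>t\<in>S. c s * cnj (d t) * ep (of_int (k * (s - t)) / real q))" by (simp only:)
  also have "\<dots> = (\<Sum>s\<in>S. \<Sum>k\<in>{0..<int q}. \<Sum>t\<in>S. c s * cnj (d t) * ep (of_int (k * (s - t)) / real q))"
    by (rule sum.swap)
  also have "\<dots> = (\<Sum>s\<in>S. \<Sum>t\<in>S. \<Sum>k\<in>{0..<int q}. c s * cnj (d t) * ep (of_int (k * (s - t)) / real q))"
    by (intro sum.cong refl sum.swap)
  also have "\<dots> = (\<Sum>s\<in>S. \<Sum>t\<in>S. c s * cnj (d t) * (if s = t then of_nat q else 0))"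
    unfolding sum_distrib_left[symmetric] sum_ep[OF q]
  proof (intro sum.cong refl arg_cong[of _ _ "(*) _"])
    fix s t assume st: "s \<in> S" "t \<in> S"
    have "int q dvd s - t \<longleftrightarrow> s = t"
      using inj_onD[OF inj _ st] by (auto simp: mod_eq_dvd_iff)
    thus "(if int q dvd s - t then of_nat q else 0) = (if s = t then of_nat q else (0::complex))" by simp
  qed
  also have "\<dots> = (\<Sum>s\<in>S. \<Sum>t\<in>S. if s = t then of_nat q * (c s * cnj (d s)) else 0)"
    by (intro sum.cong refl) auto
  also have "\<dots> = of_nat q * (\<Sum>s\<in>S. c s * cnj (d s))" using S by (simp add: sum_distrib_left)
  finally show ?thesis .
qed

lemma inj_on_mod_interval: "inj_on (\<lambda>s. s mod int q) {0..<int q}"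
  by (rule inj_onI) simp

lemma finite_Parseval_norm:
  fixes c :: "int \<Rightarrow> complex"
  assumes "q > 0" "finite S" "inj_on (\<lambda>s. s mod int q) S"
  shows "(\<Sum>k\<in>{0..<int q}. (cmod (\<Sum>s\<in>S. c s * ep (of_int (s * k) / real q)))\<^sup>2) = real q * (\<Sum>s\<in>S. (cmod (c s))\<^sup>2)"
proof -
  have "complex_of_real (\<Sum>k\<in>{0..<int q}. (cmod (\<Sum>s\<in>S. c s * ep (of_int (s * k) / real q)))\<^sup>2)
     = complex_of_real (real q * (\<Sum>s\<in>S. (cmod (c s))\<^sup>2))"
    by (simp only: of_real_sum of_real_mult complex_norm_square of_real_of_nat_eq finite_Parseval[OF assms])
  thus ?thesis by (simp only: of_real_eq_iff)
qed

lemma periodic_sum_shift: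
  fixes \<phi> :: "int \<Rightarrow> 'a::comm_monoid_add"
  assumes q: "q > 0" and per: "\<And>x. \<phi> (x mod int q) = \<phi> x"
  shows "(\<Sum>x\<in>{0..<int q}. \<phi> (c + x)) = (\<Sum>x\<in>{0..<int q}. \<phi> x)"
proof (rule sum.reindex_bij_witness[of _ "\<lambda>y. (y - c) mod int q" "\<lambda>x. (c + x) mod int q"])
  fix x assume "x \<in> {0..<int q}"
  show "\<phi> ((c + x) mod int q) = \<phi> (c + x)" by (rule per)
qed (use q in \<open>auto simp: mod_simps\<close>)

lemma crosscorr_eq:
  assumes g: "\<And>j. j \<notin> {0..<int q} \<Longrightarrow> g j = 0"
  shows "crosscorr f g s = (\<Sum>j\<in>{0..<int q}. f (j + s) * cnj (g j))"
  unfolding crosscorr_def by (rule sum.mono_neutral_left) (use g in force)+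

lemma crosscorr_eq_0:
  assumes g: "\<And>j. j \<notin> {0..<int q} \<Longrightarrow> g j = 0" and f: "\<And>j. j \<notin> {0..<int q} \<Longrightarrow> f j = 0"
    and s: "s \<notin> {- int q<..<int q}"
  shows "crosscorr f g s = 0"
proof -
  have "crosscorr f g s = (\<Sum>j\<in>{0..<int q}. f (j + s) * cnj (g j))" by (rule crosscorr_eq) (rule g)
  also have "\<dots> = 0"
  proof (rule sum.neutral, safe)
  fix j assume "j \<in> {0..<int q}"
  hence "j + s \<notin> {0..<int q}" using s by auto
  thus "f (j + s) * cnj (g j) = 0" using f by simp
  qed
  finally show ?thesis .
qed

definition spectrum2 :: "nat \<Rightarrow> (int \<Rightarrow> complex) \<Rightarrow> int \<Rightarrow> complex" where
  "spectrum2 q f k = (\<Sum>j\<in>{0..<int q}. f j * ep (- of_int (j * k) / real (2 * q)))"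

text \<open>The product of one spectrum with the conjugate of the other is the transform of the
  correlation. Its at most 2q - 1 shifts are distinct modulo 2q, so Parseval is exact; with only q
  samples they would alias.\<close>

lemma crosscorr_sampling:
  assumes q: "q > 0"
    and f: "\<And>j. j \<notin> {0..<int q} \<Longrightarrow> f j = 0" and g: "\<And>j. j \<notin> {0..<int q} \<Longrightarrow> g j = 0"
  shows "real (2 * q) * (\<Sum>s\<in>{s. crosscorr f g s \<noteq> 0}. (cmod (crosscorr f g s))\<^sup>2)
    = (\<Sum>k\<in>{0..<int (2 * q)}. (cmod (spectrum2 q f k))\<^sup>2 * (cmod (spectrum2 q g k))\<^sup>2)"
proof -
  define S where "S = {- int q<..<int q}"
  have prod: "spectrum2 q f k * cnj (spectrum2 q g k) = (\<Sum>s\<in>S. crosscorr f g s * ep (of_int (s * - k) / real (2 * q)))" for k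
  proof -
    have "spectrum2 q f k * cnj (spectrum2 q g k) =
      (\<Sum>j\<in>{0..<int q}. \<Sum>i\<in>{0..<int q}. f i * cnj (g j) * ep (of_int ((i - j) * - k) / real (2 * q)))"
      unfolding spectrum2_def cnj_sum sum_product
    proof (subst sum.swap, intro sum.cong refl)
      fix i j
      have "ep (- of_int (i * k) / real (2 * q)) * cnj (ep (- of_int (j * k) / real (2 * q))) = ep (of_int ((i - j) * - k) / real (2 * q))"
        unfolding cnj_ep ep_add[symmetric] by (rule arg_cong[of _ _ ep]) (simp add: algebra_simps diff_divide_distrib add_divide_distrib)
      thus "f i * ep (- of_int (i * k) / real (2 * q)) * cnj (g j * ep (- of_int (j * k) / real (2 * q))) =
         f i * cnj (g j) * ep (of_int ((i - j) * - k) / real (2 * q))" by (simp add: mult_ac)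
    qed
    also have "\<dots> = (\<Sum>j\<in>{0..<int q}. \<Sum>s\<in>S. f (j + s) * cnj (g j) * ep (of_int (s * - k) / real (2 * q)))"
    proof (rule sum.cong[OF refl])
      fix j assume j: "j \<in> {0..<int q}"
      have "(\<Sum>s\<in>S. f (j + s) * cnj (g j) * ep (of_int (s * - k) / real (2 * q))) =
        (\<Sum>s\<in>{- j..<int q - j}. f (j + s) * cnj (g j) * ep (of_int (s * - k) / real (2 * q)))"
        by (rule sum.mono_neutral_right) (use j f in \<open>auto simp: S_def\<close>)
      also have "\<dots> = (\<Sum>i\<in>{0..<int q}. f i * cnj (g j) * ep (of_int ((i - j) * - k) / real (2 * q)))"
        by (rule sum.reindex_bij_witness[of _ "\<lambda>i. i - j" "\<lambda>s. j + s"]) auto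
      finally show "(\<Sum>i\<in>{0..<int q}. f i * cnj (g j) * ep (of_int ((i - j) * - k) / real (2 * q))) =
        (\<Sum>s\<in>S. f (j + s) * cnj (g j) * ep (of_int (s * - k) / real (2 * q)))" by simp
    qed
    also have "\<dots> = (\<Sum>s\<in>S. \<Sum>j\<in>{0..<int q}. f (j + s) * cnj (g j) * ep (of_int (s * - k) / real (2 * q)))"
      by (rule sum.swap)
    also have "\<dots> = (\<Sum>s\<in>S. crosscorr f g s * ep (of_int (s * - k) / real (2 * q)))"
    proof -
      have "crosscorr f g s = (\<Sum>j\<in>{0..<int q}. f (j + s) * cnj (g j))" for s by (rule crosscorr_eq) (rule g)
      thus ?thesis by (simp only: sum_distrib_right)
    qed
    finally show ?thesis .
  qed
  have inj: "inj_on (\<lambda>s. s mod int (2 * q)) (uminus ` S)"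
  proof (rule inj_onI)
    fix x y assume xy: "x \<in> uminus ` S" "y \<in> uminus ` S" "x mod int (2 * q) = y mod int (2 * q)"
    hence "int (2 * q) dvd x - y" by (simp add: mod_eq_dvd_iff)
    moreover have "\<bar>x - y\<bar> < int (2 * q)" using xy(1,2) by (auto simp: S_def)
    ultimately show "x = y" using zdvd_imp_le[of "int (2 * q)" "\<bar>x - y\<bar>"] by auto
  qed
  have "(\<Sum>k\<in>{0..<int (2 * q)}. (cmod (spectrum2 q f k))\<^sup>2 * (cmod (spectrum2 q g k))\<^sup>2) =
     (\<Sum>k\<in>{0..<int (2 * q)}. (cmod (\<Sum>s\<in>S. crosscorr f g s * ep (of_int (s * - k) / real (2 * q))))\<^sup>2)"
    unfolding prod[symmetric] by (simp add: norm_mult power_mult_distrib)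
  also have "\<dots> = (\<Sum>k\<in>{0..<int (2 * q)}. (cmod (\<Sum>s\<in>uminus ` S. crosscorr f g (- s) * ep (of_int (s * k) / real (2 * q))))\<^sup>2)"
    by (simp add: sum.reindex)
  also have "\<dots> = real (2 * q) * (\<Sum>s\<in>uminus ` S. (cmod (crosscorr f g (- s)))\<^sup>2)"
    by (rule finite_Parseval_norm[OF _ _ inj]) (use q in \<open>auto simp: S_def\<close>)
  also have "(\<Sum>s\<in>uminus ` S. (cmod (crosscorr f g (- s)))\<^sup>2) = (\<Sum>s\<in>S. (cmod (crosscorr f g s))\<^sup>2)"
    by (simp add: sum.reindex)
  also have "\<dots> = (\<Sum>s\<in>{s. crosscorr f g s \<noteq> 0}. (cmod (crosscorr f g s))\<^sup>2)"
  proof (rule sum.mono_neutral_right)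
    show "{s. crosscorr f g s \<noteq> 0} \<subseteq> S"
    proof
      fix s assume "s \<in> {s. crosscorr f g s \<noteq> 0}"
      moreover have "crosscorr f g s = 0" if "s \<notin> {- int q<..<int q}"
        by (rule crosscorr_eq_0[of q]) (use f g that in blast)+
      ultimately show "s \<in> S" unfolding S_def by blast
    qed
  qed (auto simp: S_def)
  finally show ?thesis by simp
qed

section \<open>Samples of a rotated periodic sequence at even and odd frequencies\<close>

definition dft :: "nat \<Rightarrow> (int \<Rightarrow> complex) \<Rightarrow> int \<Rightarrow> complex" where
  "dft q u t = (\<Sum>h\<in>{0..<int q}. u h * ep (- of_int (h * t) / real q)) / of_real (sqrt q)"

lemma dft_mod: "q > 0 \<Longrightarrow> dft q u (t mod int q) = dft q u t"
proof -
  assume q: "q > 0"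
  have "ep (- of_int (h * (t mod int q)) / real q) = ep (- of_int (h * t) / real q)" for h
  proof -
    have "(- (h * (t mod int q))) mod int q = (- (h * t)) mod int q" by (simp add: mod_simps flip: mult_minus_left)
    from ep_cong_mod[OF q this] show ?thesis by simp
  qed
  thus ?thesis by (simp only: dft_def)
qed

lemma dft_inversion:
  assumes q: "q > 0" and per: "u (h mod int q) = u h"
  shows "(\<Sum>t\<in>{0..<int q}. dft q u t * ep (of_int (t * h) / real q)) = of_real (sqrt q) * u h"
proof -
  have "(\<Sum>t\<in>{0..<int q}. dft q u t * ep (of_int (t * h) / real q)) =
     (\<Sum>t\<in>{0..<int q}. \<Sum>x\<in>{0..<int q}. u x * ep (of_int (t * (h - x)) / real q)) / of_real (sqrt q)"
    unfolding sum_divide_distrib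
  proof (rule sum.cong[OF refl])
    fix t
    have "ep (- of_int (x * t) / real q) * ep (of_int (t * h) / real q) = ep (of_int (t * (h - x)) / real q)" for x
      unfolding ep_add[symmetric] by (rule arg_cong[of _ _ ep]) (simp add: algebra_simps diff_divide_distrib)
    thus "dft q u t * ep (of_int (t * h) / real q) = (\<Sum>x\<in>{0..<int q}. u x * ep (of_int (t * (h - x)) / real q) / of_real (sqrt q))"
      by (simp add: dft_def sum_distrib_right sum_divide_distrib mult.assoc)
  qed
  also have "(\<Sum>t\<in>{0..<int q}. \<Sum>x\<in>{0..<int q}. u x * ep (of_int (t * (h - x)) / real q)) =
     (\<Sum>x\<in>{0..<int q}. u x * (if int q dvd h - x then of_nat q else 0))"
    by (subst sum.swap) (simp only: sum_distrib_left[symmetric] sum_ep[OF q])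
  also have "\<dots> = (\<Sum>x\<in>{0..<int q}. if x = h mod int q then of_nat q * u x else 0)"
  proof (rule sum.cong[OF refl])
    fix x assume "x \<in> {0..<int q}"
    hence "int q dvd h - x \<longleftrightarrow> x = h mod int q" by (auto simp: mod_eq_dvd_iff[symmetric])
    thus "u x * (if int q dvd h - x then of_nat q else 0) = (if x = h mod int q then of_nat q * u x else 0)" by simp
  qed
  also have "\<dots> = of_nat q * u h" using q per by simp
  also have "of_nat q * u h / of_real (sqrt q) = of_real (sqrt q) * u h"
  proof -
    have "(of_nat q :: complex) = of_real (sqrt q) * of_real (sqrt q)" unfolding of_real_mult[symmetric] by simp
    thus ?thesis using q by simp
  qed
  finally show ?thesis .
qed

text \<open>The normalised Dirichlet kernel at the half-integer \<open>b - 1/2\<close>: the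
  frequency \<open>2 * m + 1\<close> lies at \<open>m + 1/2\<close> on the scale of
  \<open>dft\<close>, and its sample is interpolated from the values at
  \<open>m + b\<close>.\<close>

definition half_kernel :: "nat \<Rightarrow> int \<Rightarrow> complex" where
  "half_kernel q b = (\<Sum>j\<in>{0..<int q}. ep (of_int (j * (2 * b - 1)) / real (2 * q))) / of_nat q"

text \<open>At even frequencies the exponential has period \<open>q\<close>, so a rotation is a mere
  translation and contributes only a phase.\<close>

lemma spectrum2_even:
  assumes q: "q > 0" and per: "\<And>h. u (h mod int q) = u h"
  shows "spectrum2 q (rotation q u r) (2 * m) = of_real (sqrt q) * ep (of_int (m * r) / real q) * dft q u m"
proof -
  define \<phi> where "\<phi> x = u x * ep (- of_int (x * m) / real q)" for x
  have "spectrum2 q (rotation q u r) (2 * m) = (\<Sum>j\<in>{0..<int q}. ep (of_int (m * r) / real q) * \<phi> (r + j))"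
    unfolding spectrum2_def
  proof (rule sum.cong[OF refl])
    fix j assume j: "j \<in> {0..<int q}"
    have "ep (- of_int (j * (2 * m)) / real (2 * q)) = ep (of_int (m * r) / real q) * ep (- of_int ((r + j) * m) / real q)"
      unfolding ep_add[symmetric] by (rule arg_cong[of _ _ ep]) (use q in \<open>simp add: field_simps\<close>)
    thus "rotation q u r j * ep (- of_int (j * (2 * m)) / real (2 * q)) = ep (of_int (m * r) / real q) * \<phi> (r + j)"
      using j per by (simp add: rotation_def \<phi>_def)
  qed
  also have "\<dots> = ep (of_int (m * r) / real q) * (\<Sum>j\<in>{0..<int q}. \<phi> j)"
    unfolding sum_distrib_left[symmetric]
  proof (rule arg_cong[of _ _ "(*) _"], rule periodic_sum_shift[OF q])
    fix x
    have "(- ((x mod int q) * m)) mod int q = (- (x * m)) mod int q" by (simp add: mod_simps flip: mult_minus_right)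
    from ep_cong_mod[OF q this] show "\<phi> (x mod int q) = \<phi> x" by (simp add: \<phi>_def per)
  qed
  also have "(\<Sum>j\<in>{0..<int q}. \<phi> j) = of_real (sqrt q) * dft q u m" using q by (simp add: dft_def \<phi>_def)
  finally show ?thesis by (simp add: mult_ac)
qed

text \<open>Fourier inversion is inserted for \<open>u\<close>, and the sum over positions becomes
  the kernel. The rotation now leaves the phase \<open>ep (b * r / q)\<close> inside the sum; this
  is where the limit acquires its dependence on the rotation.\<close>

lemma spectrum2_odd:
  assumes q: "q > 0" and per: "\<And>h. u (h mod int q) = u h"
  shows "spectrum2 q (rotation q u r) (2 * m + 1) = of_real (sqrt q) * ep (of_int (m * r) / real q) *
    (\<Sum>b\<in>{0..<int q}. dft q u (m + b) * (half_kernel q b * ep (of_int (b * r) / real q)))"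
proof -
  define s where "s = complex_of_real (sqrt q)"
  have s: "s \<noteq> 0" "s * s = of_nat q" using q unfolding s_def of_real_mult[symmetric] by simp_all
  have u: "u h = (\<Sum>b\<in>{0..<int q}. dft q u (m + b) * ep (of_int ((m + b) * h) / real q)) / s" for h
  proof -
    define \<phi> where "\<phi> t = dft q u t * ep (of_int (t * h) / real q)" for t
    have "(\<Sum>b\<in>{0..<int q}. \<phi> (m + b)) = (\<Sum>b\<in>{0..<int q}. \<phi> b)"
    proof (rule periodic_sum_shift[OF q])
      fix x
      have "((x mod int q) * h) mod int q = (x * h) mod int q" by (simp add: mod_simps)
      from ep_cong_mod[OF q this] show "\<phi> (x mod int q) = \<phi> x" by (simp add: \<phi>_def dft_mod[OF q])
    qed
    also have "\<dots> = s * u h" unfolding \<phi>_def s_def by (rule dft_inversion[where u = u, OF q per])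
    finally show ?thesis using s by (simp add: \<phi>_def field_simps)
  qed
  have "spectrum2 q (rotation q u r) (2 * m + 1) =
    (\<Sum>j\<in>{0..<int q}. \<Sum>b\<in>{0..<int q}. dft q u (m + b) / s * ep (of_int (m * r) / real q) * ep (of_int (b * r) / real q) *
       ep (of_int (j * (2 * b - 1)) / real (2 * q)))"
    unfolding spectrum2_def
  proof (rule sum.cong[OF refl])
    fix j assume j: "j \<in> {0..<int q}"
    have e: "ep (of_int ((m + b) * (r + j)) / real q) * ep (- of_int (j * (2 * m + 1)) / real (2 * q)) =
      ep (of_int (m * r) / real q) * ep (of_int (b * r) / real q) * ep (of_int (j * (2 * b - 1)) / real (2 * q))" for b
      unfolding ep_add[symmetric] by (rule arg_cong[of _ _ ep]) (use q in \<open>simp add: field_simps\<close>)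
    have "rotation q u r j = u (r + j)" using j per by (simp add: rotation_def)
    also have "\<dots> = (\<Sum>b\<in>{0..<int q}. dft q u (m + b) * ep (of_int ((m + b) * (r + j)) / real q)) / s" by (rule u)
    finally show "rotation q u r j * ep (- of_int (j * (2 * m + 1)) / real (2 * q)) =
      (\<Sum>b\<in>{0..<int q}. dft q u (m + b) / s * ep (of_int (m * r) / real q) * ep (of_int (b * r) / real q) *
       ep (of_int (j * (2 * b - 1)) / real (2 * q)))"
      by (simp only: sum_divide_distrib sum_distrib_right)
        (intro sum.cong refl, simp only: times_divide_eq_left mult.assoc e[unfolded mult.assoc])
  qed
  also have "\<dots> = (\<Sum>b\<in>{0..<int q}. \<Sum>j\<in>{0..<int q}. dft q u (m + b) / s * ep (of_int (m * r) / real q) * ep (of_int (b * r) / real q) *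
       ep (of_int (j * (2 * b - 1)) / real (2 * q)))" by (rule sum.swap)
  also have "\<dots> = (\<Sum>b\<in>{0..<int q}. dft q u (m + b) / s * ep (of_int (m * r) / real q) * ep (of_int (b * r) / real q) * (of_nat q * half_kernel q b))"
    unfolding sum_distrib_left[symmetric] using q by (simp add: half_kernel_def)
  also have "\<dots> = (\<Sum>b\<in>{0..<int q}. s * ep (of_int (m * r) / real q) * (dft q u (m + b) * (half_kernel q b * ep (of_int (b * r) / real q))))"
  proof (rule sum.cong[OF refl])
    fix b
    show "dft q u (m + b) / s * ep (of_int (m * r) / real q) * ep (of_int (b * r) / real q) * (of_nat q * half_kernel q b) =
      s * ep (of_int (m * r) / real q) * (dft q u (m + b) * (half_kernel q b * ep (of_int (b * r) / real q)))"
      unfolding s(2)[symmetric] using s(1) by (simp add: field_simps)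
  qed
  finally show ?thesis by (simp add: sum_distrib_left s_def)
qed

section \<open>The half-integer interpolation kernel\<close>

lemma sin_ge_linear:
  assumes "0 \<le> x" "x \<le> 1/2"
  shows "2 * x \<le> sin (pi * x)"
proof -
  have conv: "convex_on {0..pi} (\<lambda>x. - sin x)"
  proof (rule f''_ge0_imp_convex)
    show "convex {0..pi}" by (rule convex_real_interval)
    fix x :: real assume "x \<in> {0..pi}"
    show "((\<lambda>x. - sin x) has_real_derivative - cos x) (at x)" by (auto intro!: derivative_eq_intros)
    show "((\<lambda>x. - cos x) has_real_derivative sin x) (at x)" by (auto intro!: derivative_eq_intros)
    show "0 \<le> sin x" using \<open>x \<in> {0..pi}\<close> by (intro sin_ge_zero) auto
  qed
  have "- sin ((1 - 2 * x) *\<^sub>R 0 + (2 * x) *\<^sub>R (pi / 2)) \<le> (1 - 2 * x) * (- sin 0) + (2 * x) * (- sin (pi / 2))"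
    by (rule convex_onD[OF conv]) (use assms in auto)
  thus ?thesis by (simp add: mult.commute)
qed

lemma inverse_sin_le:
  assumes "0 < x" "x < 1"
  shows "1 / sin (pi * x) \<le> 1 / (2 * x) + 1 / (2 * (1 - x))"
proof (cases "x \<le> 1/2")
  case True
  have "2 * x \<le> sin (pi * x)" using assms True by (intro sin_ge_linear) auto
  hence "1 / sin (pi * x) \<le> 1 / (2 * x)" using assms by (intro divide_left_mono) auto
  moreover have "0 \<le> 1 / (2 * (1 - x))" using assms by simp
  ultimately show ?thesis by linarith
next
  case False
  have "2 * (1 - x) \<le> sin (pi * (1 - x))" using assms False by (intro sin_ge_linear) auto
  also have "sin (pi * (1 - x)) = sin (pi * x)" by (simp add: right_diff_distrib sin_diff)
  finally have "1 / sin (pi * x) \<le> 1 / (2 * (1 - x))" using assms by (intro divide_left_mono) auto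
  moreover have "0 \<le> 1 / (2 * x)" using assms by simp
  ultimately show ?thesis by linarith
qed

lemma norm_1_minus_ep: "cmod (1 - ep x) = 2 * \<bar>sin (pi * x)\<bar>"
proof -
  have "(cmod (1 - ep x))\<^sup>2 = (1 - cos (2 * pi * x))\<^sup>2 + (sin (2 * pi * x))\<^sup>2"
    by (simp add: ep_def cmod_power2)
  also have "\<dots> = 2 - 2 * cos (2 * (pi * x))"
    using sin_cos_squared_add[of "2 * pi * x"] by (simp add: power2_eq_square algebra_simps)
  also have "\<dots> = (2 * \<bar>sin (pi * x)\<bar>)\<^sup>2" by (simp add: cos_double_sin power_mult_distrib)
  finally show ?thesis by (rule power2_eq_imp_eq) auto
qed

lemma ep_minus_half: "ep (- 1 / 2) = - 1"
  by (simp add: ep_def complex_eq_iff)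

lemma norm_half_kernel_le_1: "q > 0 \<Longrightarrow> cmod (half_kernel q b) \<le> 1"
proof -
  assume q: "q > 0"
  have "cmod (\<Sum>j\<in>{0..<int q}. ep (of_int (j * (2 * b - 1)) / real (2 * q))) \<le> (\<Sum>j\<in>{0..<int q}. 1)"
    by (rule sum_norm_le) simp
  thus ?thesis using q by (simp add: half_kernel_def norm_divide divide_le_eq)
qed

text \<open>At a half-integer \<open>w ^ q = - 1\<close>, so the geometric sum is
  \<open>2 / (1 - w)\<close> and the kernel has modulus \<open>1 / (q * sin (pi * x))\<close>, with
  \<open>x = (b - 1/2) / q\<close>.\<close>

lemma norm_half_kernel_le:
  assumes b: "0 < b" "b < int q"
  shows "cmod (half_kernel q b) \<le> 1 / of_int b + 1 / of_int (int q - b)"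
proof -
  have q: "q > 0" using b by simp
  define x where "x = of_int (2 * b - 1) / real (2 * q)"
  define w where "w = ep x"
  have x: "0 < x" "x < 1" using b q unfolding x_def by (auto simp: divide_less_eq)
  have "of_int (2 * b - 1) < real_of_int (2 * int q)" using b by (intro of_int_less_iff[THEN iffD2]) simp
  hence x1: "x < 1" unfolding x_def using q by (simp add: divide_less_eq)
  have sinp: "sin (pi * x) > 0" using x(1) x1 by (intro sin_gt_zero) auto
  have "cmod (1 - w) \<noteq> 0" unfolding w_def norm_1_minus_ep using sinp by simp
  hence w1: "w \<noteq> 1" by auto
  have wj: "ep (of_int (int j * (2 * b - 1)) / real (2 * q)) = w ^ j" for j
    unfolding w_def ep_power x_def by simp
  have "real q * x = - 1 / 2 + of_int b" using q by (simp add: x_def field_simps)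
  hence "w ^ q = ep (- 1 / 2)" unfolding w_def ep_power by (simp only: ep_add_int)
  also have "\<dots> = - 1" by (rule ep_minus_half)
  finally have wq: "w ^ q = - 1" .
  have "(\<Sum>j\<in>{0..<int q}. ep (of_int (j * (2 * b - 1)) / real (2 * q))) = (\<Sum>j<q. w ^ j)"
    unfolding sum_int_interval wj ..
  also have "\<dots> = 2 / (1 - w)" using w1 by (simp add: sum_gp_strict wq)
  finally have "cmod (half_kernel q b) = 2 / (real q * cmod (1 - w))"
    by (simp add: half_kernel_def norm_divide norm_mult mult.commute)
  also have "\<dots> = (1 / real q) * (1 / sin (pi * x))" unfolding w_def norm_1_minus_ep using sinp by simp
  also have "\<dots> \<le> (1 / real q) * (1 / (2 * x) + 1 / (2 * (1 - x)))"
    by (intro mult_left_mono inverse_sin_le x(1) x1) auto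
  also have "\<dots> = 1 / (2 * real q * x) + 1 / (2 * real q - 2 * real q * x)"
    using q x(1) x1 by (simp add: field_simps)
  also have "2 * real q * x = 2 * of_int b - 1" using q by (simp add: x_def)
  also have "1 / (2 * of_int b - 1) \<le> 1 / (of_int b :: real)" using b by (intro divide_left_mono) auto
  also have "1 / (2 * real q - (2 * of_int b - 1)) \<le> 1 / of_int (int q - b)" using b by (intro divide_left_mono) auto
  finally show ?thesis by simp
qed

lemma harm_le: "m > 0 \<Longrightarrow> harm m \<le> 1 + ln (real m)"
proof -
  assume "m > 0"
  then obtain k where k: "m = Suc k" by (cases m) auto
  have "harm (Suc k) - ln (real (Suc k)) \<le> harm (Suc 0) - ln (real (Suc 0))"
    using decseq_harm_diff_ln by (rule decseqD) simp
  thus ?thesis unfolding k by (simp add: harm_def)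
qed

text \<open>The index 0 contributes at most 1; the two reciprocals in
  \<open>norm_half_kernel_le\<close> each sum to a harmonic number.\<close>

lemma sum_norm_half_kernel:
  assumes q: "q > 1"
  shows "(\<Sum>b\<in>{0..<int q}. cmod (half_kernel q b)) \<le> 3 + 2 * ln (real q)"
proof -
  have "(\<Sum>b\<in>{0..<int q}. cmod (half_kernel q b)) = cmod (half_kernel q 0) + (\<Sum>b\<in>{1..<int q}. cmod (half_kernel q b))"
  proof -
    have "{0..<int q} = insert 0 {1..<int q}" using q by auto
    thus ?thesis by simp
  qed
  also have "\<dots> \<le> 1 + (\<Sum>b\<in>{1..<int q}. 1 / of_int b + 1 / of_int (int q - b))"
    using q by (intro add_mono sum_mono norm_half_kernel_le norm_half_kernel_le_1) auto
  also have "(\<Sum>b\<in>{1..<int q}. 1 / of_int b + 1 / of_int (int q - b)) = 2 * (\<Sum>b\<in>{1..<int q}. 1 / (of_int b :: real))"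
  proof -
    have "(\<Sum>b\<in>{1..<int q}. 1 / real_of_int (int q - b)) = (\<Sum>b\<in>{1..<int q}. 1 / of_int b)"
      by (rule sum.reindex_bij_witness[of _ "\<lambda>b. int q - b" "\<lambda>b. int q - b"]) auto
    thus ?thesis by (simp add: sum.distrib)
  qed
  also have "(\<Sum>b\<in>{1..<int q}. 1 / (of_int b :: real)) = harm (q - 1)"
    unfolding harm_def by (rule sum.reindex_bij_witness[of _ int nat]) (auto simp: divide_inverse)
  also have "harm (q - 1) \<le> 1 + ln (real (q - 1))" using q by (intro harm_le) auto
  also have "ln (real (q - 1)) \<le> ln (real q)" using q by simp
  finally show ?thesis by simp
qed

text \<open>Exhibits the kernel as the finite Fourier transform of a sequence of modulus
  \<open>1 / q\<close>, so that Parseval yields its moments.\<close>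

lemma half_kernel_eq:
  "half_kernel q b = (\<Sum>j\<in>{0..<int q}. ep (- of_int j / real (2 * q)) / of_nat q * ep (of_int (j * b) / real q))"
  unfolding half_kernel_def sum_divide_distrib
proof (rule sum.cong[OF refl])
  fix j
  show "ep (of_int (j * (2 * b - 1)) / real (2 * q)) / of_nat q = ep (- of_int j / real (2 * q)) / of_nat q * ep (of_int (j * b) / real q)"
  proof (cases "q = 0")
    case False
    have "ep (of_int (j * (2 * b - 1)) / real (2 * q)) = ep (- of_int j / real (2 * q)) * ep (of_int (j * b) / real q)"
      unfolding ep_add[symmetric] by (rule arg_cong[of _ _ ep]) (use False in \<open>simp add: field_simps\<close>)
    thus ?thesis by simp
  qed simp
qed

lemma sum_norm_half_kernel_sq:
  assumes q: "q > 0"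
  shows "(\<Sum>b\<in>{0..<int q}. (cmod (half_kernel q b))\<^sup>2) = 1"
proof -
  have "(\<Sum>b\<in>{0..<int q}. (cmod (half_kernel q b))\<^sup>2) = real q * (\<Sum>j\<in>{0..<int q}. (cmod (ep (- of_int j / real (2 * q)) / of_nat q))\<^sup>2)"
    unfolding half_kernel_eq by (rule finite_Parseval_norm[OF q _ inj_on_mod_interval]) simp
  thus ?thesis using q by (simp add: norm_divide power2_eq_square)
qed

text \<open>Squaring the kernel convolves its coefficient sequence with itself cyclically. For each
  \<open>i\<close> exactly one \<open>j\<close> contributes, with phase \<open>E t\<close>, or
  \<open>E (t + q) = - E t\<close> after wrapping around. There are \<open>t + 1\<close> positive
  and \<open>q - 1 - t\<close> negative terms.\<close>

lemma half_kernel_square_transform: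
  assumes q: "q > 0"
  shows "cmod (\<Sum>b\<in>{0..<int q}. (half_kernel q b)\<^sup>2 * ep (of_int (b * R) / real q)) =
    \<bar>2 * (of_int ((- R) mod int q) + 1) - real q\<bar> / real q"
proof -
  define t where "t = (- R) mod int q"
  have t: "0 \<le> t" "t < int q" using q by (auto simp: t_def)
  define E where "E x = ep (- of_int x / real (2 * q))" for x :: int
  have EE: "E i * E j = E (i + j)" for i j
    unfolding E_def ep_add[symmetric] by (rule arg_cong[of _ _ ep]) (simp add: diff_divide_distrib)
  have "(half_kernel q b)\<^sup>2 * ep (of_int (b * R) / real q) =
    (\<Sum>i\<in>{0..<int q}. \<Sum>j\<in>{0..<int q}. E (i + j) / (of_nat q)\<^sup>2 * ep (of_int (b * (i + j + R)) / real q))" for b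
    unfolding power2_eq_square half_kernel_eq sum_product unfolding sum_distrib_right
  proof (intro sum.cong refl)
    fix i j
    have "ep (of_int (i * b) / real q) * ep (of_int (j * b) / real q) * ep (of_int (b * R) / real q) = ep (of_int (b * (i + j + R)) / real q)"
      unfolding ep_add[symmetric] by (rule arg_cong[of _ _ ep]) (simp add: algebra_simps add_divide_distrib)
    thus "ep (- of_int i / real (2 * q)) / of_nat q * ep (of_int (i * b) / real q) *
       (ep (- of_int j / real (2 * q)) / of_nat q * ep (of_int (j * b) / real q)) * ep (of_int (b * R) / real q) =
       E (i + j) / (of_nat q * of_nat q) * ep (of_int (b * (i + j + R)) / real q)"
      unfolding E_def[symmetric] EE[symmetric] by (simp add: mult_ac)
  qed
  hence "(\<Sum>b\<in>{0..<int q}. (half_kernel q b)\<^sup>2 * ep (of_int (b * R) / real q)) =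
     (\<Sum>b\<in>{0..<int q}. \<Sum>i\<in>{0..<int q}. \<Sum>j\<in>{0..<int q}. E (i + j) / (of_nat q)\<^sup>2 * ep (of_int (b * (i + j + R)) / real q))"
    by (simp only:)
  also have "\<dots> = (\<Sum>i\<in>{0..<int q}. \<Sum>b\<in>{0..<int q}. \<Sum>j\<in>{0..<int q}. E (i + j) / (of_nat q)\<^sup>2 * ep (of_int (b * (i + j + R)) / real q))"
    by (rule sum.swap)
  also have "\<dots> = (\<Sum>i\<in>{0..<int q}. \<Sum>j\<in>{0..<int q}. \<Sum>b\<in>{0..<int q}. E (i + j) / (of_nat q)\<^sup>2 * ep (of_int (b * (i + j + R)) / real q))"
    by (intro sum.cong refl sum.swap)
  also have "\<dots> = (\<Sum>i\<in>{0..<int q}. \<Sum>j\<in>{0..<int q}. if j = (t - i) mod int q then E (i + j) / of_nat q else 0)"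
    unfolding sum_distrib_left[symmetric] sum_ep[OF q]
  proof (intro sum.cong refl)
    fix i j assume "j \<in> {0..<int q}"
    hence "j = (t - i) mod int q \<longleftrightarrow> j mod int q = (- R - i) mod int q" by (simp add: t_def mod_simps)
    also have "\<dots> \<longleftrightarrow> int q dvd j - (- R - i)" by (rule mod_eq_dvd_iff)
    also have "j - (- R - i) = i + j + R" by simp
    finally show "E (i + j) / (of_nat q)\<^sup>2 * (if int q dvd i + j + R then of_nat q else 0) =
      (if j = (t - i) mod int q then E (i + j) / of_nat q else 0)" using q by (simp add: power2_eq_square)
  qed
  also have "\<dots> = (\<Sum>i\<in>{0..<int q}. E (i + (t - i) mod int q) / of_nat q)"
    using q by simp
  also have "\<dots> = (\<Sum>i\<in>{0..<int q}. if i \<le> t then E t / of_nat q else - (E t / of_nat q))"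
  proof (rule sum.cong[OF refl])
    fix i assume i: "i \<in> {0..<int q}"
    show "E (i + (t - i) mod int q) / of_nat q = (if i \<le> t then E t / of_nat q else - (E t / of_nat q))"
    proof (cases "i \<le> t")
      case True
      thus ?thesis using i t by simp
    next
      case False
      have "(t - i) mod int q = (t - i + int q) mod int q" by simp
      also have "\<dots> = t - i + int q" using False i t by (intro mod_pos_pos_trivial) auto
      finally have "i + (t - i) mod int q = t + int q" by simp
      moreover have "E (t + int q) = E t * E (int q)" by (simp add: EE)
      moreover have "E (int q) = ep (- 1 / 2)" unfolding E_def using q by (intro arg_cong[of _ _ ep]) simp
      hence "E (int q) = - 1" by (simp only: ep_minus_half)
      ultimately show ?thesis using False by simp
    qed
  qed
  also have "\<dots> = (\<Sum>i\<in>{0..t}. E t / of_nat q) + (\<Sum>i\<in>{t<..<int q}. - (E t / of_nat q))"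
  proof -
    have eq: "{0..<int q} = {0..t} \<union> {t<..<int q}" using t by auto
    show ?thesis unfolding eq by (subst sum.union_disjoint) auto
  qed
  also have "\<dots> = E t / of_nat q * of_real (2 * (of_int t + 1) - real q)"
    using t by (simp add: algebra_simps of_nat_diff add_divide_distrib diff_divide_distrib)
  finally show ?thesis unfolding t_def[symmetric] by (simp add: norm_mult norm_divide E_def del: of_real_add of_real_diff of_real_mult)
qed

lemma sum_centred_squares:
  "(\<Sum>t\<in>{0..<int q}. (2 * (of_int t + 1) - real q)\<^sup>2) = real q ^ 3 / 3 + 2 * real q / 3"
proof -
  have "(\<Sum>t<m. (2 * (real t + 1) - x)\<^sup>2) = 4 * (real m * (real m + 1) * (2 * real m + 1)) / 6 - 2 * x * (real m * (real m + 1)) + real m * x\<^sup>2" for m and x :: real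
    by (induction m) (simp_all add: field_simps power2_eq_square)
  from this[of "real q" q] show ?thesis
    unfolding sum_int_interval by (simp add: field_simps power2_eq_square power3_eq_cube)
qed

text \<open>Parseval for the squared kernel, whose transform is known explicitly. The main term 1/3
  is the mean of (2x - 1)^2 on the unit interval.\<close>

lemma sum_norm_half_kernel_fourth:
  assumes q: "q > 0"
  shows "(\<Sum>b\<in>{0..<int q}. (cmod (half_kernel q b)) ^ 4) = 1 / 3 + 2 / (3 * (real q)\<^sup>2)"
proof -
  have "real q * (\<Sum>b\<in>{0..<int q}. (cmod ((half_kernel q b)\<^sup>2))\<^sup>2) =
     (\<Sum>R\<in>{0..<int q}. (cmod (\<Sum>b\<in>{0..<int q}. (half_kernel q b)\<^sup>2 * ep (of_int (b * R) / real q)))\<^sup>2)"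
    by (rule finite_Parseval_norm[OF q _ inj_on_mod_interval, symmetric]) simp
  also have "\<dots> = (\<Sum>R\<in>{0..<int q}. (2 * (of_int ((- R) mod int q) + 1) - real q)\<^sup>2 / (real q)\<^sup>2)"
    unfolding half_kernel_square_transform[OF q] by (simp add: power_divide)
  also have "\<dots> = (\<Sum>t\<in>{0..<int q}. (2 * (of_int t + 1) - real q)\<^sup>2 / (real q)\<^sup>2)"
    by (rule sum.reindex_bij_witness[of _ "\<lambda>t. (- t) mod int q" "\<lambda>R. (- R) mod int q"])
      (use q in \<open>auto simp: mod_simps\<close>)
  also have "\<dots> = (real q ^ 3 / 3 + 2 * real q / 3) / (real q)\<^sup>2"
    unfolding sum_divide_distrib[symmetric] sum_centred_squares ..
  finally have "real q * (\<Sum>b\<in>{0..<int q}. (cmod (half_kernel q b)) ^ 4) = (real q ^ 3 / 3 + 2 * real q / 3) / (real q)\<^sup>2"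
    by (simp add: norm_power power_mult[symmetric])
  hence "(\<Sum>b\<in>{0..<int q}. (cmod (half_kernel q b)) ^ 4) = (real q ^ 3 / 3 + 2 * real q / 3) / (real q)\<^sup>2 / real q"
    using q by (simp only: nonzero_eq_divide_eq) (simp add: mult.commute)
  also have "\<dots> = 1 / 3 + 2 / (3 * (real q)\<^sup>2)"
    using q by (simp add: field_simps power2_eq_square power3_eq_cube)
  finally show ?thesis .
qed

section \<open>Fourth moments\<close>

lemma sum_diagonal:
  fixes f :: "'a \<Rightarrow> 'b::comm_monoid_add"
  assumes "finite I"
  shows "(\<Sum>P\<in>I \<times> I. if fst P = snd P then f (fst P) else 0) = (\<Sum>b\<in>I. f b)"
  unfolding sum.cartesian_product'[of _ I I] using assms by simp

text \<open>Opening both squares gives a sum over four shifts, and \<open>H\<close> evaluates the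
  inner sum over \<open>m\<close>. \<open>A1\<close>, \<open>A2\<close>, \<open>A3\<close> belong to
  the pairings 12|34, 14|23, 13|24 and \<open>A4\<close> to four equal shifts. The error is uniform
  in the shifts, so it is multiplied by the l1 norms of the weights.\<close>

lemma quartic_expansion:
  fixes u u' Z Z' :: "int \<Rightarrow> complex" and A1 A2 A3 A4 :: complex and q :: nat
  defines "I \<equiv> {0..<int q}"
  assumes H: "\<And>b1 b2 b3 b4. {b1, b2, b3, b4} \<subseteq> I \<Longrightarrow>
     cmod ((\<Sum>m\<in>I. u (m + b1) * cnj (u (m + b2)) * u' (m + b3) * cnj (u' (m + b4)))
       - of_nat q * ((if b1 = b2 \<and> b3 = b4 then A1 else 0) + (if b1 = b4 \<and> b2 = b3 then A2 else 0)
         + (if b1 = b3 \<and> b2 = b4 then A3 else 0) + (if b1 = b2 \<and> b2 = b3 \<and> b3 = b4 then A4 else 0))) \<le> \<epsilon>"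
  shows "cmod (of_real (\<Sum>m\<in>I. (cmod (\<Sum>b\<in>I. u (m + b) * Z b))\<^sup>2 * (cmod (\<Sum>b\<in>I. u' (m + b) * Z' b))\<^sup>2)
     - of_nat q * (A1 * of_real (\<Sum>b\<in>I. (cmod (Z b))\<^sup>2) * of_real (\<Sum>b\<in>I. (cmod (Z' b))\<^sup>2)
        + A2 * of_real ((cmod (\<Sum>b\<in>I. Z b * cnj (Z' b)))\<^sup>2) + A3 * of_real ((cmod (\<Sum>b\<in>I. Z b * Z' b))\<^sup>2)
        + A4 * of_real (\<Sum>b\<in>I. (cmod (Z b))\<^sup>2 * (cmod (Z' b))\<^sup>2)))
    \<le> \<epsilon> * ((\<Sum>b\<in>I. cmod (Z b))\<^sup>2 * (\<Sum>b\<in>I. cmod (Z' b))\<^sup>2)"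
proof -
  have I: "finite I" by (simp add: I_def)
  define J where "J = I \<times> I"
  have J: "finite J" using I by (simp add: J_def)
  \<comment> \<open>The shifts are grouped by the square they come from: \<open>P = (b1, b2)\<close>
    and \<open>Q = (b3, b4)\<close>.\<close>
  define zeta where "zeta P = Z (fst P) * cnj (Z (snd P))" for P
  define zeta' where "zeta' P = Z' (fst P) * cnj (Z' (snd P))" for P
  define h where "h P Q m = u (m + fst P) * cnj (u (m + snd P)) * u' (m + fst Q) * cnj (u' (m + snd Q))" for P Q and m :: int
  define A where "A P Q = (if fst P = snd P \<and> fst Q = snd Q then A1 else 0) + (if Q = (snd P, fst P) then A2 else 0)
     + (if Q = P then A3 else 0) + (if Q = P \<and> fst P = snd P then A4 else 0)" for P Q :: "int \<times> int"
  have sq: "of_real ((cmod (\<Sum>b\<in>I. F b))\<^sup>2) = (\<Sum>P\<in>J. F (fst P) * cnj (F (snd P)))" for F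
    unfolding complex_norm_square cnj_sum sum_product J_def by (simp add: sum.cartesian_product case_prod_unfold)
  have "complex_of_real (\<Sum>m\<in>I. (cmod (\<Sum>b\<in>I. u (m + b) * Z b))\<^sup>2 * (cmod (\<Sum>b\<in>I. u' (m + b) * Z' b))\<^sup>2)
    = (\<Sum>m\<in>I. \<Sum>P\<in>J. \<Sum>Q\<in>J. zeta P * zeta' Q * h P Q m)"
    unfolding of_real_sum of_real_mult sq sum_product
    by (intro sum.cong refl) (simp add: zeta_def zeta'_def h_def mult_ac)
  also have "\<dots> = (\<Sum>P\<in>J. \<Sum>m\<in>I. \<Sum>Q\<in>J. zeta P * zeta' Q * h P Q m)" by (rule sum.swap)
  also have "\<dots> = (\<Sum>P\<in>J. \<Sum>Q\<in>J. \<Sum>m\<in>I. zeta P * zeta' Q * h P Q m)" by (intro sum.cong refl sum.swap)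
  also have "\<dots> = (\<Sum>P\<in>J. \<Sum>Q\<in>J. zeta P * zeta' Q * (\<Sum>m\<in>I. h P Q m))" by (simp only: sum_distrib_left)
  finally have lhs: "complex_of_real (\<Sum>m\<in>I. (cmod (\<Sum>b\<in>I. u (m + b) * Z b))\<^sup>2 * (cmod (\<Sum>b\<in>I. u' (m + b) * Z' b))\<^sup>2)
    = (\<Sum>P\<in>J. \<Sum>Q\<in>J. zeta P * zeta' Q * (\<Sum>m\<in>I. h P Q m))" .
  have sd: "(\<Sum>P\<in>J. if fst P = snd P then f (fst P) else 0) = (\<Sum>b\<in>I. f b)" for f :: "int \<Rightarrow> complex"
    unfolding J_def by (rule sum_diagonal[OF I])
  have t1: "(\<Sum>P\<in>J. \<Sum>Q\<in>J. zeta P * zeta' Q * (if fst P = snd P \<and> fst Q = snd Q then A1 else 0)) =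
     A1 * of_real (\<Sum>b\<in>I. (cmod (Z b))\<^sup>2) * of_real (\<Sum>b\<in>I. (cmod (Z' b))\<^sup>2)"
  proof -
    have "(\<Sum>P\<in>J. \<Sum>Q\<in>J. zeta P * zeta' Q * (if fst P = snd P \<and> fst Q = snd Q then A1 else 0)) =
      A1 * ((\<Sum>P\<in>J. if fst P = snd P then Z (fst P) * cnj (Z (fst P)) else 0) * (\<Sum>Q\<in>J. if fst Q = snd Q then Z' (fst Q) * cnj (Z' (fst Q)) else 0))"
      unfolding sum_product unfolding sum_distrib_left by (intro sum.cong refl) (auto simp: zeta_def zeta'_def)
    also have "\<dots> = A1 * ((\<Sum>b\<in>I. Z b * cnj (Z b)) * (\<Sum>b\<in>I. Z' b * cnj (Z' b)))"
      unfolding sd[of "\<lambda>b. Z b * cnj (Z b)"] sd[of "\<lambda>b. Z' b * cnj (Z' b)"] ..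
    finally show ?thesis by (simp only: of_real_sum complex_norm_square mult.assoc)
  qed
  have t2: "(\<Sum>P\<in>J. \<Sum>Q\<in>J. zeta P * zeta' Q * (if Q = (snd P, fst P) then A2 else 0)) = A2 * of_real ((cmod (\<Sum>b\<in>I. Z b * cnj (Z' b)))\<^sup>2)"
  proof -
    have "(\<Sum>P\<in>J. \<Sum>Q\<in>J. zeta P * zeta' Q * (if Q = (snd P, fst P) then A2 else 0)) =
      (\<Sum>P\<in>J. \<Sum>Q\<in>J. if Q = (snd P, fst P) then zeta P * zeta' Q * A2 else 0)" by (intro sum.cong refl) auto
    also have "\<dots> = (\<Sum>P\<in>J. zeta P * zeta' (snd P, fst P) * A2)"
      by (intro sum.cong refl) (use J in \<open>auto simp: J_def\<close>)
    finally show ?thesis unfolding sq sum_distrib_left by (simp add: zeta_def zeta'_def mult_ac)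
  qed
  have t3: "(\<Sum>P\<in>J. \<Sum>Q\<in>J. zeta P * zeta' Q * (if Q = P then A3 else 0)) = A3 * of_real ((cmod (\<Sum>b\<in>I. Z b * Z' b))\<^sup>2)"
  proof -
    have "(\<Sum>P\<in>J. \<Sum>Q\<in>J. zeta P * zeta' Q * (if Q = P then A3 else 0)) =
      (\<Sum>P\<in>J. \<Sum>Q\<in>J. if Q = P then zeta P * zeta' Q * A3 else 0)" by (intro sum.cong refl) auto
    also have "\<dots> = (\<Sum>P\<in>J. zeta P * zeta' P * A3)"
      by (intro sum.cong refl) (use J in auto)
    finally show ?thesis unfolding sq sum_distrib_left by (simp add: zeta_def zeta'_def mult_ac)
  qed
  have t4: "(\<Sum>P\<in>J. \<Sum>Q\<in>J. zeta P * zeta' Q * (if Q = P \<and> fst P = snd P then A4 else 0)) = A4 * of_real (\<Sum>b\<in>I. (cmod (Z b))\<^sup>2 * (cmod (Z' b))\<^sup>2)"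
  proof -
    have "(\<Sum>P\<in>J. \<Sum>Q\<in>J. zeta P * zeta' Q * (if Q = P \<and> fst P = snd P then A4 else 0)) =
      (\<Sum>P\<in>J. \<Sum>Q\<in>J. if Q = P then (if fst P = snd P then zeta P * zeta' Q * A4 else 0) else 0)" by (intro sum.cong refl) auto
    also have "\<dots> = (\<Sum>P\<in>J. if fst P = snd P then zeta P * zeta' P * A4 else 0)"
      by (intro sum.cong refl) (use J in auto)
    also have "\<dots> = (\<Sum>P\<in>J. if fst P = snd P then A4 * (of_real ((cmod (Z (fst P)))\<^sup>2) * of_real ((cmod (Z' (fst P)))\<^sup>2)) else 0)"
      unfolding complex_norm_square by (intro sum.cong refl) (auto simp: zeta_def zeta'_def mult_ac)
    also have "\<dots> = (\<Sum>b\<in>I. A4 * (of_real ((cmod (Z b))\<^sup>2) * of_real ((cmod (Z' b))\<^sup>2)))"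
      by (rule sd)
    finally show ?thesis by (simp only: of_real_sum of_real_mult sum_distrib_left)
  qed
  have main: "(\<Sum>P\<in>J. \<Sum>Q\<in>J. zeta P * zeta' Q * A P Q) =
      A1 * of_real (\<Sum>b\<in>I. (cmod (Z b))\<^sup>2) * of_real (\<Sum>b\<in>I. (cmod (Z' b))\<^sup>2)
        + A2 * of_real ((cmod (\<Sum>b\<in>I. Z b * cnj (Z' b)))\<^sup>2) + A3 * of_real ((cmod (\<Sum>b\<in>I. Z b * Z' b))\<^sup>2)
        + A4 * of_real (\<Sum>b\<in>I. (cmod (Z b))\<^sup>2 * (cmod (Z' b))\<^sup>2)"
    unfolding A_def distrib_left sum.distrib t1 t2 t3 t4 ..
  have diff: "(\<Sum>P\<in>J. \<Sum>Q\<in>J. zeta P * zeta' Q * (\<Sum>m\<in>I. h P Q m)) - of_nat q * (\<Sum>P\<in>J. \<Sum>Q\<in>J. zeta P * zeta' Q * A P Q)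
     = (\<Sum>P\<in>J. \<Sum>Q\<in>J. zeta P * zeta' Q * ((\<Sum>m\<in>I. h P Q m) - of_nat q * A P Q))"
    unfolding sum_distrib_left[of "of_nat q"] sum_subtractf[symmetric] by (intro sum.cong refl) (simp add: algebra_simps)
  have "cmod (\<Sum>P\<in>J. \<Sum>Q\<in>J. zeta P * zeta' Q * ((\<Sum>m\<in>I. h P Q m) - of_nat q * A P Q)) \<le>
     (\<Sum>P\<in>J. \<Sum>Q\<in>J. cmod (zeta P) * cmod (zeta' Q) * \<epsilon>)"
  proof (intro sum_norm_le)
    fix P Q assume PQ: "P \<in> J" "Q \<in> J"
    obtain b1 b2 b3 b4 where b: "P = (b1, b2)" "Q = (b3, b4)" by (cases P, cases Q)
    have "{b1, b2, b3, b4} \<subseteq> I" using PQ b by (auto simp: J_def)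
    have "A P Q = (if b1 = b2 \<and> b3 = b4 then A1 else 0) + (if b1 = b4 \<and> b2 = b3 then A2 else 0)
         + (if b1 = b3 \<and> b2 = b4 then A3 else 0) + (if b1 = b2 \<and> b2 = b3 \<and> b3 = b4 then A4 else 0)"
      unfolding A_def by (intro arg_cong2[of _ _ _ _ plus] if_cong refl) (auto simp: b)
    hence "cmod ((\<Sum>m\<in>I. h P Q m) - of_nat q * A P Q) \<le> \<epsilon>"
      using H[OF \<open>{b1, b2, b3, b4} \<subseteq> I\<close>] by (simp only: h_def b fst_conv snd_conv)
    thus "cmod (zeta P * zeta' Q * ((\<Sum>m\<in>I. h P Q m) - of_nat q * A P Q)) \<le> cmod (zeta P) * cmod (zeta' Q) * \<epsilon>"
      unfolding norm_mult by (intro mult_left_mono mult_nonneg_nonneg) auto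
  qed
  also have "\<dots> = \<epsilon> * ((\<Sum>P\<in>J. cmod (zeta P)) * (\<Sum>Q\<in>J. cmod (zeta' Q)))"
    unfolding sum_product unfolding sum_distrib_left by (intro sum.cong refl) simp
  also have "(\<Sum>P\<in>J. cmod (zeta P)) = (\<Sum>b\<in>I. cmod (Z b))\<^sup>2"
    unfolding power2_eq_square sum_product J_def by (simp add: sum.cartesian_product case_prod_unfold zeta_def norm_mult)
  also have "(\<Sum>P\<in>J. cmod (zeta' P)) = (\<Sum>b\<in>I. cmod (Z' b))\<^sup>2"
    unfolding power2_eq_square sum_product J_def by (simp add: sum.cartesian_product case_prod_unfold zeta'_def norm_mult)
  finally show ?thesis unfolding lhs main[symmetric] diff .
qed

text \<open>A square matrix with orthogonal rows has orthogonal columns. The squared norm of row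
  \<open>k\<close> of the defect \<open>e\<close> is \<open>n * (n - s k)\<close>, whence
  \<open>s k \<le> n\<close>; but the \<open>s k\<close> add up to n^2, so every defect is
  0.\<close>

lemma dual_orthogonality:
  fixes x :: "'i \<Rightarrow> nat \<Rightarrow> complex"
  assumes J: "finite J" "card J = n"
    and orth: "\<And>i j. i \<in> J \<Longrightarrow> j \<in> J \<Longrightarrow> (\<Sum>k<n. x i k * cnj (x j k)) = (if i = j then of_nat n else 0)"
    and kl: "k < n" "l < n"
  shows "(\<Sum>i\<in>J. x i k * cnj (x i l)) = (if k = l then of_nat n else 0)"
proof -
  define s where "s k = (\<Sum>i\<in>J. (cmod (x i k))\<^sup>2)" for k
  define y where "y k l = (\<Sum>i\<in>J. cnj (x i k) * x i l)" for k l
  define e where "e k l = (if k = l then of_nat n else 0) - y k l" for k l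
  have ykk: "y k k = of_real (s k)" for k
    unfolding y_def s_def of_real_sum complex_norm_square by (simp add: mult.commute)
  have yy: "(\<Sum>l<n. y k l * cnj (y k l)) = of_nat n * of_real (s k)" for k
  proof -
    have "(\<Sum>l<n. y k l * cnj (y k l)) = (\<Sum>l<n. \<Sum>i\<in>J. \<Sum>j\<in>J. cnj (x i k) * x j k * (x i l * cnj (x j l)))"
      unfolding y_def cnj_sum sum_product by (intro sum.cong refl) (simp add: mult_ac)
    also have "\<dots> = (\<Sum>i\<in>J. \<Sum>l<n. \<Sum>j\<in>J. cnj (x i k) * x j k * (x i l * cnj (x j l)))" by (rule sum.swap)
    also have "\<dots> = (\<Sum>i\<in>J. \<Sum>j\<in>J. \<Sum>l<n. cnj (x i k) * x j k * (x i l * cnj (x j l)))" by (intro sum.cong refl sum.swap)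
    also have "\<dots> = (\<Sum>i\<in>J. \<Sum>j\<in>J. if i = j then cnj (x i k) * x i k * of_nat n else 0)"
      unfolding sum_distrib_left[symmetric] by (intro sum.cong refl) (simp add: orth)
    also have "\<dots> = of_nat n * y k k" using J(1) by (simp add: y_def sum_distrib_left mult_ac)
    finally show ?thesis by (simp add: ykk)
  qed
  have ee: "(\<Sum>l<n. (cmod (e k l))\<^sup>2) = real n * (real n - s k)" if k: "k < n" for k
  proof -
    have "complex_of_real (\<Sum>l<n. (cmod (e k l))\<^sup>2) = (\<Sum>l<n. e k l * cnj (e k l))"
      by (simp only: of_real_sum complex_norm_square)
    also have "\<dots> = (\<Sum>l<n. (if k = l then of_nat n * of_nat n - of_nat n * y k l - of_nat n * cnj (y k l) else 0) + y k l * cnj (y k l))"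
      by (intro sum.cong refl) (auto simp: e_def algebra_simps)
    also have "\<dots> = (of_nat n * of_nat n - of_nat n * y k k - of_nat n * cnj (y k k)) + of_nat n * of_real (s k)"
      using k by (simp add: sum.distrib yy)
    also have "\<dots> = complex_of_real (real n * (real n - s k))" by (simp add: ykk algebra_simps)
    finally show ?thesis by (simp only: of_real_eq_iff)
  qed
  have s_le: "s k \<le> real n" if "k < n" for k
  proof -
    have "0 \<le> real n * (real n - s k)" unfolding ee[OF that, symmetric] by (intro sum_nonneg) auto
    thus ?thesis using that by (simp add: zero_le_mult_iff)
  qed
  have "complex_of_real (\<Sum>k<n. s k) = (\<Sum>i\<in>J. \<Sum>k<n. x i k * cnj (x i k))"
    unfolding s_def of_real_sum complex_norm_square by (rule sum.swap)
  also have "\<dots> = complex_of_real (real n * real n)" using J by (simp add: orth)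
  finally have "(\<Sum>k<n. s k) = real n * real n" by (simp only: of_real_eq_iff)
  hence "(\<Sum>k<n. real n - s k) = 0" by (simp add: sum_subtractf)
  hence "real n - s k = 0" using s_le kl(1) by (subst (asm) sum_nonneg_eq_0_iff) auto
  hence "(\<Sum>l<n. (cmod (e k l))\<^sup>2) = 0" using ee[OF kl(1)] by simp
  hence "e k l = 0" using kl(2) by (subst (asm) sum_nonneg_eq_0_iff) auto
  hence "y k l = (if k = l then of_nat n else 0)" by (simp add: e_def)
  hence "cnj (y k l) = (if k = l then of_nat n else 0)" by simp
  thus ?thesis by (simp add: y_def)
qed

lemma dft_Parseval:
  assumes q: "q > 0"
  shows "(\<Sum>t\<in>{0..<int q}. dft q u t * cnj (dft q v t)) = (\<Sum>h\<in>{0..<int q}. u h * cnj (v h))"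
proof -
  define s where "s = complex_of_real (sqrt q)"
  have s: "s \<noteq> 0" "s * s = of_nat q" "cnj s = s" using q unfolding s_def of_real_mult[symmetric] by simp_all
  have d: "dft q w t = cnj (\<Sum>h\<in>{0..<int q}. cnj (w h) / s * ep (of_int (h * t) / real q))" for w t
    by (simp add: dft_def cnj_ep s(3) s_def[symmetric] sum_divide_distrib)
  have "(\<Sum>t\<in>{0..<int q}. dft q u t * cnj (dft q v t)) =
    cnj (\<Sum>t\<in>{0..<int q}. (\<Sum>h\<in>{0..<int q}. cnj (u h) / s * ep (of_int (h * t) / real q)) *
       cnj (\<Sum>h\<in>{0..<int q}. cnj (v h) / s * ep (of_int (h * t) / real q)))"
    unfolding d by simp
  also have "\<dots> = cnj (of_nat q * (\<Sum>h\<in>{0..<int q}. cnj (u h) / s * cnj (cnj (v h) / s)))"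
    by (subst finite_Parseval[OF q _ inj_on_mod_interval]) simp_all
  also have "\<dots> = (\<Sum>h\<in>{0..<int q}. u h * cnj (v h))"
    unfolding s(2)[symmetric] using s(1,3) by (simp add: sum_distrib_left)
  finally show ?thesis .
qed

lemma sum_even_odd:
  fixes \<phi> :: "int \<Rightarrow> 'a::comm_monoid_add"
  shows "(\<Sum>k\<in>{0..<int (2 * q)}. \<phi> k) = (\<Sum>m\<in>{0..<int q}. \<phi> (2 * m)) + (\<Sum>m\<in>{0..<int q}. \<phi> (2 * m + 1))"
proof -
  have "(\<Sum>k<2 * q. \<phi> (int k)) = (\<Sum>m<q. \<phi> (2 * int m)) + (\<Sum>m<q. \<phi> (2 * int m + 1))"
    by (induction q) (simp_all add: add_ac)
  thus ?thesis unfolding sum_int_interval .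
qed

lemma prime_multiple_sum:
  fixes \<phi> :: "int \<Rightarrow> 'a::comm_monoid_add"
  assumes q: "prime q" and y: "\<not> int q dvd y" and per: "\<And>x. \<phi> (x mod int q) = \<phi> x"
  shows "(\<Sum>x\<in>{0..<int q}. \<phi> (y * x)) = (\<Sum>x\<in>{0..<int q}. \<phi> x)"
proof -
  have q0: "q > 0" using q prime_gt_0_nat by blast
  have inj: "inj_on (\<lambda>x. (y * x) mod int q) {0..<int q}"
  proof (rule inj_onI)
    fix a b assume ab: "a \<in> {0..<int q}" "b \<in> {0..<int q}" "(y * a) mod int q = (y * b) mod int q"
    hence "int q dvd y * (a - b)" by (simp add: mod_eq_dvd_iff right_diff_distrib)
    hence "int q dvd a - b" using q y by (simp add: prime_dvd_mult_iff)
    hence "a mod int q = b mod int q" by (simp add: mod_eq_dvd_iff)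
    thus "a = b" using ab by simp
  qed
  have "(\<lambda>x. (y * x) mod int q) ` {0..<int q} = {0..<int q}"
    by (rule endo_inj_surj[OF _ _ inj]) (use q0 in auto)
  hence "bij_betw (\<lambda>x. (y * x) mod int q) {0..<int q} {0..<int q}" using inj by (simp add: bij_betw_def)
  from sum.reindex_bij_betw[OF this, of \<phi>] show ?thesis by (simp add: per)
qed

section \<open>Correlations of transformed patterns\<close>

lemma norm_four_product_diff:
  fixes x1 x2 x3 x4 y1 y2 y3 y4 :: complex
  assumes x: "cmod x1 \<le> Q" "cmod x2 \<le> Q" "cmod x3 \<le> Q" "cmod x4 \<le> Q"
    and y: "cmod y1 \<le> Q" "cmod y2 \<le> Q" "cmod y3 \<le> Q" "cmod y4 \<le> Q"
    and d: "cmod (x1 - y1) \<le> \<epsilon>" "cmod (x2 - y2) \<le> \<epsilon>" "cmod (x3 - y3) \<le> \<epsilon>" "cmod (x4 - y4) \<le> \<epsilon>"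
  shows "cmod (x1 * x2 * x3 * x4 - y1 * y2 * y3 * y4) \<le> 4 * \<epsilon> * Q ^ 3"
proof -
  have Q: "Q \<ge> 0" using x(1) norm_ge_zero order.trans by blast
  have eps: "\<epsilon> \<ge> 0" using d(1) norm_ge_zero order.trans by blast
  have "x1 * x2 * x3 * x4 - y1 * y2 * y3 * y4 =
    (x1 - y1) * (x2 * x3 * x4) + (x2 - y2) * (y1 * x3 * x4) + (x3 - y3) * (y1 * y2 * x4) + (x4 - y4) * (y1 * y2 * y3)"
    by (simp add: algebra_simps)
  also have "cmod \<dots> \<le> \<epsilon> * (Q * Q * Q) + \<epsilon> * (Q * Q * Q) + \<epsilon> * (Q * Q * Q) + \<epsilon> * (Q * Q * Q)"
  proof -
    have t: "cmod (r * (s * t * v)) \<le> \<epsilon> * (Q * Q * Q)"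
      if "cmod r \<le> \<epsilon>" "cmod s \<le> Q" "cmod t \<le> Q" "cmod v \<le> Q" for r s t v :: complex
      unfolding norm_mult using that by (intro mult_mono Q eps mult_nonneg_nonneg norm_ge_zero)
    show ?thesis
      by (intro order.trans[OF norm_triangle_ineq] add_mono t x y d)
  qed
  also have "\<dots> = 4 * \<epsilon> * Q ^ 3" by (simp add: power3_eq_cube)
  finally show ?thesis .
qed

context cyclotomy
begin

lemma p_pos: "p > 0" using p_gt1 by simp

lemma avg_scale: "avg (\<lambda>k. f k / c) = avg f / c"
  by (simp add: avg_def sum_divide_distrib[symmetric] divide_divide_eq_left mult.commute)

text \<open>Sum and main terms are homogeneous of degree four, so dividing the four functions by
  \<open>Q\<close> reduces to bound 1.\<close>

lemma four_fold_correlation: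
  fixes w1 w2 w3 w4 :: "nat \<Rightarrow> complex" and b1 b2 b3 b4 :: int
  assumes Q: "Q > 0" and w: "\<And>k. k < n \<Longrightarrow> cmod (w1 k) \<le> Q" "\<And>k. k < n \<Longrightarrow> cmod (w2 k) \<le> Q"
      "\<And>k. k < n \<Longrightarrow> cmod (w3 k) \<le> Q" "\<And>k. k < n \<Longrightarrow> cmod (w4 k) \<le> Q"
    and b: "{b1, b2, b3, b4} \<subseteq> {0..<int p}"
    and bal: "avg w1 = 0" "avg w2 = 0" "avg w3 = 0" "avg w4 = 0"
  defines "A12 \<equiv> avg (\<lambda>k. w1 k * w2 k)" and "A34 \<equiv> avg (\<lambda>k. w3 k * w4 k)"
    and "A13 \<equiv> avg (\<lambda>k. w1 k * w3 k)" and "A24 \<equiv> avg (\<lambda>k. w2 k * w4 k)"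
    and "A14 \<equiv> avg (\<lambda>k. w1 k * w4 k)" and "A23 \<equiv> avg (\<lambda>k. w2 k * w3 k)"
    and "A4 \<equiv> avg (\<lambda>k. w1 k * w2 k * w3 k * w4 k)"
  shows "cmod ((\<Sum>x\<in>unit_shifts {b1, b2, b3, b4}. w1 (cls (x + b1)) * w2 (cls (x + b2)) * w3 (cls (x + b3)) * w4 (cls (x + b4)))
     - of_nat p * ((if b1 = b2 \<and> b3 = b4 then A12 * A34 else 0) + (if b1 = b4 \<and> b2 = b3 then A14 * A23 else 0)
         + (if b1 = b3 \<and> b2 = b4 then A13 * A24 else 0)
         + (if b1 = b2 \<and> b2 = b3 \<and> b3 = b4 then A4 - A12 * A34 - A14 * A23 - A13 * A24 else 0)))
     \<le> Q ^ 4 * equidist_const n * sqrt p" (is "cmod (?S - of_nat p * ?A) \<le> _")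
proof -
  define c where "c = complex_of_real Q"
  have c: "c \<noteq> 0" "cmod c = Q" using Q by (simp_all add: c_def)
  have d1: "cmod (w k / c) \<le> 1" if "cmod (w k) \<le> Q" for w :: "nat \<Rightarrow> complex" and k
    using that Q by (simp add: norm_divide c(2))
  have p2: "f / c * (g / c) = f * g / c\<^sup>2" for f g by (simp add: power2_eq_square)
  have p4: "f / c * (g / c) * (h / c) * (k / c) = f * g * h * k / c ^ 4" for f g h k
    by (simp add: power4_eq_xxxx mult_ac)
  have q4: "x / c\<^sup>2 * (y / c\<^sup>2) = x * y / c ^ 4" for x y by (simp flip: power_add)
  have ifd: "(if P then x / c ^ 4 else 0) = (if P then x else 0) / c ^ 4" for P x by simp
  define v1 v2 v3 v4 where v: "v1 = (\<lambda>k. w1 k / c)" "v2 = (\<lambda>k. w2 k / c)" "v3 = (\<lambda>k. w3 k / c)" "v4 = (\<lambda>k. w4 k / c)"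
  have v1: "cmod (v1 k) \<le> 1" "cmod (v2 k) \<le> 1" "cmod (v3 k) \<le> 1" "cmod (v4 k) \<le> 1" if "k < n" for k
    unfolding v by (rule d1[of w1 k, OF w(1)[OF that]], rule d1[of w2 k, OF w(2)[OF that]],
        rule d1[of w3 k, OF w(3)[OF that]], rule d1[of w4 k, OF w(4)[OF that]])
  have vb: "avg v1 = 0" "avg v2 = 0" "avg v3 = 0" "avg v4 = 0" unfolding v avg_scale bal by simp_all
  have a: "avg (\<lambda>k. v1 k * v2 k) = A12 / c\<^sup>2" "avg (\<lambda>k. v3 k * v4 k) = A34 / c\<^sup>2"
    "avg (\<lambda>k. v1 k * v3 k) = A13 / c\<^sup>2" "avg (\<lambda>k. v2 k * v4 k) = A24 / c\<^sup>2"
    "avg (\<lambda>k. v1 k * v4 k) = A14 / c\<^sup>2" "avg (\<lambda>k. v2 k * v3 k) = A23 / c\<^sup>2"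
    unfolding v p2 avg_scale A12_def A34_def A13_def A24_def A14_def A23_def by (rule refl)+
  have a4: "avg (\<lambda>k. v1 k * v2 k * v3 k * v4 k) = A4 / c ^ 4"
    unfolding v p4 avg_scale A4_def by (rule refl)
  have S: "(\<Sum>x\<in>unit_shifts {b1, b2, b3, b4}. v1 (cls (x + b1)) * v2 (cls (x + b2)) * v3 (cls (x + b3)) * v4 (cls (x + b4))) = ?S / c ^ 4"
    unfolding v p4 sum_divide_distrib[symmetric] ..
  have "cmod (?S / c ^ 4 - of_nat p * (?A / c ^ 4)) \<le> equidist_const n * sqrt p"
    using four_fold_correlation_scaled[of v1 v2 v3 v4 b1 b2 b3 b4, OF v1 b vb]
    unfolding a a4 S q4 diff_divide_distrib[symmetric] ifd add_divide_distrib[symmetric] .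
  moreover have "x / c ^ 4 - y * (z / c ^ 4) = (x - y * z) / c ^ 4" for x y z
    by (simp add: diff_divide_distrib)
  ultimately have "cmod (?S - of_nat p * ?A) / Q ^ 4 \<le> equidist_const n * sqrt p"
    by (simp only: norm_divide norm_power c(2))
  moreover have "t \<le> Q ^ 4 * x * y" if "t / Q ^ 4 \<le> x * y" for t x y
    using that Q by (simp add: divide_le_eq mult_ac)
  ultimately show ?thesis by blast
qed

text \<open>Beside the equidistribution error, the 8 is 4 for the excluded residues plus 4 for
  replacing four perturbed factors one at a time.\<close>

definition corr_const :: real where
  "corr_const = (sqrt n + 1) ^ 4 * (equidist_const n + 8)"

text \<open>Made for transforms of sequences, which follow a class function only up to
  \<open>1 / sqrt p\<close> and not at all at multiples of \<open>p\<close>. The perturbation costs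
  \<open>p * (1 / sqrt p)\<close>, the at most four excluded residues cost O(1); both fit into the
  error.\<close>

lemma perturbed_correlation:
  fixes u1 u2 u3 u4 :: "int \<Rightarrow> complex" and w1 w2 w3 w4 :: "nat \<Rightarrow> complex" and b1 b2 b3 b4 :: int
  defines "Q \<equiv> sqrt n + 1"
  assumes u: "\<And>x. cmod (u1 x) \<le> Q" "\<And>x. cmod (u2 x) \<le> Q" "\<And>x. cmod (u3 x) \<le> Q" "\<And>x. cmod (u4 x) \<le> Q"
    and w: "\<And>k. k < n \<Longrightarrow> cmod (w1 k) \<le> Q" "\<And>k. k < n \<Longrightarrow> cmod (w2 k) \<le> Q"
      "\<And>k. k < n \<Longrightarrow> cmod (w3 k) \<le> Q" "\<And>k. k < n \<Longrightarrow> cmod (w4 k) \<le> Q"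
    and uw: "\<And>x. \<not> int p dvd x \<Longrightarrow> cmod (u1 x - w1 (cls x)) \<le> 1 / sqrt p"
      "\<And>x. \<not> int p dvd x \<Longrightarrow> cmod (u2 x - w2 (cls x)) \<le> 1 / sqrt p"
      "\<And>x. \<not> int p dvd x \<Longrightarrow> cmod (u3 x - w3 (cls x)) \<le> 1 / sqrt p"
      "\<And>x. \<not> int p dvd x \<Longrightarrow> cmod (u4 x - w4 (cls x)) \<le> 1 / sqrt p"
    and b: "{b1, b2, b3, b4} \<subseteq> {0..<int p}"
    and bal: "avg w1 = 0" "avg w2 = 0" "avg w3 = 0" "avg w4 = 0"
  defines "A12 \<equiv> avg (\<lambda>k. w1 k * w2 k)" and "A34 \<equiv> avg (\<lambda>k. w3 k * w4 k)"
    and "A13 \<equiv> avg (\<lambda>k. w1 k * w3 k)" and "A24 \<equiv> avg (\<lambda>k. w2 k * w4 k)"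
    and "A14 \<equiv> avg (\<lambda>k. w1 k * w4 k)" and "A23 \<equiv> avg (\<lambda>k. w2 k * w3 k)"
    and "A4 \<equiv> avg (\<lambda>k. w1 k * w2 k * w3 k * w4 k)"
  shows "cmod ((\<Sum>x\<in>{0..<int p}. u1 (x + b1) * u2 (x + b2) * u3 (x + b3) * u4 (x + b4))
     - of_nat p * ((if b1 = b2 \<and> b3 = b4 then A12 * A34 else 0) + (if b1 = b4 \<and> b2 = b3 then A14 * A23 else 0)
         + (if b1 = b3 \<and> b2 = b4 then A13 * A24 else 0)
         + (if b1 = b2 \<and> b2 = b3 \<and> b3 = b4 then A4 - A12 * A34 - A14 * A23 - A13 * A24 else 0)))
     \<le> corr_const * sqrt p" (is "cmod (?U - ?A) \<le> _")
proof -
  define B where "B = {b1, b2, b3, b4}"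
  define X where "X = unit_shifts B"
  define f where "f x = u1 (x + b1) * u2 (x + b2) * u3 (x + b3) * u4 (x + b4)" for x
  define g where "g x = w1 (cls (x + b1)) * w2 (cls (x + b2)) * w3 (cls (x + b3)) * w4 (cls (x + b4))" for x
  have Q1: "Q \<ge> 1" by (simp add: Q_def)
  have XI: "X \<subseteq> {0..<int p}" by (auto simp: X_def unit_shifts_def)
  have fX: "finite X" by (simp add: X_def)
  have cardB: "finite B" "card B \<le> 4" using card_length[of "[b1, b2, b3, b4]"] by (simp_all add: B_def)
  have sp: "sqrt p \<ge> 1" using p_gt1 by simp
  have f_le: "cmod (f x) \<le> Q ^ 4" for x
  proof -
    have "cmod (f x) \<le> Q * Q * Q * Q" unfolding f_def norm_mult
      using Q1 by (intro mult_mono u mult_nonneg_nonneg norm_ge_zero) auto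
    thus ?thesis by (simp add: power4_eq_xxxx)
  qed
  have "cmod (\<Sum>x\<in>{0..<int p} - X. f x) \<le> (\<Sum>x\<in>{0..<int p} - X. Q ^ 4)" by (rule sum_norm_le) (rule f_le)
  also have "\<dots> = real (card ({0..<int p} - X)) * Q ^ 4" by simp
  also have "\<dots> \<le> 4 * Q ^ 4"
  proof (rule mult_right_mono)
    have "card ({0..<int p} - X) = p - card X" using XI fX by (subst card_Diff_subset) auto
    thus "real (card ({0..<int p} - X)) \<le> 4"
      using card_unit_shifts[OF cardB] unfolding X_def by linarith
  qed (use Q1 in simp)
  also have "\<dots> \<le> 4 * Q ^ 4 * sqrt p" using sp Q1 by simp
  finally have 1: "cmod (\<Sum>x\<in>{0..<int p} - X. f x) \<le> 4 * Q ^ 4 * sqrt p" .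
  have "cmod (\<Sum>x\<in>X. f x - g x) \<le> (\<Sum>x\<in>X. 4 * (1 / sqrt p) * Q ^ 3)"
  proof (rule sum_norm_le)
    fix x assume "x \<in> X"
    hence nd: "\<not> int p dvd x + b1" "\<not> int p dvd x + b2" "\<not> int p dvd x + b3" "\<not> int p dvd x + b4"
      by (auto simp: X_def unit_shifts_def B_def)
    show "cmod (f x - g x) \<le> 4 * (1 / sqrt p) * Q ^ 3"
      unfolding f_def g_def
      by (rule norm_four_product_diff[OF u(1) u(2) u(3) u(4) w(1)[OF cls_less] w(2)[OF cls_less] w(3)[OF cls_less] w(4)[OF cls_less] uw(1) uw(2) uw(3) uw(4)]) (rule nd)+
  qed
  also have "\<dots> = real (card X) * (4 * (1 / sqrt p) * Q ^ 3)" by simp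
  also have "\<dots> \<le> real p * (4 * (1 / sqrt p) * Q ^ 3)"
    using card_unit_shifts[OF cardB] Q1 unfolding X_def by (intro mult_right_mono) auto
  also have "\<dots> = 4 * Q ^ 3 * (real p / sqrt p)" by simp
  also have "real p / sqrt p = sqrt p" using p_pos by (simp add: real_div_sqrt)
  also have "4 * Q ^ 3 * sqrt p \<le> 4 * Q ^ 4 * sqrt p"
    using Q1 by (intro mult_right_mono mult_left_mono power_increasing) auto
  finally have 2: "cmod (\<Sum>x\<in>X. f x - g x) \<le> 4 * Q ^ 4 * sqrt p" .
  have 3: "cmod ((\<Sum>x\<in>X. g x) - ?A) \<le> Q ^ 4 * equidist_const n * sqrt p"
    unfolding X_def B_def g_def A12_def A34_def A13_def A24_def A14_def A23_def A4_def
    by (rule four_fold_correlation[OF _ w b bal]) (use Q1 in simp)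
  have "?U = (\<Sum>x\<in>X. f x) + (\<Sum>x\<in>{0..<int p} - X. f x)"
    unfolding f_def by (rule sum.subset_diff[OF XI, THEN trans]) (simp_all add: add.commute)
  hence "?U - ?A = (\<Sum>x\<in>{0..<int p} - X. f x) + (\<Sum>x\<in>X. f x - g x) + ((\<Sum>x\<in>X. g x) - ?A)"
    by (simp add: sum_subtractf algebra_simps)
  hence "cmod (?U - ?A) \<le> cmod (\<Sum>x\<in>{0..<int p} - X. f x) + cmod (\<Sum>x\<in>X. f x - g x) + cmod ((\<Sum>x\<in>X. g x) - ?A)"
    by (simp only:) (intro order.trans[OF norm_triangle_ineq] add_mono norm_triangle_ineq order.refl)
  also have "\<dots> \<le> 4 * Q ^ 4 * sqrt p + 4 * Q ^ 4 * sqrt p + Q ^ 4 * equidist_const n * sqrt p"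
    by (intro add_mono 1 2 3)
  also have "\<dots> = corr_const * sqrt p" by (simp add: corr_const_def Q_def algebra_simps)
  finally show ?thesis .
qed

section \<open>Transforms of cyclotomic patterns\<close>

definition pat :: "complex list \<Rightarrow> int \<Rightarrow> complex" where
  "pat d h = (if int p dvd h then 0 else d ! cls h)"

text \<open>The transform of \<open>pat d\<close> is again constant on cyclotomic classes, so its
  values at the representatives \<open>a ^ k\<close> determine it away from 0. These are the
  combinations of Gaussian periods belonging to \<open>d\<close>, divided by
  \<open>sqrt p\<close>.\<close>

definition dhat :: "complex list \<Rightarrow> nat \<Rightarrow> complex" where
  "dhat d k = dft p (pat d) (int a ^ k)"

lemma pat_mod: "pat d (h mod int p) = pat d h"
  by (simp add: pat_def dvd_mod_iff)

lemma sum_units: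
  fixes \<phi> :: "nat \<Rightarrow> complex"
  shows "(\<Sum>h\<in>{0..<int p}. if int p dvd h then 0 else \<phi> (cls h)) = of_nat N * (\<Sum>k<n. \<phi> k)"
proof -
  have "(\<Sum>h\<in>{0..<int p}. if int p dvd h then 0 else \<phi> (cls h)) = (\<Sum>h\<in>{x\<in>{0..<int p}. \<not> int p dvd x}. \<phi> (cls h))"
    by (rule sum.mono_neutral_cong_right) (auto simp del: atLeastLessThan_iff intro: finite_subset[OF _ finite_atLeastLessThan_int])
  thus ?thesis by (simp only: nonresidue_interval sum_cls)
qed

text \<open>The substitution of \<open>y ^ n * h\<close> for \<open>h\<close> leaves the pattern
  fixed, because classes are cosets of the n-th powers.\<close>

lemma dft_pat_mult_nth_power:
  assumes y: "\<not> int p dvd y"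
  shows "dft p (pat d) (s * y ^ n) = dft p (pat d) s"
proof -
  define \<phi> where "\<phi> x = pat d x * ep (- of_int (x * s) / real p)" for x
  have per: "\<phi> (x mod int p) = \<phi> x" for x
  proof -
    have "(- ((x mod int p) * s)) mod int p = (- (x * s)) mod int p" by (simp add: mod_simps flip: mult_minus_right)
    from ep_cong_mod[OF p_pos this] show ?thesis by (simp add: \<phi>_def pat_mod)
  qed
  have yn: "\<not> int p dvd y ^ n" using y p by (simp add: prime_dvd_power_iff n_pos)
  have "pat d (y ^ n * h) = pat d h" for h
    using cls_mult_nth_power[OF _ y, of h] yn p by (auto simp: pat_def prime_dvd_mult_iff mult.commute)
  hence "pat d h * ep (- of_int (h * (s * y ^ n)) / real p) = \<phi> (y ^ n * h)" for h
    by (simp add: \<phi>_def mult_ac)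
  thus ?thesis using prime_multiple_sum[where \<phi> = \<phi>, OF p yn per] unfolding dft_def by (simp add: \<phi>_def)
qed

lemma dft_pat_cls:
  assumes "\<not> int p dvd t"
  shows "dft p (pat d) t = dhat d (cls t)"
proof -
  obtain i where i: "[t = int a ^ i] (mod int p)" using discrete_log[OF assms] by blast
  have "dft p (pat d) t = dft p (pat d) (int a ^ i)"
    using dft_mod[OF p_pos, of "pat d" t] dft_mod[OF p_pos, of "pat d" "int a ^ i"] i by (simp add: Cong.cong_def)
  also have "int a ^ i = int a ^ (i mod n) * (int a ^ (i div n)) ^ n"
    by (simp flip: power_mult power_add)
  also have "dft p (pat d) \<dots> = dft p (pat d) (int a ^ (i mod n))"
    by (rule dft_pat_mult_nth_power[OF not_dvd_primroot_power])
  finally show ?thesis by (simp add: dhat_def cls_primroot_power[OF i])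
qed

lemma dft_pat_0:
  assumes "length d = n" "balanced d" "int p dvd t"
  shows "dft p (pat d) t = 0"
proof -
  have "ep (- of_int (h * t) / real p) = 1" for h
  proof -
    have "(- (h * t)) mod int p = 0 mod int p" using assms(3) by simp
    from ep_cong_mod[OF p_pos this] show ?thesis by simp
  qed
  hence "dft p (pat d) t = (\<Sum>h\<in>{0..<int p}. if int p dvd h then 0 else d ! cls h) / of_real (sqrt p)"
    by (simp add: dft_def pat_def)
  also have "\<dots> = of_nat N * (\<Sum>k<n. d ! k) / of_real (sqrt p)" by (simp only: sum_units)
  also have "(\<Sum>k<n. d ! k) = 0"
    using assms(1,2) by (simp add: balanced_def sum_list_sum_nth atLeast0LessThan)
  finally show ?thesis by simp
qed

lemma dft_pat:
  assumes "length d = n" "balanced d"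
  shows "dft p (pat d) t = (if int p dvd t then 0 else dhat d (cls t))"
  using dft_pat_cls dft_pat_0[OF assms] by simp

text \<open>Fourier inversion at 0: the transform sums to a multiple of \<open>pat d 0\<close>,
  which is 0 because the plain sequence vanishes there.\<close>

lemma avg_dhat:
  assumes "length d = n" "balanced d"
  shows "avg (dhat d) = 0"
proof -
  have "of_nat N * (\<Sum>k<n. dhat d k) = (\<Sum>t\<in>{0..<int p}. dft p (pat d) t)"
    unfolding dft_pat[OF assms] by (simp only: sum_units)
  also have "\<dots> = of_real (sqrt p) * pat d 0"
    using dft_inversion[OF p_pos, of "pat d" 0] by simp
  also have "\<dots> = 0" by (simp add: pat_def)
  finally show ?thesis using N_pos by (simp add: avg_def)
qed

text \<open>Parseval, divided on both sides by the common class size \<open>N\<close>: passing from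
  \<open>d\<close> to \<open>dhat d\<close> is unitary.\<close>

lemma dhat_inner:
  assumes "length d = n" "balanced d" "length e = n" "balanced e"
  shows "(\<Sum>k<n. dhat d k * cnj (dhat e k)) = (\<Sum>k<n. d ! k * cnj (e ! k))"
proof -
  have "of_nat N * (\<Sum>k<n. dhat d k * cnj (dhat e k)) = (\<Sum>t\<in>{0..<int p}. dft p (pat d) t * cnj (dft p (pat e) t))"
    unfolding dft_pat[OF assms(1,2)] dft_pat[OF assms(3,4)] sum_units[symmetric] by (intro sum.cong refl) simp
  also have "\<dots> = (\<Sum>h\<in>{0..<int p}. pat d h * cnj (pat e h))" by (rule dft_Parseval[OF p_pos])
  also have "\<dots> = of_nat N * (\<Sum>k<n. d ! k * cnj (e ! k))"
    unfolding sum_units[symmetric] by (intro sum.cong refl) (simp add: pat_def)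
  finally show ?thesis using N_pos by simp
qed

lemma unimodular_inner:
  assumes "length d = n" "unimodular d"
  shows "(\<Sum>k<n. d ! k * cnj (d ! k)) = of_nat n"
proof -
  have "d ! k * cnj (d ! k) = 1" if "k < n" for k
    using assms that unfolding complex_norm_square[symmetric] by (simp add: unimodular_def)
  thus ?thesis by simp
qed

lemma norm_dhat_le:
  assumes d: "length d = n" "balanced d" "unimodular d" and k: "k < n"
  shows "cmod (dhat d k) \<le> sqrt n"
proof -
  have "complex_of_real (\<Sum>k<n. (cmod (dhat d k))\<^sup>2) = of_real (real n)"
    unfolding of_real_sum complex_norm_square using dhat_inner[OF d(1,2) d(1,2)] unimodular_inner[OF d(1,3)] by simp
  hence "(\<Sum>k<n. (cmod (dhat d k))\<^sup>2) = real n" by (simp only: of_real_eq_iff)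
  moreover have "(cmod (dhat d k))\<^sup>2 \<le> (\<Sum>k<n. (cmod (dhat d k))\<^sup>2)" using k by (intro member_le_sum) auto
  ultimately show ?thesis by (simp add: real_le_rsqrt)
qed

definition cseq :: "complex list \<Rightarrow> complex \<Rightarrow> int \<Rightarrow> complex" where
  "cseq d c h = pat d h + (if int p dvd h then c else 0)"

lemma cyc_seq_eq: "alpha p = a \<Longrightarrow> cyc_seq alpha p n d c = cseq d c"
  by (rule ext) (auto simp: cyc_seq_def cseq_def pat_def dvd_eq_mod_eq_0)

lemma cseq_mod: "cseq d c (h mod int p) = cseq d c h"
  by (simp add: cseq_def pat_mod dvd_mod_iff)

lemma dft_cseq: "dft p (cseq d c) t = dft p (pat d) t + c / of_real (sqrt p)"
proof -
  have "(\<Sum>h\<in>{0..<int p}. (if int p dvd h then c else 0) * ep (- of_int (h * t) / real p)) = (\<Sum>h\<in>{0..<int p}. if h = 0 then c else 0)"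
    using nonresidue_interval by (intro sum.cong refl) force
  also have "\<dots> = c" using p_pos by simp
  finally have "(\<Sum>h\<in>{0..<int p}. (if int p dvd h then c else 0) * ep (- of_int (h * t) / real p)) = c" .
  thus ?thesis by (simp only: dft_def cseq_def distrib_right sum.distrib add_divide_distrib)
qed

text \<open>A value at position 0 shifts the whole transform by the constant
  \<open>c / sqrt p\<close>, which is within the tolerance of \<open>perturbed_correlation\<close>.
  Plain and unimodularized instances are thus treated at once.\<close>

lemma dft_cseq_approx:
  assumes d: "length d = n" "balanced d" "unimodular d" and c: "cmod c \<le> 1"
  shows "cmod (dft p (cseq d c) t) \<le> sqrt n + 1"
    and "\<not> int p dvd t \<Longrightarrow> cmod (dft p (cseq d c) t - dhat d (cls t)) \<le> 1 / sqrt p"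
proof -
  have cs: "cmod (c / of_real (sqrt p)) \<le> 1 / sqrt p" using c by (simp add: norm_divide divide_right_mono)
  have "cmod (dft p (pat d) t) \<le> sqrt n"
    unfolding dft_pat[OF d(1,2)] using norm_dhat_le[OF d cls_less[of t]] by simp
  moreover have "1 / sqrt p \<le> 1" using p_gt1 by simp
  ultimately show "cmod (dft p (cseq d c) t) \<le> sqrt n + 1"
    unfolding dft_cseq using cs by (intro norm_triangle_le) linarith
  show "cmod (dft p (cseq d c) t - dhat d (cls t)) \<le> 1 / sqrt p" if "\<not> int p dvd t"
    using cs that unfolding dft_cseq dft_pat[OF d(1,2)] by simp
qed

end

lemma norm_rotated_spectrum:
  assumes q: "q > 0" and per: "\<And>h. u (h mod int q) = u h"
  shows "(cmod (spectrum2 q (rotation q u r) (2 * m)))\<^sup>2 = real q * (cmod (dft q u m))\<^sup>2"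
    and "(cmod (spectrum2 q (rotation q u r) (2 * m + 1)))\<^sup>2 = real q *
      (cmod (\<Sum>b\<in>{0..<int q}. dft q u (m + b) * (half_kernel q b * ep (of_int (b * r) / real q))))\<^sup>2"
proof -
  have "(cmod (of_real (sqrt q) * ep x * y))\<^sup>2 = real q * (cmod y)\<^sup>2" for x y
    using q by (simp add: norm_mult power_mult_distrib)
  thus "(cmod (spectrum2 q (rotation q u r) (2 * m)))\<^sup>2 = real q * (cmod (dft q u m))\<^sup>2"
    "(cmod (spectrum2 q (rotation q u r) (2 * m + 1)))\<^sup>2 = real q *
      (cmod (\<Sum>b\<in>{0..<int q}. dft q u (m + b) * (half_kernel q b * ep (of_int (b * r) / real q))))\<^sup>2"
    unfolding spectrum2_even[of q u, OF q per] spectrum2_odd[of q u, OF q per] by blast+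
qed

section \<open>Correlation energy of a pair of patterns\<close>

context cyclotomy
begin

lemma cnj_avg: "cnj (avg f) = avg (\<lambda>k. cnj (f k))"
  by (simp add: avg_def)

lemma corr_const_nonneg: "corr_const \<ge> 0"
  using charsum_const_nonneg[of n] unfolding corr_const_def equidist_const_def
  by (intro mult_nonneg_nonneg add_nonneg_nonneg) auto

text \<open>The weights with which the coincidence patterns \<open>b\<^sub>1 = b\<^sub>3, b\<^sub>2 = b\<^sub>4\<close> and \<open>b\<^sub>1 = b\<^sub>2 = b\<^sub>3 = b\<^sub>4\<close> of the four shifts
  enter; the other two patterns have weights \<open>1\<close> and \<open>\<delta>\<close>.\<close>

definition pair_third :: "complex list \<Rightarrow> complex list \<Rightarrow> real" where
  "pair_third d e = (cmod (avg (\<lambda>k. dhat d k * dhat e k)))\<^sup>2"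

definition pair_fourth :: "complex list \<Rightarrow> complex list \<Rightarrow> real" where
  "pair_fourth d e = (\<Sum>k<n. (cmod (dhat d k))\<^sup>2 * (cmod (dhat e k))\<^sup>2) / real n"

text \<open>Closed forms of \<open>|\<Sum>\<^sub>b K(b)\<^sup>2 e(bR/p)|\<^sup>2\<close> and \<open>\<Sum>\<^sub>b |K(b)| ^ 4\<close> for \<open>K = half_kernel p\<close>.\<close>

definition rot_weight :: "int \<Rightarrow> real" where
  "rot_weight R = ((2 * (of_int ((- R) mod int p) + 1) - real p) / real p)\<^sup>2"

definition kernel_fourth :: real where
  "kernel_fourth = 1 / 3 + 2 / (3 * (real p)\<^sup>2)"

text \<open>\<open>Te\<close> collects the even samples and \<open>To\<close> the odd ones, with
  main terms \<open>p * B4\<close> and \<open>p * R\<close>. Conjugates sit at the second and fourth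
  shift, so the pairing 12|34 has weight 1 by unimodularity, 14|23 has weight
  \<open>\<delta>\<close> by orthogonality, and 13|24 involves no conjugation and gives
  \<open>pair_third\<close>.\<close>

lemma cross_energy_estimate:
  assumes d: "length d = n" "balanced d" "unimodular d" and e: "length e = n" "balanced e" "unimodular e"
    and orth: "d \<noteq> e \<Longrightarrow> orthogonal_patterns d e" and r: "d = e \<Longrightarrow> r = r'"
    and c: "cmod c \<le> 1" "cmod c' \<le> 1"
  defines "\<delta> \<equiv> (if d = e then 1 else 0 :: real)"
    and "f \<equiv> rotation p (cseq d c) r" and "g \<equiv> rotation p (cseq e c') r'"
  shows "\<bar>(\<Sum>s\<in>{s. crosscorr f g s \<noteq> 0}. (cmod (crosscorr f g s))\<^sup>2) / (real p)\<^sup>2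
     - (pair_fourth d e + 1 + \<delta> + pair_third d e * rot_weight (r + r') + (pair_fourth d e - 1 - \<delta> - pair_third d e) * kernel_fourth) / 2\<bar>
    \<le> corr_const * (3 + 2 * ln p) ^ 4 / sqrt p"
proof -
  define I where "I = {0..<int p}"
  define u where "u = dft p (cseq d c)"
  define u' where "u' = dft p (cseq e c')"
  define B3 where "B3 = pair_third d e"
  define B4 where "B4 = pair_fourth d e"
  define Z where "Z b = half_kernel p b * ep (of_int (b * r) / real p)" for b
  define Z' where "Z' b = half_kernel p b * ep (of_int (b * r') / real p)" for b
  define \<epsilon> where "\<epsilon> = corr_const * sqrt p"
  define \<Lambda> where "\<Lambda> = 3 + 2 * ln (real p)"
  have \<Lambda>: "\<Lambda> \<ge> 1" using p_gt1 by (simp add: \<Lambda>_def)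
  have \<epsilon>: "\<epsilon> \<ge> 0" using corr_const_nonneg by (simp add: \<epsilon>_def)
  have n0: "(of_nat n :: complex) \<noteq> 0" using n_pos by simp

  have A12: "avg (\<lambda>k. dhat d k * cnj (dhat d k)) = 1"
    unfolding avg_def dhat_inner[OF d(1,2) d(1,2)] unimodular_inner[OF d(1,3)] using n0 by simp
  have A34: "avg (\<lambda>k. dhat e k * cnj (dhat e k)) = 1"
    unfolding avg_def dhat_inner[OF e(1,2) e(1,2)] unimodular_inner[OF e(1,3)] using n0 by simp
  have A14: "avg (\<lambda>k. dhat d k * cnj (dhat e k)) = of_real \<delta>"
  proof (cases "d = e")
    case True
    thus ?thesis using A12 by (simp add: \<delta>_def)
  next
    case False
    have "(\<Sum>k<n. dhat d k * cnj (dhat e k)) = 0"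
      unfolding dhat_inner[OF d(1,2) e(1,2)] using orth[OF False] d(1) by (simp add: orthogonal_patterns_def)
    thus ?thesis using False by (simp add: avg_def \<delta>_def)
  qed
  have A23: "avg (\<lambda>k. cnj (dhat d k) * dhat e k) = of_real \<delta>"
    using arg_cong[OF A14, of cnj] by (simp add: cnj_avg)
  have A1324: "avg (\<lambda>k. dhat d k * dhat e k) * avg (\<lambda>k. cnj (dhat d k) * cnj (dhat e k)) = of_real B3"
    unfolding B3_def pair_third_def complex_norm_square by (simp add: cnj_avg)
  have A4: "avg (\<lambda>k. dhat d k * cnj (dhat d k) * dhat e k * cnj (dhat e k)) = of_real B4"
    unfolding B4_def pair_fourth_def avg_def of_real_divide of_real_sum of_real_mult complex_norm_square
    by (simp add: mult.assoc)
  have \<delta>2: "complex_of_real \<delta> * of_real \<delta> = of_real \<delta>" by (simp add: \<delta>_def)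

  have Hb: "cmod ((\<Sum>m\<in>I. u (m + b1) * cnj (u (m + b2)) * u' (m + b3) * cnj (u' (m + b4)))
       - of_nat p * ((if b1 = b2 \<and> b3 = b4 then 1 else 0) + (if b1 = b4 \<and> b2 = b3 then of_real \<delta> else 0)
         + (if b1 = b3 \<and> b2 = b4 then of_real B3 else 0)
         + (if b1 = b2 \<and> b2 = b3 \<and> b3 = b4 then of_real B4 - 1 - of_real \<delta> - of_real B3 else 0))) \<le> \<epsilon>"
    if b: "{b1, b2, b3, b4} \<subseteq> I" for b1 b2 b3 b4
  proof -
    define v where "v x = cnj (u x)" for x
    define v' where "v' x = cnj (u' x)" for x
    define w where "w k = cnj (dhat d k)" for k
    define w' where "w' k = cnj (dhat e k)" for k
    note ap = dft_cseq_approx[OF d c(1), folded u_def] dft_cseq_approx[OF e c(2), folded u'_def]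
    have vb: "cmod (v x) \<le> sqrt n + 1" "cmod (v' x) \<le> sqrt n + 1" for x
      using ap(1)[of x] ap(3)[of x] by (simp_all add: v_def v'_def)
    have va: "cmod (v x - w (cls x)) \<le> 1 / sqrt p" "cmod (v' x - w' (cls x)) \<le> 1 / sqrt p" if "\<not> int p dvd x" for x
      using ap(2)[OF that] ap(4)[OF that] unfolding v_def v'_def w_def w'_def complex_cnj_diff[symmetric] complex_mod_cnj by blast+
    have wb: "cmod (dhat d k) \<le> sqrt n + 1" "cmod (w k) \<le> sqrt n + 1" "cmod (dhat e k) \<le> sqrt n + 1" "cmod (w' k) \<le> sqrt n + 1"
      if "k < n" for k using norm_dhat_le[OF d that] norm_dhat_le[OF e that] by (simp_all add: w_def w'_def)
    have bal: "avg (dhat d) = 0" "avg w = 0" "avg (dhat e) = 0" "avg w' = 0"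
      using avg_dhat[OF d(1,2)] avg_dhat[OF e(1,2)] unfolding w_def w'_def cnj_avg[symmetric] by simp_all
    have "cmod ((\<Sum>m\<in>{0..<int p}. u (m + b1) * v (m + b2) * u' (m + b3) * v' (m + b4))
     - of_nat p * ((if b1 = b2 \<and> b3 = b4 then avg (\<lambda>k. dhat d k * w k) * avg (\<lambda>k. dhat e k * w' k) else 0)
         + (if b1 = b4 \<and> b2 = b3 then avg (\<lambda>k. dhat d k * w' k) * avg (\<lambda>k. w k * dhat e k) else 0)
         + (if b1 = b3 \<and> b2 = b4 then avg (\<lambda>k. dhat d k * dhat e k) * avg (\<lambda>k. w k * w' k) else 0)
         + (if b1 = b2 \<and> b2 = b3 \<and> b3 = b4 then avg (\<lambda>k. dhat d k * w k * dhat e k * w' k)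
             - avg (\<lambda>k. dhat d k * w k) * avg (\<lambda>k. dhat e k * w' k)
             - avg (\<lambda>k. dhat d k * w' k) * avg (\<lambda>k. w k * dhat e k)
             - avg (\<lambda>k. dhat d k * dhat e k) * avg (\<lambda>k. w k * w' k) else 0))) \<le> corr_const * sqrt p"
      by (rule perturbed_correlation[of u v u' v' "dhat d" w "dhat e" w',
            OF ap(1) vb(1) ap(3) vb(2) wb(1) wb(2) wb(3) wb(4) ap(2) va(1) ap(4) va(2) b[unfolded I_def] bal])
    thus ?thesis unfolding w_def w'_def v_def v'_def A12 A34 A14 A23 A1324 A4 \<delta>2 I_def \<epsilon>_def mult_1_right .
  qed
  \<comment> \<open>The weights stay arbitrary because two choices are needed: a point mass for the
    even samples and the rotated kernel for the odd ones.\<close>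
  have Qx: "cmod (of_real (\<Sum>m\<in>I. (cmod (\<Sum>b\<in>I. u (m + b) * Y b))\<^sup>2 * (cmod (\<Sum>b\<in>I. u' (m + b) * Y' b))\<^sup>2)
     - of_nat p * (1 * of_real (\<Sum>b\<in>I. (cmod (Y b))\<^sup>2) * of_real (\<Sum>b\<in>I. (cmod (Y' b))\<^sup>2)
        + of_real \<delta> * of_real ((cmod (\<Sum>b\<in>I. Y b * cnj (Y' b)))\<^sup>2) + of_real B3 * of_real ((cmod (\<Sum>b\<in>I. Y b * Y' b))\<^sup>2)
        + (of_real B4 - 1 - of_real \<delta> - of_real B3) * of_real (\<Sum>b\<in>I. (cmod (Y b))\<^sup>2 * (cmod (Y' b))\<^sup>2)))
    \<le> \<epsilon> * ((\<Sum>b\<in>I. cmod (Y b))\<^sup>2 * (\<Sum>b\<in>I. cmod (Y' b))\<^sup>2)" for Y Y'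
    unfolding I_def by (rule quartic_expansion) (rule Hb[unfolded I_def])
  define R where "R = 1 + \<delta> + B3 * rot_weight (r + r') + (B4 - 1 - \<delta> - B3) * kernel_fourth"
  define Te where "Te = (\<Sum>m\<in>I. (cmod (u m))\<^sup>2 * (cmod (u' m))\<^sup>2)"
  define To where "To = (\<Sum>m\<in>I. (cmod (\<Sum>b\<in>I. u (m + b) * Z b))\<^sup>2 * (cmod (\<Sum>b\<in>I. u' (m + b) * Z' b))\<^sup>2)"
  have toreal: "\<bar>x - real p * y\<bar> \<le> z" if "cmod (of_real x - of_nat p * of_real y) \<le> z" for x y z
  proof -
    have "complex_of_real x - of_nat p * of_real y = of_real (x - real p * y)" by simp
    thus ?thesis using that by (simp only: norm_of_real)
  qed
  have Te: "\<bar>Te - real p * B4\<bar> \<le> \<epsilon>"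
  proof (rule toreal)
    \<comment> \<open>For a point mass every coincidence sum equals 1, so the four main terms
      telescope to \<open>B4\<close>.\<close>
    define D0 where "D0 b = (if b = 0 then 1 else 0 :: complex)" for b :: int
    have D0: "(\<Sum>b\<in>I. h b * D0 b) = h 0" for h
    proof -
      have "(\<Sum>b\<in>I. h b * D0 b) = (\<Sum>b\<in>I. if b = 0 then h b else 0)" by (rule sum.cong) (auto simp: D0_def)
      thus ?thesis using p_pos by (simp add: I_def)
    qed
    have D0': "(\<Sum>b\<in>I. if b = 0 then 1 else 0 :: real) = 1" using p_pos by (simp add: I_def)
    have s1: "(\<Sum>b\<in>I. (cmod (D0 b))\<^sup>2) = 1" by (rule trans[OF sum.cong[OF refl] D0']) (auto simp: D0_def)
    have s2: "(\<Sum>b\<in>I. (cmod (D0 b))\<^sup>2 * (cmod (D0 b))\<^sup>2) = 1" by (rule trans[OF sum.cong[OF refl] D0']) (auto simp: D0_def)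
    have s3: "(\<Sum>b\<in>I. cmod (D0 b)) = 1" by (rule trans[OF sum.cong[OF refl] D0']) (auto simp: D0_def)
    have s4: "(\<Sum>b\<in>I. D0 b * cnj (D0 b)) = 1" using D0[of "\<lambda>b. cnj (D0 b)"] by (simp add: mult.commute D0_def)
    have s5: "(\<Sum>b\<in>I. D0 b * D0 b) = 1" using D0[of D0] by (simp add: D0_def)
    have Te_eq: "(\<Sum>m\<in>I. (cmod (\<Sum>b\<in>I. u (m + b) * D0 b))\<^sup>2 * (cmod (\<Sum>b\<in>I. u' (m + b) * D0 b))\<^sup>2) = Te"
      unfolding Te_def D0[of "\<lambda>b. u (_ + b)"] D0[of "\<lambda>b. u' (_ + b)"] by simp
    have "1 * of_real 1 * of_real 1 + of_real \<delta> * of_real ((cmod 1)\<^sup>2) + of_real B3 * of_real ((cmod 1)\<^sup>2)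
        + (of_real B4 - 1 - of_real \<delta> - of_real B3) * of_real 1 = complex_of_real B4" by simp
    thus "cmod (of_real Te - of_nat p * of_real B4) \<le> \<epsilon>"
      using Qx[of D0 D0, unfolded Te_eq s1 s2 s3 s4 s5] by simp
  qed
  have normZ: "cmod (Z b) = cmod (half_kernel p b)" "cmod (Z' b) = cmod (half_kernel p b)" for b
    by (simp_all add: Z_def Z'_def norm_mult)
  have To: "\<bar>To - real p * R\<bar> \<le> \<epsilon> * \<Lambda> ^ 4"
  proof (rule toreal)
    have s1: "(\<Sum>b\<in>I. (cmod (Z b))\<^sup>2) = 1" "(\<Sum>b\<in>I. (cmod (Z' b))\<^sup>2) = 1"
      unfolding normZ I_def by (rule sum_norm_half_kernel_sq[OF p_pos])+
    have s2: "(\<Sum>b\<in>I. (cmod (Z b))\<^sup>2 * (cmod (Z' b))\<^sup>2) = kernel_fourth"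
      using sum_norm_half_kernel_fourth[OF p_pos] unfolding normZ I_def kernel_fourth_def by (simp flip: power_add)
    have s3: "(cmod (\<Sum>b\<in>I. Z b * Z' b))\<^sup>2 = rot_weight (r + r')"
    proof -
      have "Z b * Z' b = (half_kernel p b)\<^sup>2 * ep (of_int (b * (r + r')) / real p)" for b
      proof -
        have "ep (of_int (b * r) / real p) * ep (of_int (b * r') / real p) = ep (of_int (b * (r + r')) / real p)"
          unfolding ep_add[symmetric] by (rule arg_cong[of _ _ ep]) (simp add: distrib_left add_divide_distrib)
        thus ?thesis by (simp add: Z_def Z'_def power2_eq_square mult_ac)
      qed
      thus ?thesis by (simp only: I_def half_kernel_square_transform[OF p_pos] rot_weight_def power_divide power2_abs)
    qed
    \<comment> \<open>The sum matters only for \<open>d = e\<close>. There both rotations agree, the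
      phases cancel, and it is the l2 norm 1 of the kernel.\<close>
    have s4: "complex_of_real \<delta> * of_real ((cmod (\<Sum>b\<in>I. Z b * cnj (Z' b)))\<^sup>2) = of_real \<delta>"
    proof (cases "d = e")
      case True
      hence "Z = Z'" using r by (auto simp: Z_def Z'_def)
      hence "(\<Sum>b\<in>I. Z b * cnj (Z' b)) = of_real (\<Sum>b\<in>I. (cmod (Z b))\<^sup>2)" by (simp only: of_real_sum complex_norm_square)
      thus ?thesis by (simp add: s1)
    qed (simp add: \<delta>_def)
    have "(\<Sum>b\<in>I. cmod (Z b)) \<le> \<Lambda>" "(\<Sum>b\<in>I. cmod (Z' b)) \<le> \<Lambda>"
      unfolding normZ I_def \<Lambda>_def by (rule sum_norm_half_kernel[OF p_gt1])+
    hence "(\<Sum>b\<in>I. cmod (Z b))\<^sup>2 * (\<Sum>b\<in>I. cmod (Z' b))\<^sup>2 \<le> \<Lambda>\<^sup>2 * \<Lambda>\<^sup>2"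
      by (intro mult_mono power_mono sum_nonneg) auto
    hence "(\<Sum>b\<in>I. cmod (Z b))\<^sup>2 * (\<Sum>b\<in>I. cmod (Z' b))\<^sup>2 \<le> \<Lambda> ^ 4" by (simp flip: power_add)
    hence le: "\<epsilon> * ((\<Sum>b\<in>I. cmod (Z b))\<^sup>2 * (\<Sum>b\<in>I. cmod (Z' b))\<^sup>2) \<le> \<epsilon> * \<Lambda> ^ 4"
      using \<epsilon> by (rule mult_left_mono)
    have "cmod (of_real To - of_nat p * (1 * of_real 1 * of_real 1 + of_real \<delta> + of_real B3 * of_real (rot_weight (r + r'))
       + (of_real B4 - 1 - of_real \<delta> - of_real B3) * of_real kernel_fourth)) \<le> \<epsilon> * ((\<Sum>b\<in>I. cmod (Z b))\<^sup>2 * (\<Sum>b\<in>I. cmod (Z' b))\<^sup>2)"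
      using Qx[of Z Z'] unfolding s1 s2 s3 s4 To_def .
    also have "1 * of_real 1 * of_real 1 + of_real \<delta> + of_real B3 * of_real (rot_weight (r + r'))
       + (of_real B4 - 1 - of_real \<delta> - of_real B3) * of_real kernel_fourth = complex_of_real R"
      by (simp add: R_def)
    finally show "cmod (of_real To - of_nat p * of_real R) \<le> \<epsilon> * \<Lambda> ^ 4" using le by linarith
  qed
  define En where "En = (\<Sum>s\<in>{s. crosscorr f g s \<noteq> 0}. (cmod (crosscorr f g s))\<^sup>2)"
  have "real (2 * p) * En = (\<Sum>k\<in>{0..<int (2 * p)}. (cmod (spectrum2 p f k))\<^sup>2 * (cmod (spectrum2 p g k))\<^sup>2)"
    unfolding En_def by (rule crosscorr_sampling[OF p_pos]) (auto simp: f_def g_def rotation_def)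
  also have "\<dots> = (real p)\<^sup>2 * (Te + To)"
    unfolding sum_even_odd f_def g_def norm_rotated_spectrum[of p "cseq d c", OF p_pos cseq_mod] norm_rotated_spectrum[of p "cseq e c'", OF p_pos cseq_mod]
      Te_def To_def u_def u'_def Z_def Z'_def I_def distrib_left sum_distrib_left
    by (simp add: power2_eq_square mult_ac)
  finally have En: "En / (real p)\<^sup>2 = (Te + To) / (2 * real p)" using p_pos by (simp add: field_simps)
  have "\<bar>(Te + To) / (2 * real p) - (B4 + R) / 2\<bar> = \<bar>(Te - real p * B4) + (To - real p * R)\<bar> / (2 * real p)"
  proof -
    have "(Te + To) / (2 * real p) - (B4 + R) / 2 = ((Te - real p * B4) + (To - real p * R)) / (2 * real p)"
      using p_pos by (simp add: field_simps)
    thus ?thesis by (simp only: abs_divide)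
  qed
  also have "\<dots> \<le> (\<epsilon> * \<Lambda> ^ 4 + \<epsilon> * \<Lambda> ^ 4) / (2 * real p)"
  proof (rule divide_right_mono)
    have "\<epsilon> * 1 \<le> \<epsilon> * \<Lambda> ^ 4" using \<epsilon> \<Lambda> by (intro mult_left_mono) auto
    thus "\<bar>(Te - real p * B4) + (To - real p * R)\<bar> \<le> \<epsilon> * \<Lambda> ^ 4 + \<epsilon> * \<Lambda> ^ 4" using Te To by linarith
  qed simp
  also have "\<dots> = corr_const * \<Lambda> ^ 4 * (sqrt p / real p)" by (simp add: \<epsilon>_def)
  also have "sqrt p / real p = 1 / sqrt p" using p_pos by (simp add: field_simps)
  finally have "\<bar>En / (real p)\<^sup>2 - (B4 + R) / 2\<bar> \<le> corr_const * \<Lambda> ^ 4 / sqrt p" unfolding En by simp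
  moreover have "B4 + R = pair_fourth d e + 1 + \<delta> + pair_third d e * rot_weight (r + r') + (pair_fourth d e - 1 - \<delta> - pair_third d e) * kernel_fourth"
    unfolding R_def B4_def B3_def by linarith
  ultimately show ?thesis unfolding En_def \<Lambda>_def by (simp only:)
qed

end

section \<open>Hadamard plans\<close>

context cyclotomy
begin

context
  fixes D :: "complex list set"
  assumes D: "hadamard_plan n D"
begin

lemma plan_facts:
  "finite D" "card D = n - 1"
  "d \<in> D \<Longrightarrow> length d = n" "d \<in> D \<Longrightarrow> balanced d" "d \<in> D \<Longrightarrow> unimodular d"
  "d \<in> D \<Longrightarrow> e \<in> D \<Longrightarrow> d \<noteq> e \<Longrightarrow> orthogonal_patterns d e"
  using D unfolding hadamard_plan_def by auto

lemma real_card_D: "real (card D) = real n - 1"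
  using plan_facts(2) n_pos by (simp add: of_nat_diff)

lemma dhat_orthogonal:
  assumes "d \<in> D" "e \<in> D"
  shows "(\<Sum>k<n. dhat d k * cnj (dhat e k)) = (if d = e then of_nat n else 0)"
proof (cases "d = e")
  case True
  thus ?thesis using dhat_inner[of d e] unimodular_inner[of d] plan_facts assms by simp
next
  case False
  thus ?thesis using dhat_inner[of d e] plan_facts assms by (simp add: orthogonal_patterns_def)
qed

text \<open>Adjoining the constant pattern to the transformed plan gives a full orthogonal basis, so
  the rows of the resulting square matrix are orthogonal as well.\<close>

lemma dhat_dual_orthogonality:
  assumes kl: "k < n" "l < n"
  shows "(\<Sum>d\<in>D. dhat d k * cnj (dhat d l)) = (if k = l then of_nat n else 0) - 1"
proof -
  define x where "x i k = (case i of None \<Rightarrow> 1 | Some d \<Rightarrow> dhat d k)" for i k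
  define J where "J = insert None (Some ` D)"
  have sum0: "(\<Sum>k<n. dhat d k) = 0" if "d \<in> D" for d
    using avg_dhat[of d] plan_facts(3,4)[OF that] n_pos by (simp add: avg_def)
  have "(\<Sum>i\<in>J. x i k * cnj (x i l)) = (if k = l then of_nat n else 0)"
  proof (rule dual_orthogonality[OF _ _ _ kl])
    show "finite J" using plan_facts(1) by (simp add: J_def)
    show "card J = n" using plan_facts(1,2) n_pos by (auto simp: J_def card_image)
    fix i j assume "i \<in> J" "j \<in> J"
    thus "(\<Sum>k<n. x i k * cnj (x j k)) = (if i = j then of_nat n else 0)"
    proof (cases i; cases j)
      fix d assume ij: "i = None" "j = Some d"
      hence "d \<in> D" using \<open>j \<in> J\<close> by (auto simp: J_def)
      thus ?thesis using ij arg_cong[OF sum0[of d], of cnj] by (simp add: x_def)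
    next
      fix d assume ij: "i = Some d" "j = None"
      hence "d \<in> D" using \<open>i \<in> J\<close> by (auto simp: J_def)
      thus ?thesis using ij sum0[of d] by (simp add: x_def)
    next
      fix d e assume ij: "i = Some d" "j = Some e"
      hence "d \<in> D" "e \<in> D" using \<open>i \<in> J\<close> \<open>j \<in> J\<close> by (auto simp: J_def)
      thus ?thesis using ij dhat_orthogonal[of d e] by (simp add: x_def)
    qed (simp add: x_def)
  qed
  moreover have "(\<Sum>i\<in>J. x i k * cnj (x i l)) = 1 + (\<Sum>d\<in>D. dhat d k * cnj (dhat d l))"
    unfolding J_def using plan_facts(1) by (subst sum.insert) (auto simp: x_def sum.reindex)
  ultimately show ?thesis by (simp add: algebra_simps)
qed

text \<open>\<open>pair_third d e\<close> is a squared coefficient of the conjugate of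
  \<open>dhat d\<close> in the orthogonal basis. Its component along the constant pattern vanishes,
  so the plan captures the full norm and each row sums to 1.\<close>

lemma sum_pair_third: "(\<Sum>d\<in>D. \<Sum>e\<in>D. pair_third d e) = real n - 1"
proof -
  have "(\<Sum>e\<in>D. pair_third d e) = 1" if d: "d \<in> D" for d
  proof -
    have n0: "(of_nat n :: complex) \<noteq> 0" using n_pos by simp
    have pe: "complex_of_real (pair_third d e) = (\<Sum>k<n. \<Sum>l<n. dhat d k * cnj (dhat d l) * (dhat e k * cnj (dhat e l))) / (of_nat n * of_nat n)" for e
      unfolding pair_third_def complex_norm_square avg_def complex_cnj_divide cnj_sum times_divide_times_eq sum_product
      by (simp add: mult_ac)
    have "complex_of_real (\<Sum>e\<in>D. pair_third d e) = (\<Sum>e\<in>D. \<Sum>k<n. \<Sum>l<n. dhat d k * cnj (dhat d l) * (dhat e k * cnj (dhat e l))) / (of_nat n * of_nat n)"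
      unfolding of_real_sum pe sum_divide_distrib[symmetric] ..
    also have "(\<Sum>e\<in>D. \<Sum>k<n. \<Sum>l<n. dhat d k * cnj (dhat d l) * (dhat e k * cnj (dhat e l))) =
       (\<Sum>k<n. \<Sum>e\<in>D. \<Sum>l<n. dhat d k * cnj (dhat d l) * (dhat e k * cnj (dhat e l)))" by (rule sum.swap)
    also have "\<dots> = (\<Sum>k<n. \<Sum>l<n. \<Sum>e\<in>D. dhat d k * cnj (dhat d l) * (dhat e k * cnj (dhat e l)))"
      by (intro sum.cong refl sum.swap)
    also have "\<dots> = (\<Sum>k<n. \<Sum>l<n. dhat d k * cnj (dhat d l) * ((if k = l then of_nat n else 0) - 1))"
      unfolding sum_distrib_left[symmetric] by (intro sum.cong refl) (simp add: dhat_dual_orthogonality)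
    also have "\<dots> = (\<Sum>k<n. \<Sum>l<n. if k = l then of_nat n * (dhat d k * cnj (dhat d k)) else 0) - (\<Sum>k<n. \<Sum>l<n. dhat d k * cnj (dhat d l))"
      unfolding sum_subtractf[symmetric] by (intro sum.cong refl) (auto simp: algebra_simps)
    also have "(\<Sum>k<n. \<Sum>l<n. if k = l then of_nat n * (dhat d k * cnj (dhat d k)) else 0) = of_nat n * of_nat n"
      using dhat_orthogonal[OF d d] by (simp add: sum_distrib_left[symmetric])
    also have "(\<Sum>k<n. \<Sum>l<n. dhat d k * cnj (dhat d l)) = (\<Sum>k<n. dhat d k) * (\<Sum>l<n. cnj (dhat d l))"
      by (simp add: sum_product)
    also have "(\<Sum>k<n. dhat d k) = 0"
      using avg_dhat[of d] plan_facts(3,4)[OF d] n_pos by (simp add: avg_def)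
    finally have "complex_of_real (\<Sum>e\<in>D. pair_third d e) = of_real 1" using n0 by simp
    thus ?thesis by (simp only: of_real_eq_iff)
  qed
  thus ?thesis by (simp add: real_card_D)
qed

lemma pair_third_bounds: "d \<in> D \<Longrightarrow> e \<in> D \<Longrightarrow> 0 \<le> pair_third d e \<and> pair_third d e \<le> real n - 1"
proof -
  assume de: "d \<in> D" "e \<in> D"
  have nn: "pair_third x y \<ge> 0" for x y by (simp add: pair_third_def)
  have "pair_third d e \<le> (\<Sum>e\<in>D. pair_third d e)" using de plan_facts(1) nn by (intro member_le_sum) auto
  also have "\<dots> \<le> (\<Sum>d\<in>D. \<Sum>e\<in>D. pair_third d e)"
    using de plan_facts(1) nn by (intro member_le_sum[of d D "\<lambda>d. \<Sum>e\<in>D. pair_third d e"] sum_nonneg) auto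
  finally show ?thesis using nn sum_pair_third by simp
qed

text \<open>By the diagonal case of dual orthogonality every class carries the same total
  \<open>n - 1\<close> of squared transform values.\<close>

lemma sum_pair_fourth: "(\<Sum>d\<in>D. \<Sum>e\<in>D. pair_fourth d e) = (real n - 1)\<^sup>2"
proof -
  have s: "(\<Sum>d\<in>D. (cmod (dhat d k))\<^sup>2) = real n - 1" if "k < n" for k
  proof -
    have "complex_of_real (\<Sum>d\<in>D. (cmod (dhat d k))\<^sup>2) = of_real (real n - 1)"
      unfolding of_real_sum complex_norm_square dhat_dual_orthogonality[OF that that] by simp
    thus ?thesis by (simp only: of_real_eq_iff)
  qed
  have "(\<Sum>d\<in>D. \<Sum>e\<in>D. pair_fourth d e) = (\<Sum>d\<in>D. \<Sum>e\<in>D. \<Sum>k<n. (cmod (dhat d k))\<^sup>2 * (cmod (dhat e k))\<^sup>2) / real n"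
    by (simp add: pair_fourth_def sum_divide_distrib[symmetric])
  also have "(\<Sum>d\<in>D. \<Sum>e\<in>D. \<Sum>k<n. (cmod (dhat d k))\<^sup>2 * (cmod (dhat e k))\<^sup>2) = (\<Sum>d\<in>D. \<Sum>k<n. \<Sum>e\<in>D. (cmod (dhat d k))\<^sup>2 * (cmod (dhat e k))\<^sup>2)"
    by (intro sum.cong refl sum.swap)
  also have "\<dots> = (\<Sum>k<n. \<Sum>d\<in>D. \<Sum>e\<in>D. (cmod (dhat d k))\<^sup>2 * (cmod (dhat e k))\<^sup>2)" by (rule sum.swap)
  also have "\<dots> = (\<Sum>k<n. (\<Sum>d\<in>D. (cmod (dhat d k))\<^sup>2) * (\<Sum>e\<in>D. (cmod (dhat e k))\<^sup>2))" by (simp only: sum_product)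
  also have "\<dots> = (\<Sum>k<n. (real n - 1) * (real n - 1))" by (intro sum.cong refl) (simp add: s)
  finally show ?thesis using n_pos by (simp add: power2_eq_square)
qed

text \<open>\<open>v\<close> is any candidate for the common limit of the rotation weights. The
  weights enter only multiplied by \<open>pair_third\<close>, whose total is \<open>n - 1\<close>,
  so replacing them by \<open>v\<close> costs their deviations.\<close>

lemma total_energy_estimate:
  fixes r :: "complex list \<Rightarrow> int" and c :: "complex list \<Rightarrow> complex" and v :: real
  assumes c: "\<And>d. d \<in> D \<Longrightarrow> cmod (c d) \<le> 1"
  defines "f \<equiv> \<lambda>d. rotation p (cseq d (c d)) (r d)"
  shows "\<bar>(\<Sum>d\<in>D. \<Sum>e\<in>D. (\<Sum>s\<in>{s. crosscorr (f d) (f e) s \<noteq> 0}. (cmod (crosscorr (f d) (f e) s))\<^sup>2) / (real p)\<^sup>2)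
      - ((real n - 1)\<^sup>2 + (real n - 1) * (1 - 2 * kernel_fourth + v) / 2)\<bar>
    \<le> (real n - 1)\<^sup>2 * (corr_const * (3 + 2 * ln p) ^ 4 / sqrt p)
      + (real n - 1) * (\<Sum>d\<in>D. \<Sum>e\<in>D. \<bar>rot_weight (r d + r e) - v\<bar>)"
proof -
  define E where "E d e = (\<Sum>s\<in>{s. crosscorr (f d) (f e) s \<noteq> 0}. (cmod (crosscorr (f d) (f e) s))\<^sup>2) / (real p)\<^sup>2" for d e
  define \<delta> where "\<delta> d e = (if d = e then 1 else 0 :: real)" for d e :: "complex list"
  define M where "M d e = (pair_fourth d e + 1 + \<delta> d e + pair_third d e * rot_weight (r d + r e) + (pair_fourth d e - 1 - \<delta> d e - pair_third d e) * kernel_fourth) / 2" for d e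
  define err where "err = corr_const * (3 + 2 * ln p) ^ 4 / sqrt p"
  have EM: "\<bar>E d e - M d e\<bar> \<le> err" if "d \<in> D" "e \<in> D" for d e
    unfolding E_def M_def \<delta>_def err_def f_def
    by (rule cross_energy_estimate) (use that plan_facts c in auto)
  have sum_bound: "\<bar>(\<Sum>d\<in>D. \<Sum>e\<in>D. F d e)\<bar> \<le> (\<Sum>d\<in>D. \<Sum>e\<in>D. \<bar>F d e\<bar>)" for F :: "complex list \<Rightarrow> complex list \<Rightarrow> real"
    by (rule order.trans[OF sum_abs sum_mono]) (rule sum_abs)
  have "\<bar>\<Sum>d\<in>D. \<Sum>e\<in>D. E d e - M d e\<bar> \<le> (\<Sum>d\<in>D. \<Sum>e\<in>D. err)"
    by (rule order.trans[OF sum_bound]) (intro sum_mono EM)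
  also have "\<dots> = (real n - 1)\<^sup>2 * err" by (simp add: real_card_D power2_eq_square)
  finally have 1: "\<bar>\<Sum>d\<in>D. \<Sum>e\<in>D. E d e - M d e\<bar> \<le> (real n - 1)\<^sup>2 * err" .
  have \<delta>_sum: "(\<Sum>d\<in>D. \<Sum>e\<in>D. \<delta> d e) = real n - 1"
    using plan_facts(1) by (simp add: \<delta>_def real_card_D)
  have one_sum: "(\<Sum>d\<in>D. \<Sum>e\<in>D. 1) = (real n - 1)\<^sup>2"
    by (simp add: real_card_D power2_eq_square)
  have Msum: "(\<Sum>d\<in>D. \<Sum>e\<in>D. M d e) = (real n - 1)\<^sup>2 + ((real n - 1) * (1 - 2 * kernel_fourth) + (\<Sum>d\<in>D. \<Sum>e\<in>D. pair_third d e * rot_weight (r d + r e))) / 2"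
    unfolding M_def sum_divide_distrib[symmetric] sum.distrib sum_subtractf sum_distrib_right[symmetric] sum_pair_third sum_pair_fourth \<delta>_sum one_sum
    by (simp add: field_simps)
  have "(\<Sum>d\<in>D. \<Sum>e\<in>D. pair_third d e * rot_weight (r d + r e)) - (real n - 1) * v =
     (\<Sum>d\<in>D. \<Sum>e\<in>D. pair_third d e * (rot_weight (r d + r e) - v))"
    unfolding sum_pair_third[symmetric] sum_distrib_right sum_subtractf[symmetric] by (simp add: right_diff_distrib)
  also have "\<bar>\<dots>\<bar> \<le> (\<Sum>d\<in>D. \<Sum>e\<in>D. (real n - 1) * \<bar>rot_weight (r d + r e) - v\<bar>)"
  proof (rule order.trans[OF sum_bound], intro sum_mono)
    fix d e assume "d \<in> D" "e \<in> D"
    from pair_third_bounds[OF this] show "\<bar>pair_third d e * (rot_weight (r d + r e) - v)\<bar> \<le> (real n - 1) * \<bar>rot_weight (r d + r e) - v\<bar>"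
      unfolding abs_mult by (intro mult_right_mono) auto
  qed
  also have "\<dots> = (real n - 1) * (\<Sum>d\<in>D. \<Sum>e\<in>D. \<bar>rot_weight (r d + r e) - v\<bar>)" by (simp only: sum_distrib_left)
  finally have 2: "\<bar>(\<Sum>d\<in>D. \<Sum>e\<in>D. pair_third d e * rot_weight (r d + r e)) - (real n - 1) * v\<bar>
     \<le> (real n - 1) * (\<Sum>d\<in>D. \<Sum>e\<in>D. \<bar>rot_weight (r d + r e) - v\<bar>)" .
  have "(\<Sum>d\<in>D. \<Sum>e\<in>D. E d e) = (\<Sum>d\<in>D. \<Sum>e\<in>D. E d e - M d e) + (\<Sum>d\<in>D. \<Sum>e\<in>D. M d e)"
    unfolding sum_subtractf by simp
  hence "(\<Sum>d\<in>D. \<Sum>e\<in>D. E d e) - ((real n - 1)\<^sup>2 + (real n - 1) * (1 - 2 * kernel_fourth + v) / 2) =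
    (\<Sum>d\<in>D. \<Sum>e\<in>D. E d e - M d e) + ((\<Sum>d\<in>D. \<Sum>e\<in>D. pair_third d e * rot_weight (r d + r e)) - (real n - 1) * v) / 2"
    unfolding Msum by (simp add: field_simps)
  moreover have "\<bar>x\<bar> \<le> X + Y" if "x = y + z / 2" "\<bar>y\<bar> \<le> X" "\<bar>z\<bar> \<le> Y" for x y z X Y :: real
    using that by linarith
  ultimately have "\<bar>(\<Sum>d\<in>D. \<Sum>e\<in>D. E d e) - ((real n - 1)\<^sup>2 + (real n - 1) * (1 - 2 * kernel_fourth + v) / 2)\<bar>
     \<le> (real n - 1)\<^sup>2 * err + (real n - 1) * (\<Sum>d\<in>D. \<Sum>e\<in>D. \<bar>rot_weight (r d + r e) - v\<bar>)"
    using 1 2 by blast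
  thus ?thesis unfolding E_def err_def .
qed

text \<open>The value depends on the sequence only through the modulus at position 0, which makes
  \<open>SDC\<close> an explicit function of \<open>p\<close>.\<close>

lemma energy:
  fixes r :: int and c :: complex
  assumes d: "d \<in> D"
  defines "f \<equiv> rotation p (cseq d c) r"
  shows "Re (crosscorr f f 0) = real p - 1 + (cmod c)\<^sup>2"
proof -
  have supp: "f j = 0" if "j \<notin> {0..<int p}" for j using that by (auto simp: f_def rotation_def)
  have un: "(cmod (pat d h))\<^sup>2 = (if int p dvd h then 0 else 1)" for h
    using plan_facts(3,5)[OF d] cls_less[of h] by (simp add: pat_def unimodular_def)
  have "crosscorr f f 0 = (\<Sum>j\<in>{0..<int p}. f (j + 0) * cnj (f j))" by (rule crosscorr_eq) (rule supp)
  also have "\<dots> = (\<Sum>j\<in>{0..<int p}. of_real ((cmod (cseq d c (r + j)))\<^sup>2))"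
    unfolding complex_norm_square by (intro sum.cong refl) (simp add: f_def rotation_def cseq_mod)
  also have "\<dots> = (\<Sum>j\<in>{0..<int p}. of_real ((cmod (cseq d c j))\<^sup>2))"
    by (rule periodic_sum_shift[OF p_pos]) (simp add: cseq_mod)
  finally have "Re (crosscorr f f 0) = (\<Sum>j\<in>{0..<int p}. (cmod (cseq d c j))\<^sup>2)" by simp
  also have "{0..<int p} = insert 0 {1..<int p}" using p_pos by auto
  also have "(\<Sum>j\<in>insert 0 {1..<int p}. (cmod (cseq d c j))\<^sup>2) = (cmod c)\<^sup>2 + (\<Sum>j\<in>{1..<int p}. 1)"
  proof (subst sum.insert)
    show "(cmod (cseq d c 0))\<^sup>2 + (\<Sum>j\<in>{1..<int p}. (cmod (cseq d c j))\<^sup>2) = (cmod c)\<^sup>2 + (\<Sum>j\<in>{1..<int p}. 1)"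
    proof (intro arg_cong2[of _ _ _ _ "(+)"] sum.cong refl)
      fix j assume "j \<in> {1..<int p}"
      hence "\<not> int p dvd j" unfolding nonresidue_interval[symmetric] by simp
      thus "(cmod (cseq d c j))\<^sup>2 = 1" using un[of j] by (simp add: cseq_def)
    qed (simp add: cseq_def pat_def)
  qed auto
  finally show ?thesis using p_pos by simp
qed

text \<open>A codebook is a set, so coinciding sequences would lower its cardinality. If two
  coincided, a product of pattern values would equal 1 on all of \<open>unit_shifts B\<close>,
  whereas equidistribution makes it average to nearly 0: by balance if the rotations differ modulo
  \<open>p\<close>, by orthogonality if they agree.\<close>

lemma rotations_distinct:
  assumes de: "d \<in> D" "e \<in> D" "d \<noteq> e" and big: "real p - 4 > equidist_const n * sqrt p"
  shows "rotation p (cseq d c) r \<noteq> rotation p (cseq e c') r'"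
proof
  assume eq: "rotation p (cseq d c) r = rotation p (cseq e c') r'"
  have same: "cseq d c (x + r) = cseq e c' (x + r')" if "x \<in> {0..<int p}" for x
    using fun_cong[OF eq, of x] that by (simp add: rotation_def cseq_mod add.commute)
  have prod1: "d ! cls (x + r) * cnj (e ! cls (x + r')) = 1" if x: "x \<in> {0..<int p}" "\<not> int p dvd x + r" "\<not> int p dvd x + r'" for x
  proof -
    have "d ! cls (x + r) = e ! cls (x + r')" using same[OF x(1)] x(2,3) by (simp add: cseq_def pat_def)
    moreover have "cmod (e ! cls (x + r')) = 1" using plan_facts(3,5)[OF de(2)] cls_less[OF x(3)] by (simp add: unimodular_def)
    ultimately show ?thesis using complex_norm_square[of "e ! cls (x + r')"] by simp
  qed
  have un: "cmod (d ! k) = 1" "cmod (e ! k) = 1" if "k < n" for k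
    using plan_facts(3,5)[OF de(1)] plan_facts(3,5)[OF de(2)] that by (auto simp: unimodular_def)
  have bal: "(\<Sum>k<n. d ! k) = 0"
    using plan_facts(3,4)[OF de(1)] by (simp add: balanced_def sum_list_sum_nth atLeast0LessThan)
  have orth: "(\<Sum>k<n. d ! k * cnj (e ! k)) = 0"
    using plan_facts(6)[OF de] plan_facts(3)[OF de(1)] by (simp add: orthogonal_patterns_def)
  obtain B v where B: "finite B" "card B \<le> 4" "inj_on (\<lambda>b. b mod int p) B"
    and v: "\<And>b k. b \<in> B \<Longrightarrow> k < n \<Longrightarrow> cmod (v b k :: complex) \<le> 1"
    and one: "\<And>x. x \<in> unit_shifts B \<Longrightarrow> (\<Prod>b\<in>B. v b (cls (x + b))) = 1"
    and zero: "(\<Prod>b\<in>B. (\<Sum>k<n. v b k) / of_nat n) = 0"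
  proof (cases "r mod int p = r' mod int p")
    case False
    define v where "v b k = (if b = r then d ! k else cnj (e ! k))" for b :: int and k
    have ne: "r \<noteq> r'" using False by auto
    show ?thesis
    proof (rule that[of "{r, r'}" v])
      show "cmod (v b k) \<le> 1" if "k < n" for b k using un[OF that] by (simp add: v_def)
      show "(\<Prod>b\<in>{r, r'}. v b (cls (x + b))) = 1" if "x \<in> unit_shifts {r, r'}" for x
        using prod1[of x] that ne by (simp add: v_def unit_shifts_def)
      show "(\<Prod>b\<in>{r, r'}. (\<Sum>k<n. v b k) / of_nat n) = 0" using bal ne by (simp add: v_def)
    qed (use False in \<open>auto simp: card_insert_if\<close>)
  next
    case True
    define v where "v b k = d ! k * cnj (e ! k)" for b :: int and k
    have "[r = r'] (mod int p)" using True by (simp add: Cong.cong_def)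
    hence cc: "[x + r = x + r'] (mod int p)" for x by (intro cong_add cong_refl)
    show ?thesis
    proof (rule that[of "{r}" v])
      show "cmod (v b k) \<le> 1" if "k < n" for b k using un[OF that] by (simp add: v_def norm_mult)
      show "(\<Prod>b\<in>{r}. v b (cls (x + b))) = 1" if "x \<in> unit_shifts {r}" for x
      proof -
        have x: "x \<in> {0..<int p}" "\<not> int p dvd x + r" using that by (simp_all add: unit_shifts_def)
        hence "\<not> int p dvd x + r'" using cong_dvd_iff[OF cc[of x]] by simp
        from prod1[OF x this] have "d ! cls (x + r) * cnj (e ! cls (x + r)) = 1" unfolding cls_cong[OF cc[of x]] .
        thus ?thesis by (simp add: v_def)
      qed
      show "(\<Prod>b\<in>{r}. (\<Sum>k<n. v b k) / of_nat n) = 0" using orth by (simp add: v_def)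
    qed auto
  qed
  have "cmod ((\<Sum>x\<in>unit_shifts B. \<Prod>b\<in>B. v b (cls (x + b))) - of_nat p * (\<Prod>b\<in>B. (\<Sum>k<n. v b k) / of_nat n))
     \<le> equidist_const n * sqrt p" by (rule cls_equidistribution[OF B v])
  moreover have "(\<Sum>x\<in>unit_shifts B. \<Prod>b\<in>B. v b (cls (x + b))) = of_nat (card (unit_shifts B))" using one by simp
  ultimately have "real (card (unit_shifts B)) \<le> equidist_const n * sqrt p" using zero by simp
  thus False using card_unit_shifts(2)[OF B(1,2)] big by linarith
qed

end

end

section \<open>The limit\<close>

text \<open>The parabola takes the same value at both ends of the period, so it is continuous across
  integers. Points at distance below 1 have at most one integer step between their floors; in that
  case both distances to the integer crossed add up to \<open>y - x\<close>.\<close>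

lemma frac_parabola_lipschitz:
  fixes x y :: real
  assumes "\<bar>x - y\<bar> < 1"
  shows "\<bar>(2 * frac x - 1)\<^sup>2 - (2 * frac y - 1)\<^sup>2\<bar> \<le> 4 * \<bar>x - y\<bar>"
proof -
  define g where "g t = t * (1 - t)" for t :: real
  have main: "\<bar>g (frac x) - g (frac y)\<bar> \<le> y - x" if xy: "x \<le> y" "y - x < 1" for x y
  proof (cases "\<lfloor>x\<rfloor> = \<lfloor>y\<rfloor>")
    case True
    have f: "frac y - frac x = y - x" using True by (simp add: frac_def)
    have "g (frac x) - g (frac y) = (frac y - frac x) * (frac x + frac y - 1)" by (simp add: g_def algebra_simps)
    hence "\<bar>g (frac x) - g (frac y)\<bar> = (y - x) * \<bar>frac x + frac y - 1\<bar>" using xy f by (simp add: abs_mult)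
    moreover have "\<bar>frac x + frac y - 1\<bar> \<le> 1"
      using frac_lt_1[of x] frac_lt_1[of y] frac_ge_0[of x] frac_ge_0[of y] by linarith
    hence "(y - x) * \<bar>frac x + frac y - 1\<bar> \<le> (y - x) * 1" using xy by (intro mult_left_mono) auto
    ultimately show ?thesis by simp
  next
    case False
    hence "\<lfloor>x\<rfloor> < \<lfloor>y\<rfloor>" using xy floor_mono[of x y] by linarith
    moreover have "\<lfloor>y\<rfloor> < \<lfloor>x\<rfloor> + 2" using xy by linarith
    ultimately have "\<lfloor>y\<rfloor> = \<lfloor>x\<rfloor> + 1" by linarith
    hence f: "(1 - frac x) + frac y = y - x" by (simp add: frac_def)
    have "0 \<le> g (frac x)" "g (frac x) \<le> 1 - frac x"
      using frac_lt_1[of x] frac_ge_0[of x] by (auto simp: g_def mult_left_le_one_le)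
    moreover have "0 \<le> g (frac y)" "g (frac y) \<le> frac y"
      using frac_lt_1[of y] frac_ge_0[of y] by (auto simp: g_def mult_right_le_one_le)
    moreover have "0 \<le> 1 - frac x" "0 \<le> frac y" using frac_lt_1[of x] by auto
    ultimately show ?thesis using f by linarith
  qed
  have sq: "(2 * t - 1)\<^sup>2 = 1 - 4 * g t" for t by (simp add: g_def power2_eq_square algebra_simps)
  have "\<bar>g (frac x) - g (frac y)\<bar> \<le> \<bar>x - y\<bar>"
    using main[of x y] main[of y x] assms by (cases "x \<le> y") auto
  moreover have "\<bar>1 - 4 * a - (1 - 4 * b)\<bar> \<le> 4 * t" if "\<bar>a - b\<bar> \<le> t" for a b t :: real
    using that by (simp add: abs_le_iff)
  ultimately show ?thesis unfolding sq by blast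
qed

lemma tendsto_frac_parabola:
  fixes X :: "'i \<Rightarrow> real"
  assumes "(X \<longlongrightarrow> \<theta>) G"
  shows "((\<lambda>i. (2 * frac (X i) - 1)\<^sup>2) \<longlongrightarrow> (2 * frac \<theta> - 1)\<^sup>2) G"
proof (rule Lim_transform_bound[of "\<lambda>i. (2 * frac (X i) - 1)\<^sup>2 - (2 * frac \<theta> - 1)\<^sup>2" "\<lambda>i. 4 * (X i - \<theta>)" for a, THEN LIM_zero_cancel])
  show "\<forall>\<^sub>F i in G. norm ((2 * frac (X i) - 1)\<^sup>2 - (2 * frac \<theta> - 1)\<^sup>2) \<le> norm (4 * (X i - \<theta>))"
  proof (rule eventually_mono[OF tendstoD[OF assms zero_less_one]])
    fix i assume "dist (X i) \<theta> < 1"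
    thus "norm ((2 * frac (X i) - 1)\<^sup>2 - (2 * frac \<theta> - 1)\<^sup>2) \<le> norm (4 * (X i - \<theta>))"
      using frac_parabola_lipschitz[of "X i" \<theta>] by (simp only: dist_real_def real_norm_def abs_mult abs_numeral)
  qed
  show "((\<lambda>i. 4 * (X i - \<theta>)) \<longlongrightarrow> 0) G"
    using tendsto_mult_right_zero[OF LIM_zero[OF assms], of 4] by simp
qed

lemma frac_parabola_minus: "(2 * frac (- x) - 1)\<^sup>2 = (2 * frac x - 1)\<^sup>2" for x :: real
proof (cases "x \<in> \<int>")
  case True
  thus ?thesis by (simp add: frac_eq_0_iff[THEN iffD2])
next
  case False
  thus ?thesis by (simp add: frac_neg power2_eq_square algebra_simps)
qed

text \<open>\<open>(- R) mod q / q\<close> is the fractional part of \<open>- R / q\<close>, and the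
  parabola is even. The summand 1 shifts the base of the square by \<open>2 / q\<close>
  only.\<close>

lemma rotation_weight_tendsto:
  fixes q :: "'i \<Rightarrow> nat" and R :: "'i \<Rightarrow> int"
  assumes q: "filterlim (\<lambda>i. real (q i)) at_top G" and R: "((\<lambda>i. of_int (R i) / real (q i)) \<longlongrightarrow> \<theta>) G"
  shows "((\<lambda>i. ((2 * (of_int ((- R i) mod int (q i)) + 1) - real (q i)) / real (q i))\<^sup>2) \<longlongrightarrow> (2 * frac \<theta> - 1)\<^sup>2) G"
proof -
  define s where "s i = 2 * frac (- (of_int (R i) / real (q i))) - 1" for i
  have q0: "\<forall>\<^sub>F i in G. q i > 0"
    using filterlim_at_top_dense[THEN iffD1, OF q, rule_format, of 0] by simp
  have inv: "((\<lambda>i. 2 / real (q i)) \<longlongrightarrow> 0) G"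
    by (rule tendsto_divide_0[OF tendsto_const filterlim_at_top_imp_at_infinity[OF q]])
  have s2: "((\<lambda>i. (s i)\<^sup>2) \<longlongrightarrow> (2 * frac \<theta> - 1)\<^sup>2) G"
    unfolding s_def using tendsto_frac_parabola[OF tendsto_minus[OF R]] by (simp only: frac_parabola_minus)
  have sle: "\<bar>s i\<bar> \<le> 1" for i
    using frac_lt_1[of "- (of_int (R i) / real (q i))"] frac_ge_0[of "- (of_int (R i) / real (q i))"] unfolding s_def by linarith
  have st: "((\<lambda>i. s i * (2 / real (q i))) \<longlongrightarrow> 0) G"
    by (rule Lim_transform_bound[OF _ inv]) (use sle in \<open>auto simp: abs_mult divide_right_mono mult_left_le_one_le intro!: always_eventually\<close>)
  have "((\<lambda>i. (s i)\<^sup>2 + 2 * (s i * (2 / real (q i))) + (2 / real (q i))\<^sup>2) \<longlongrightarrow> (2 * frac \<theta> - 1)\<^sup>2 + 2 * 0 + 0\<^sup>2) G"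
    by (intro tendsto_intros s2 st inv)
  moreover have "\<forall>\<^sub>F i in G. (s i)\<^sup>2 + 2 * (s i * (2 / real (q i))) + (2 / real (q i))\<^sup>2
     = ((2 * (of_int ((- R i) mod int (q i)) + 1) - real (q i)) / real (q i))\<^sup>2"
    using q0
  proof eventually_elim
    case (elim i)
    have "of_int ((- R i) mod int (q i)) / real (q i) = frac (- (of_int (R i) / real (q i)))"
    proof -
      have "of_int ((- R i) mod int (q i)) = real_of_int (- R i) - real (q i) * of_int ((- R i) div int (q i))"
        by (simp add: minus_mult_div_eq_mod[symmetric])
      moreover have "\<lfloor>- (of_int (R i) / real (q i))\<rfloor> = (- R i) div int (q i)"
        using floor_divide_of_int_eq[of "- R i" "int (q i)", where ?'a = real] by simp
      ultimately show ?thesis using elim by (simp add: frac_def field_simps)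
    qed
    hence "(2 * (of_int ((- R i) mod int (q i)) + 1) - real (q i)) / real (q i) = s i + 2 / real (q i)"
      using elim unfolding s_def by (simp add: field_simps)
    thus ?case by (simp add: power2_sum)
  qed
  ultimately show ?thesis by (simp add: tendsto_cong)
qed

section \<open>Minimum of the limit and conclusion\<close>

lemma Phi_minimum: "- 1 / 6 \<le> Phi x" and Phi_minimum_iff: "Phi x = - 1 / 6 \<longleftrightarrow> frac x = 1 / 2"
  by (simp_all add: Phi_def)

lemma frac_double_eq_half_iff: "frac (2 * x) = 1 / 2 \<longleftrightarrow> (\<exists>m::int. x = (2 * real_of_int m + 1) / 4)"
proof
  assume "frac (2 * x) = 1 / 2"
  hence "2 * x = real_of_int \<lfloor>2 * x\<rfloor> + 1 / 2" by (simp add: frac_def)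
  hence "x = (2 * real_of_int \<lfloor>2 * x\<rfloor> + 1) / 4" by simp
  thus "\<exists>m::int. x = (2 * real_of_int m + 1) / 4" by blast
next
  assume "\<exists>m::int. x = (2 * real_of_int m + 1) / 4"
  then obtain m :: int where "x = (2 * real_of_int m + 1) / 4" by blast
  hence "2 * x = of_int m + 1 / 2" by simp
  moreover have "frac (of_int m + 1 / 2 :: real) = 1 / 2" by (simp add: frac_unique_iff)
  ultimately show "frac (2 * x) = 1 / 2" by simp
qed

lemma log_power_over_sqrt_tendsto_0: "((\<lambda>x::real. (3 + 2 * ln x) ^ 4 / sqrt x) \<longlongrightarrow> 0) at_top"
  by real_asymp

theorem theorem1p2:
  fixes n :: nat and D :: "complex list set" and \<rho> :: real
    and alpha :: "nat \<Rightarrow> nat"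
    and p :: "'i \<Rightarrow> nat" and r :: "'i \<Rightarrow> complex list \<Rightarrow> int"
    and c :: "'i \<Rightarrow> complex list \<Rightarrow> complex"
  assumes n: "2 \<le> n"
    and alpha: "\<And>q. prime q \<Longrightarrow> residue_primroot q (alpha q)"
    and D: "hadamard_plan n D"
    and p_prime: "\<And>i. prime (p i) \<and> [p i = 1] (mod n)"
    and p_unbounded: "\<And>N. \<exists>i. p i > N"
    and r_lim: "\<And>d. d \<in> D \<Longrightarrow>
        ((\<lambda>i. real_of_int (r i d) / real (p i)) \<longlongrightarrow> \<rho>) (filtercomap (\<lambda>i. real (p i)) at_top)"
    and c: "(\<forall>i. \<forall>d\<in>D. c i d = 0) \<or> (\<forall>i. \<forall>d\<in>D. cmod (c i d) = 1)"
  shows "((\<lambda>i. CDF (family_codebook alpha n D (p i) (r i) (c i)))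
            \<longlongrightarrow> 1 + 1 / (3 * (real n - 1)) + Phi (2 * \<rho>) / (real n - 1))
           (filtercomap (\<lambda>i. SDC (family_codebook alpha n D (p i) (r i) (c i))) at_top)
     \<and> (\<forall>x::real. 1 + 1 / (6 * (real n - 1))
                  \<le> 1 + 1 / (3 * (real n - 1)) + Phi (2 * x) / (real n - 1))
     \<and> (\<forall>x::real. 1 + 1 / (3 * (real n - 1)) + Phi (2 * x) / (real n - 1)
                    = 1 + 1 / (6 * (real n - 1))
                  \<longleftrightarrow> (\<exists>m::int. x = (2 * real_of_int m + 1) / 4))"
proof (intro conjI allI)
  define m where "m = real n - 1"
  have m: "m > 0" using n by (simp add: m_def)
  \<comment> \<open>The common value of the squared moduli at position 0: 0 for instances, 1 for
    unimodularized ones.\<close>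
  define \<kappa> :: real where "\<kappa> = (if \<forall>i. \<forall>d\<in>D. c i d = 0 then 0 else 1)"
  have c2: "(cmod (c i d))\<^sup>2 = \<kappa>" if "d \<in> D" for i d using c that by (auto simp: \<kappa>_def)
  have \<kappa>: "0 \<le> \<kappa>" "\<kappa> \<le> 1" by (auto simp: \<kappa>_def)
  have c1: "cmod (c i d) \<le> 1" if "d \<in> D" for i d using c that by auto
  define N where "N i = (p i - 1) div n" for i
  define a where "a i = alpha (p i)" for i
  have cyc: "cyclotomy (p i) n (N i) (a i)" for i
  proof
    show "prime (p i)" "2 \<le> n" using p_prime n by auto
    show "residue_primroot (p i) (a i)" unfolding a_def using alpha p_prime by blast
    have "n dvd p i - 1" using p_prime[of i] prime_gt_0_nat[of "p i"]
      by (metis One_nat_def Suc_leI cong_altdef_nat cong_sym)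
    thus "n * N i + 1 = p i" using p_prime[of i] prime_gt_0_nat[of "p i"] by (simp add: N_def)
  qed
  define F where "F i d = rotation (p i) (cyclotomy.cseq (p i) n (a i) d (c i d)) (r i d)" for i d
  have book: "family_codebook alpha n D (p i) (r i) (c i) = F i ` D" for i
    unfolding family_codebook_def F_def
    by (rule image_cong[OF refl]) (simp add: cyclotomy.cyc_seq_eq[OF cyc[of i], of alpha] a_def)
  have energy: "Re (crosscorr (F i d) (F i d) 0) = real (p i) - 1 + \<kappa>" if "d \<in> D" for i d
    unfolding F_def cyclotomy.energy[OF cyc D that] using c2[OF that] by simp
  have fD: "finite D" and cardD: "real (card D) = m" and D_ne: "D \<noteq> {}"
  proof -
    show "finite D" using D by (simp add: hadamard_plan_def)
    show "real (card D) = m" using cyclotomy.real_card_D[OF cyc D] by (simp add: m_def)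
    thus "D \<noteq> {}" using m by auto
  qed
  \<comment> \<open>Along this filter \<open>SDC\<close> tends to infinity; as it equals
    \<open>p - 1 + \<kappa>\<close>, the primes do too, and the hypothesis on the rotations can be
    transported.\<close>
  define G where "G = filtercomap (\<lambda>i. SDC (family_codebook alpha n D (p i) (r i) (c i))) at_top"
  have SDC: "SDC (family_codebook alpha n D (p i) (r i) (c i)) = real (p i) - 1 + \<kappa>" for i
  proof -
    have "(\<lambda>f. Re (crosscorr f f 0)) ` F i ` D = {real (p i) - 1 + \<kappa>}"
      unfolding image_image using energy D_ne by (auto simp: image_iff)
    thus ?thesis by (simp add: SDC_def book)
  qed
  have plim: "filterlim (\<lambda>i. real (p i)) at_top G"
    unfolding G_def
  proof (rule filterlim_at_top_mono[OF filterlim_filtercomap])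
    show "\<forall>\<^sub>F i in filtercomap (\<lambda>i. SDC (family_codebook alpha n D (p i) (r i) (c i))) at_top.
        SDC (family_codebook alpha n D (p i) (r i) (c i)) \<le> real (p i)"
      using \<kappa> by (intro always_eventually) (simp add: SDC)
  qed
  have "G \<le> filtercomap (\<lambda>i. real (p i)) at_top" using plim by (simp add: filterlim_iff_le_filtercomap)
  hence rlim: "((\<lambda>i. real_of_int (r i d) / real (p i)) \<longlongrightarrow> \<rho>) G" if "d \<in> D" for d
    using r_lim[OF that] tendsto_mono by blast

  define v where "v = (2 * frac (2 * \<rho>) - 1)\<^sup>2"
  define X where "X i = (\<Sum>d\<in>D. \<Sum>e\<in>D. (\<Sum>s\<in>{s. crosscorr (F i d) (F i e) s \<noteq> 0}. (cmod (crosscorr (F i d) (F i e) s))\<^sup>2) / (real (p i))\<^sup>2)" for i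
  define K where "K i = 1 / 3 + 2 / (3 * (real (p i))\<^sup>2)" for i
  define w where "w i d e = ((2 * (of_int ((- (r i d + r i e)) mod int (p i)) + 1) - real (p i)) / real (p i))\<^sup>2" for i d e
  define C where "C = cyclotomy.corr_const n"
  have est: "\<bar>X i - (m\<^sup>2 + m * (1 - 2 * K i + v) / 2)\<bar> \<le> m\<^sup>2 * (C * ((3 + 2 * ln (p i)) ^ 4 / sqrt (p i)))
      + m * (\<Sum>d\<in>D. \<Sum>e\<in>D. \<bar>w i d e - v\<bar>)" for i
    using cyclotomy.total_energy_estimate[OF cyc[of i] D, where c = "c i" and v = v and r = "r i"] c1
    unfolding X_def F_def K_def w_def C_def m_def cyclotomy.kernel_fourth_def[OF cyc] cyclotomy.rot_weight_def[OF cyc]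
    by (simp add: v_def)
  have wlim: "((\<lambda>i. w i d e) \<longlongrightarrow> v) G" if "d \<in> D" "e \<in> D" for d e
  proof -
    have "((\<lambda>i. real_of_int (r i d) / real (p i) + real_of_int (r i e) / real (p i)) \<longlongrightarrow> \<rho> + \<rho>) G"
      by (intro tendsto_add rlim that)
    hence "((\<lambda>i. real_of_int (r i d + r i e) / real (p i)) \<longlongrightarrow> 2 * \<rho>) G" by (simp add: add_divide_distrib)
    from rotation_weight_tendsto[OF plim this] show ?thesis unfolding w_def v_def .
  qed
  have inv: "((\<lambda>i. 1 / real (p i)) \<longlongrightarrow> 0) G"
    by (rule tendsto_divide_0[OF tendsto_const filterlim_at_top_imp_at_infinity[OF plim]])
  have Klim: "(K \<longlongrightarrow> 1 / 3) G"
  proof -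
    have "((\<lambda>i. 1 / 3 + 2 / 3 * (1 / real (p i))\<^sup>2) \<longlongrightarrow> 1 / 3 + 2 / 3 * 0\<^sup>2) G" by (intro tendsto_intros inv)
    thus ?thesis unfolding K_def by (simp add: power_divide)
  qed
  have "((\<lambda>i. m\<^sup>2 * (C * ((3 + 2 * ln (p i)) ^ 4 / sqrt (p i))) + m * (\<Sum>d\<in>D. \<Sum>e\<in>D. \<bar>w i d e - v\<bar>))
     \<longlongrightarrow> m\<^sup>2 * (C * 0) + m * (\<Sum>d\<in>D. \<Sum>e\<in>D. \<bar>v - v\<bar>)) G"
    by (intro tendsto_intros wlim filterlim_compose[OF log_power_over_sqrt_tendsto_0 plim])
  hence errlim: "((\<lambda>i. m\<^sup>2 * (C * ((3 + 2 * ln (p i)) ^ 4 / sqrt (p i))) + m * (\<Sum>d\<in>D. \<Sum>e\<in>D. \<bar>w i d e - v\<bar>)) \<longlongrightarrow> 0) G" by simp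
  have "((\<lambda>i. X i - (m\<^sup>2 + m * (1 - 2 * K i + v) / 2)) \<longlongrightarrow> 0) G"
    by (rule Lim_null_comparison[OF _ errlim]) (use est in \<open>auto intro!: always_eventually\<close>)
  moreover have "((\<lambda>i. m\<^sup>2 + m * (1 - 2 * K i + v) / 2) \<longlongrightarrow> m\<^sup>2 + m * (1 - 2 * (1 / 3) + v) / 2) G"
    by (intro tendsto_intros Klim) simp
  ultimately have "((\<lambda>i. (X i - (m\<^sup>2 + m * (1 - 2 * K i + v) / 2)) + (m\<^sup>2 + m * (1 - 2 * K i + v) / 2)) \<longlongrightarrow> 0 + (m\<^sup>2 + m * (1 - 2 * (1 / 3) + v) / 2)) G"
    by (rule tendsto_add)
  hence Xlim: "(X \<longlongrightarrow> m\<^sup>2 + m * (1 / 3 + v) / 2) G" by simp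
  \<comment> \<open>The energies are \<open>p - 1 + \<kappa>\<close>, whereas \<open>X\<close> is
    normalised by p^2; this is the limit of the correcting factor.\<close>
  have ratio: "((\<lambda>i. (1 / (1 - (1 - \<kappa>) * (1 / real (p i))))\<^sup>2) \<longlongrightarrow> (1 / (1 - (1 - \<kappa>) * 0))\<^sup>2) G"
    by (intro tendsto_intros inv) simp
  have "((\<lambda>i. X i / m\<^sup>2 * (1 / (1 - (1 - \<kappa>) * (1 / real (p i))))\<^sup>2) \<longlongrightarrow> (m\<^sup>2 + m * (1 / 3 + v) / 2) / m\<^sup>2 * (1 / (1 - (1 - \<kappa>) * 0))\<^sup>2) G"
    by (intro tendsto_mult tendsto_divide Xlim ratio tendsto_const) (use m in simp)
  moreover have "\<forall>\<^sub>F i in G. X i / m\<^sup>2 * (1 / (1 - (1 - \<kappa>) * (1 / real (p i))))\<^sup>2 = CDF (family_codebook alpha n D (p i) (r i) (c i))"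
  proof -
    \<comment> \<open>Beyond this threshold \<open>sqrt p\<close> exceeds
      \<open>equidist_const n + 5\<close>, which gives the hypothesis \<open>big\<close> of
      \<open>rotations_distinct\<close>.\<close>
    define T where "T = (equidist_const n + 5)\<^sup>2"
    have "\<forall>\<^sub>F i in G. real (p i) > T" using plim by (simp add: filterlim_at_top_dense)
    thus ?thesis
    proof eventually_elim
      case (elim i)
      have ec: "equidist_const n \<ge> 0" using charsum_const_nonneg[of n] by (simp add: equidist_const_def)
      have p0: "real (p i) > 1" using p_prime[of i] prime_gt_1_nat[of "p i"] by simp
      have sq: "sqrt (p i) > equidist_const n + 5" using elim ec unfolding T_def by (intro real_less_rsqrt) auto
      have "(equidist_const n + 5) * sqrt (p i) \<le> sqrt (p i) * sqrt (p i)" using sq by (intro mult_right_mono) auto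
      hence "equidist_const n * sqrt (p i) + 5 * sqrt (p i) \<le> real (p i)" by (simp add: distrib_right)
      moreover have "sqrt (p i) \<ge> 1" using p0 by simp
      ultimately have big: "real (p i) - 4 > equidist_const n * sqrt (p i)" by linarith
      have inj: "inj_on (F i) D"
      proof (rule inj_onI, rule ccontr)
        fix d e assume de: "d \<in> D" "e \<in> D" "F i d = F i e" "d \<noteq> e"
        show False using cyclotomy.rotations_distinct[OF cyc D de(1,2,4) big] de(3) unfolding F_def by blast
      qed
      define \<nu> where "\<nu> = real (p i) - 1 + \<kappa>"
      have \<nu>: "\<nu> > 0" using p0 \<kappa> by (simp add: \<nu>_def)
      have "CDF (family_codebook alpha n D (p i) (r i) (c i)) = (\<Sum>d\<in>D. \<Sum>e\<in>D. CDF_pair (F i d) (F i e)) / m\<^sup>2"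
        unfolding CDF_def book using inj by (simp add: sum.reindex card_image cardD)
      also have "(\<Sum>d\<in>D. \<Sum>e\<in>D. CDF_pair (F i d) (F i e)) = (\<Sum>d\<in>D. \<Sum>e\<in>D. (\<Sum>s\<in>{s. crosscorr (F i d) (F i e) s \<noteq> 0}. (cmod (crosscorr (F i d) (F i e) s))\<^sup>2) / (real (p i))\<^sup>2 * ((real (p i))\<^sup>2 / \<nu>\<^sup>2))"
        using p0 by (intro sum.cong refl) (simp add: CDF_pair_def energy \<nu>_def[symmetric] power2_eq_square)
      also have "\<dots> = X i * ((real (p i))\<^sup>2 / \<nu>\<^sup>2)" by (simp only: X_def sum_distrib_right)
      also have "(real (p i))\<^sup>2 / \<nu>\<^sup>2 = (1 / (1 - (1 - \<kappa>) * (1 / real (p i))))\<^sup>2"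
      proof -
        have "1 - (1 - \<kappa>) * (1 / real (p i)) = \<nu> / real (p i)" using p0 by (simp add: \<nu>_def field_simps)
        thus ?thesis using \<nu> p0 by (simp add: power_divide)
      qed
      finally show ?case by simp
    qed
  qed
  ultimately have "((\<lambda>i. CDF (family_codebook alpha n D (p i) (r i) (c i))) \<longlongrightarrow> (m\<^sup>2 + m * (1 / 3 + v) / 2) / m\<^sup>2 * (1 / (1 - (1 - \<kappa>) * 0))\<^sup>2) G"
    by (simp add: tendsto_cong)
  \<comment> \<open>Uses \<open>v = 2 * Phi (2 * \<rho>) + 1 / 3\<close>.\<close>
  also have "(m\<^sup>2 + m * (1 / 3 + v) / 2) / m\<^sup>2 * (1 / (1 - (1 - \<kappa>) * 0))\<^sup>2 = 1 + 1 / (3 * m) + Phi (2 * \<rho>) / m"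
    using m by (simp add: v_def Phi_def field_simps power2_eq_square)
  finally show "((\<lambda>i. CDF (family_codebook alpha n D (p i) (r i) (c i)))
            \<longlongrightarrow> 1 + 1 / (3 * (real n - 1)) + Phi (2 * \<rho>) / (real n - 1))
           (filtercomap (\<lambda>i. SDC (family_codebook alpha n D (p i) (r i) (c i))) at_top)"
    unfolding G_def m_def .
next
  fix x :: real
  have m: "real n - 1 > 0" using n by simp
  have "1 + 1 / (3 * k) + y / k = 1 + 1 / (6 * k) + (y + 1 / 6) / k" if "k > 0" for k y :: real
    using that by (simp add: field_simps)
  note eq = this[OF m, of "Phi (2 * x)"]
  show "1 + 1 / (6 * (real n - 1)) \<le> 1 + 1 / (3 * (real n - 1)) + Phi (2 * x) / (real n - 1)"
    unfolding eq using Phi_minimum[of "2 * x"] m by simp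
  have "1 + 1 / (3 * (real n - 1)) + Phi (2 * x) / (real n - 1) = 1 + 1 / (6 * (real n - 1)) \<longleftrightarrow> Phi (2 * x) = - 1 / 6"
    unfolding eq using m by auto
  thus "1 + 1 / (3 * (real n - 1)) + Phi (2 * x) / (real n - 1) = 1 + 1 / (6 * (real n - 1))
      \<longleftrightarrow> (\<exists>m::int. x = (2 * real_of_int m + 1) / 4)"
    by (simp only: Phi_minimum_iff frac_double_eq_half_iff)
qed

end
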